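(* There exists a $0.067$-approximation algorithm for the fully static problem when customers and suppliers make choices according to multinomial-logit (MNL) models.
   Context: There are $n$ customers and $m$ suppliers. MNL choice models: customer $i\in[n]$ has preference weights $v_{ij}\ge 0$ for suppliers $j\in[m]$ and, when shown assortment $S\subseteq[m]$, chooses $j\in S$ with probability $v_{ij}/(1+\sum_{\ell\in S}v_{i\ell})$ and the outside option with probability $1/(1+\sum_{\ell\in S}v_{i\ell})$. Supplier $j\in[m]$ has preference weights $w_{ji}\ge0$ for customers $i\in[n]$ and, when shown $C\subseteq[n]$, chooses $i\in C$ with probability $w_{ji}/(1+\sum_{k\in C}w_{jk})$ and the outside option with probability $1/(1+\sum_{k\in C}w_{jk})$. Different agents may have different MNL models. Fully static problem: simultaneously show an assortment to every agent (any subset of the opposite side is allowed); all agents then choose independently, and $i,j$ match if they choose each other; maximize the expected number of matches. Since showing $j$ to $i$ without showing $i$ to $j$ is useless, the problem is $$\mathrm{OPT}_{FS}=\max_{\mathbf x\in\{0,1\}^{n\times m}}\ \sum_{i=1}^n\sum_{j=1}^m \frac{w_{ji}}{1+\sum_{k=1}^n w_{jk}x_{kj}}\cdot\frac{v_{ij}}{1+\sum_{\ell=1}^m v_{i\ell}x_{i\ell}}\cdot x_{ij}.$$ An $\alpha$-approximation algorithm runs in polynomial time and produces a feasible (possibly randomized) solution whose expected number of matches, over the agents' choices and the algorithm's randomization, is at least $\alpha\cdot\mathrm{OPT}_{FS}$. *)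

theory Defs
  imports
    "HOL-Probability.Probability"
    "HOL-Computational_Algebra.Polynomial"
    "HOL-Library.Log_Nat"
begin

section \<open>MNL choice and the fully static problem\<close>

text \<open>
  Customers are \<open>0, \<dots>, n - 1\<close> and suppliers \<open>0, \<dots>, m - 1\<close>. The weight of supplier \<open>j\<close> for
  customer \<open>i\<close> is \<open>v i j\<close>, that of customer \<open>i\<close> for supplier \<open>j\<close> is \<open>w j i\<close>.
  The value \<open>None\<close> of a choice is the outside option.
\<close>

definition mnl_prob :: "(nat \<Rightarrow> real) \<Rightarrow> nat set \<Rightarrow> nat option \<Rightarrow> real" where
  "mnl_prob u S c =
     (case c of
        None \<Rightarrow> 1 / (1 + (\<Sum>l\<in>S. u l))
      | Some j \<Rightarrow> if j \<in> S then u j / (1 + (\<Sum>l\<in>S. u l)) else 0)"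

definition mnl_choice :: "(nat \<Rightarrow> real) \<Rightarrow> nat set \<Rightarrow> nat option pmf" where
  "mnl_choice u S = embed_pmf (mnl_prob u S)"

definition matches :: "nat \<Rightarrow> nat \<Rightarrow> (nat \<Rightarrow> nat option) \<Rightarrow> (nat \<Rightarrow> nat option) \<Rightarrow> (nat \<times> nat) set"
  where "matches n m f g = {(i, j). i < n \<and> j < m \<and> f i = Some j \<and> g j = Some i}"

text \<open>
  Customer \<open>i\<close> is shown \<open>S i\<close>, supplier \<open>j\<close> is shown \<open>C j\<close>, and all agents choose independently.
\<close>

definition expected_matches ::
  "nat \<Rightarrow> nat \<Rightarrow> (nat \<Rightarrow> nat \<Rightarrow> real) \<Rightarrow> (nat \<Rightarrow> nat \<Rightarrow> real) \<Rightarrow>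
   (nat \<Rightarrow> nat set) \<Rightarrow> (nat \<Rightarrow> nat set) \<Rightarrow> real"
where
  "expected_matches n m v w S C =
     measure_pmf.expectation
       (pair_pmf (Pi_pmf {..<n} None (\<lambda>i. mnl_choice (v i) (S i)))
                 (Pi_pmf {..<m} None (\<lambda>j. mnl_choice (w j) (C j))))
       (\<lambda>(f, g). real (card (matches n m f g)))"

text \<open>Only the entries \<open>x i j\<close> with \<open>i < n\<close> and \<open>j < m\<close> of a solution are meaningful.\<close>

definition fs_solutions :: "nat \<Rightarrow> nat \<Rightarrow> (nat \<Rightarrow> nat \<Rightarrow> real) set" where
  "fs_solutions n m = {x. \<forall>i<n. \<forall>j<m. x i j \<in> {0, 1}}"

definition fs_objective ::
  "nat \<Rightarrow> nat \<Rightarrow> (nat \<Rightarrow> nat \<Rightarrow> real) \<Rightarrow> (nat \<Rightarrow> nat \<Rightarrow> real) \<Rightarrow> (nat \<Rightarrow> nat \<Rightarrow> real) \<Rightarrow> real"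
where
  "fs_objective n m v w x =
     (\<Sum>i<n. \<Sum>j<m. w j i / (1 + (\<Sum>k<n. w j k * x k j))
                  * (v i j / (1 + (\<Sum>l<m. v i l * x i l))) * x i j)"

definition OPT_FS :: "nat \<Rightarrow> nat \<Rightarrow> (nat \<Rightarrow> nat \<Rightarrow> real) \<Rightarrow> (nat \<Rightarrow> nat \<Rightarrow> real) \<Rightarrow> real" where
  "OPT_FS n m v w = Max (fs_objective n m v w ` fs_solutions n m)"

definition solution_matches ::
  "nat \<Rightarrow> nat \<Rightarrow> (nat \<Rightarrow> nat \<Rightarrow> real) \<Rightarrow> (nat \<Rightarrow> nat \<Rightarrow> real) \<Rightarrow> (nat \<Rightarrow> nat \<Rightarrow> real) \<Rightarrow> real"
where
  "solution_matches n m v w x =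
     expected_matches n m v w (\<lambda>i. {j. j < m \<and> x i j = 1}) (\<lambda>j. {i. i < n \<and> x i j = 1})"

lemma pmf_mnl_choice:
  assumes "finite S" and "\<And>l. l \<in> S \<Longrightarrow> 0 \<le> u l"
  shows "pmf (mnl_choice u S) c = mnl_prob u S c"
proof -
  let ?D = "1 + (\<Sum>l\<in>S. u l)"
  have D: "?D > 0"
    using sum_nonneg[of S u] assms by (simp add: add_pos_nonneg)
  have nn: "0 \<le> mnl_prob u S c" for c
    using D assms by (auto simp: mnl_prob_def split: option.split)
  have "(\<integral>\<^sup>+c. ennreal (mnl_prob u S c) \<partial>count_space UNIV) =
        (\<integral>\<^sup>+c. ennreal (mnl_prob u S c) * indicator (insert None (Some ` S)) c \<partial>count_space UNIV)"
    by (rule nn_integral_cong) (auto simp: mnl_prob_def indicator_def split: option.splits)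
  also have "\<dots> = (\<integral>\<^sup>+c. ennreal (mnl_prob u S c) \<partial>count_space (insert None (Some ` S)))"
    by (subst nn_integral_count_space_indicator[symmetric]) auto
  also have "\<dots> = (\<Sum>c\<in>insert None (Some ` S). ennreal (mnl_prob u S c))"
    using assms by (intro nn_integral_count_space_finite) auto
  also have "\<dots> = ennreal (\<Sum>c\<in>insert None (Some ` S). mnl_prob u S c)"
    using nn by (intro sum_ennreal) auto
  also have "(\<Sum>c\<in>insert None (Some ` S). mnl_prob u S c) =
             mnl_prob u S None + (\<Sum>l\<in>S. mnl_prob u S (Some l))"
    using assms by (subst sum.insert) (auto simp: sum.reindex)
  also have "\<dots> = 1 / ?D + (\<Sum>l\<in>S. u l / ?D)"
    by (simp add: mnl_prob_def)
  also have "\<dots> = 1"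
    using D by (simp add: sum_divide_distrib[symmetric] add_divide_distrib[symmetric])
  finally show ?thesis
    unfolding mnl_choice_def using nn by (intro pmf_embed_pmf) auto
qed

lemma expected_matches_eq:
  assumes v: "\<And>i j. i < n \<Longrightarrow> j < m \<Longrightarrow> 0 \<le> v i j"
    and w: "\<And>i j. i < n \<Longrightarrow> j < m \<Longrightarrow> 0 \<le> w j i"
    and S: "\<And>i. i < n \<Longrightarrow> S i \<subseteq> {..<m}" and C: "\<And>j. j < m \<Longrightarrow> C j \<subseteq> {..<n}"
  shows "expected_matches n m v w S C =
    (\<Sum>i<n. \<Sum>j<m. mnl_prob (v i) (S i) (Some j) * mnl_prob (w j) (C j) (Some i))"
proof -
  let ?P = "Pi_pmf {..<n} None (\<lambda>i. mnl_choice (v i) (S i))"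
  let ?Q = "Pi_pmf {..<m} None (\<lambda>j. mnl_choice (w j) (C j))"
  have card: "real (card (matches n m f g)) =
      (\<Sum>i<n. \<Sum>j<m. indicator ({f. f i = Some j} \<times> {g. g j = Some i}) (f, g))" for f g
  proof -
    have "real (card (matches n m f g)) = (\<Sum>p\<in>matches n m f g. 1)" by simp
    also have "\<dots> = (\<Sum>p\<in>{..<n} \<times> {..<m}. indicator (matches n m f g) p)"
      by (rule sum.mono_neutral_cong_left) (auto simp: matches_def indicator_def)
    also have "\<dots> = (\<Sum>p\<in>{..<n} \<times> {..<m}. case p of (i, j) \<Rightarrow>
                      indicator ({f. f i = Some j} \<times> {g. g j = Some i}) (f, g))"
      by (rule sum.cong) (auto simp: matches_def indicator_def)
    finally show ?thesis by (simp add: sum.cartesian_product)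
  qed
  have comp: "measure_pmf.prob (pair_pmf ?P ?Q) ({f. f i = Some j} \<times> {g. g j = Some i}) =
      mnl_prob (v i) (S i) (Some j) * mnl_prob (w j) (C j) (Some i)" if "i < n" "j < m" for i j
  proof -
    have fin: "finite (S i)" "finite (C j)"
      using that S[of i] C[of j] finite_subset by blast+
    have mp: "map_pmf (\<lambda>(f, g). (f i, g j)) (pair_pmf ?P ?Q) =
          pair_pmf (mnl_choice (v i) (S i)) (mnl_choice (w j) (C j))"
      using that by (simp add: map_pair Pi_pmf_component)
    have "measure_pmf.prob (pair_pmf ?P ?Q) ({f. f i = Some j} \<times> {g. g j = Some i}) =
          measure_pmf.prob (pair_pmf ?P ?Q) ((\<lambda>(f, g). (f i, g j)) -` {(Some j, Some i)})"
      by (rule arg_cong[where f = "measure_pmf.prob (pair_pmf ?P ?Q)"]) auto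
    also have "\<dots> = pmf (map_pmf (\<lambda>(f, g). (f i, g j)) (pair_pmf ?P ?Q)) (Some j, Some i)"
      by (simp add: pmf_map)
    also have "\<dots> = mnl_prob (v i) (S i) (Some j) * mnl_prob (w j) (C j) (Some i)"
      unfolding mp pmf_pair
      using that fin S[of i] C[of j] v w by (subst (1 2) pmf_mnl_choice) auto
    finally show ?thesis .
  qed
  have int: "integrable (measure_pmf (pair_pmf ?P ?Q)) (indicator A :: _ \<Rightarrow> real)" for A
    by (rule measure_pmf.integrable_const_bound[where B = 1]) auto
  have "expected_matches n m v w S C =
    measure_pmf.expectation (pair_pmf ?P ?Q)
      (\<lambda>p. \<Sum>i<n. \<Sum>j<m. indicator ({f. f i = Some j} \<times> {g. g j = Some i}) p)"
    unfolding expected_matches_def card by (rule Bochner_Integration.integral_cong) auto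
  also have "\<dots> = (\<Sum>i<n. \<Sum>j<m.
      measure_pmf.prob (pair_pmf ?P ?Q) ({f. f i = Some j} \<times> {g. g j = Some i}))"
    by (simp add: Bochner_Integration.integral_sum Bochner_Integration.integrable_sum int)
  also have "\<dots> = (\<Sum>i<n. \<Sum>j<m. mnl_prob (v i) (S i) (Some j) * mnl_prob (w j) (C j) (Some i))"
    by (intro sum.cong refl) (auto simp: comp)
  finally show ?thesis .
qed

lemma solution_matches_eq_objective:
  assumes v: "\<And>i j. i < n \<Longrightarrow> j < m \<Longrightarrow> 0 \<le> v i j"
    and w: "\<And>i j. i < n \<Longrightarrow> j < m \<Longrightarrow> 0 \<le> w j i"
    and x: "x \<in> fs_solutions n m"
  shows "solution_matches n m v w x = fs_objective n m v w x"
proof -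
  have 1: "(\<Sum>l<m. v i l * x i l) = (\<Sum>l\<in>{j. j < m \<and> x i j = 1}. v i l)" if "i < n" for i
    using x that by (intro sum.mono_neutral_cong_right) (auto simp: fs_solutions_def)
  have 2: "(\<Sum>k<n. w j k * x k j) = (\<Sum>k\<in>{i. i < n \<and> x i j = 1}. w j k)" if "j < m" for j
    using x that by (intro sum.mono_neutral_cong_right) (auto simp: fs_solutions_def)
  show ?thesis
    unfolding solution_matches_def fs_objective_def
  proof (subst expected_matches_eq, goal_cases)
    case 5
    show ?case
    proof (intro sum.cong refl)
      fix i j assume "i \<in> {..<n}" "j \<in> {..<m}"
      then have ij: "i < n" "j < m" by auto
      with x have "x i j = 0 \<or> x i j = 1" by (auto simp: fs_solutions_def)
      then show "mnl_prob (v i) {j. j < m \<and> x i j = 1} (Some j) *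
                 mnl_prob (w j) {i. i < n \<and> x i j = 1} (Some i) =
            w j i / (1 + (\<Sum>k<n. w j k * x k j)) * (v i j / (1 + (\<Sum>l<m. v i l * x i l))) * x i j"
        using ij by (auto simp: 1 2 mnl_prob_def mult.commute)
    qed
  qed (use v w in auto)
qed

lemma finite_fs_objectives: "finite (fs_objective n m v w ` fs_solutions n m)"
proof -
  define r where "r x = (\<lambda>(i, j) \<in> {..<n} \<times> {..<m}. x i j)" for x :: "nat \<Rightarrow> nat \<Rightarrow> real"
  have *: "fs_objective n m v w x = fs_objective n m v w (\<lambda>i j. r x (i, j))" for x
    unfolding fs_objective_def r_def by (intro sum.cong refl arg_cong2[where f = "(*)"]
      arg_cong2[where f = "(/)"] arg_cong2[where f = "(+)"]) auto
  have "r ` fs_solutions n m \<subseteq> ({..<n} \<times> {..<m}) \<rightarrow>\<^sub>E {0, 1}"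
  proof (rule image_subsetI, rule PiE_I)
    fix x p assume x: "x \<in> fs_solutions n m"
    show "r x p \<in> {0, 1}" if "p \<in> {..<n} \<times> {..<m}"
      using x that by (cases p) (auto simp: r_def fs_solutions_def)
    show "r x p = undefined" if "p \<notin> {..<n} \<times> {..<m}"
      using that by (simp only: r_def restrict_apply if_False)
  qed
  then have "finite (r ` fs_solutions n m)"
    by (rule finite_subset) (intro finite_PiE; simp)
  then have "finite ((\<lambda>y. fs_objective n m v w (\<lambda>i j. y (i, j))) ` r ` fs_solutions n m)"
    by (rule finite_imageI)
  then show ?thesis by (simp add: image_image *[symmetric])
qed

text \<open>
  Showing one agent of a pair to the other but not conversely never helps, so that \<open>OPT_FS\<close> is also
  an upper bound over all profiles of assortments.
\<close>

lemma expected_matches_le_OPT_FS: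
  assumes v: "\<And>i j. i < n \<Longrightarrow> j < m \<Longrightarrow> 0 \<le> v i j"
    and w: "\<And>i j. i < n \<Longrightarrow> j < m \<Longrightarrow> 0 \<le> w j i"
    and S: "\<And>i. i < n \<Longrightarrow> S i \<subseteq> {..<m}" and C: "\<And>j. j < m \<Longrightarrow> C j \<subseteq> {..<n}"
  shows "expected_matches n m v w S C \<le> OPT_FS n m v w"
proof -
  define x :: "nat \<Rightarrow> nat \<Rightarrow> real" where "x i j = (if j \<in> S i \<and> i \<in> C j then 1 else 0)" for i j
  have x: "x \<in> fs_solutions n m" by (auto simp: x_def fs_solutions_def)
  have mono: "mnl_prob u A (Some j) \<le> mnl_prob u B (Some j)"
    if "B \<subseteq> A" "finite A" "j \<in> B" "\<And>l. l \<in> A \<Longrightarrow> 0 \<le> u l" for u A B and j :: nat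
  proof -
    have "(\<Sum>l\<in>B. u l) \<le> (\<Sum>l\<in>A. u l)" using that by (intro sum_mono2) auto
    moreover have "0 \<le> (\<Sum>l\<in>B. u l)" using that by (intro sum_nonneg) auto
    ultimately show ?thesis using that by (auto simp: mnl_prob_def intro!: divide_left_mono)
  qed
  have nn: "0 \<le> mnl_prob u A (Some j)" if "\<And>l. l \<in> A \<Longrightarrow> 0 \<le> u l" for u A and j :: nat
    using that sum_nonneg[of A u] by (auto simp: mnl_prob_def)
  have "expected_matches n m v w S C \<le> solution_matches n m v w x"
  proof -
    have "expected_matches n m v w S C =
        (\<Sum>i<n. \<Sum>j<m. mnl_prob (v i) (S i) (Some j) * mnl_prob (w j) (C j) (Some i))"
      using v w S C by (rule expected_matches_eq)
    also have "\<dots> \<le> (\<Sum>i<n. \<Sum>j<m. mnl_prob (v i) {j. j < m \<and> x i j = 1} (Some j) *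
                              mnl_prob (w j) {i. i < n \<and> x i j = 1} (Some i))"
    proof (intro sum_mono)
      fix i j assume "i \<in> {..<n}" "j \<in> {..<m}"
      then have ij: "i < n" "j < m" by auto
      let ?S = "{j. j < m \<and> x i j = 1}" and ?C = "{i. i < n \<and> x i j = 1}"
      have sub: "?S \<subseteq> S i" "?C \<subseteq> C j" by (auto simp: x_def split: if_splits)
      have fin: "finite (S i)" "finite (C j)"
        using S[of i] C[of j] ij finite_subset by blast+
      have nv: "0 \<le> v i l" if "l \<in> S i" for l using S[of i] ij that v by auto
      have nw: "0 \<le> w j k" if "k \<in> C j" for k using C[of j] ij that w by auto
      show "mnl_prob (v i) (S i) (Some j) * mnl_prob (w j) (C j) (Some i) \<le>
            mnl_prob (v i) ?S (Some j) * mnl_prob (w j) ?C (Some i)"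
      proof (cases "j \<in> S i \<and> i \<in> C j")
        case True
        then have "x i j = 1" by (simp add: x_def)
        then show ?thesis
          using sub fin nv nw ij by (intro mult_mono mono nn) auto
      next
        case False
        then have "mnl_prob (v i) (S i) (Some j) * mnl_prob (w j) (C j) (Some i) = 0"
          by (auto simp: mnl_prob_def)
        also have "0 \<le> mnl_prob (v i) ?S (Some j) * mnl_prob (w j) ?C (Some i)"
          using sub nv nw by (intro mult_nonneg_nonneg nn) auto
        finally show ?thesis .
      qed
    qed
    also have "\<dots> = solution_matches n m v w x"
      unfolding solution_matches_def using v w by (intro expected_matches_eq[symmetric]) auto
    finally show ?thesis .
  qed
  also have "\<dots> = fs_objective n m v w x"
    using x v w by (intro solution_matches_eq_objective) auto
  also have "\<dots> \<le> OPT_FS n m v w"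
    unfolding OPT_FS_def using finite_fs_objectives x by (intro Max_ge) auto
  finally show ?thesis .
qed


section \<open>Randomized programs with logarithmic cost\<close>

text \<open>
  The model of computation is a random access machine with the logarithmic cost measure (Cook and
  Reckhow), presented as a structured language. The memory consists of integer arrays, of which a
  program mentions only finitely many; a scalar is a cell of an array. Every computed
  integer, in particular every address and every value read, is charged its bit length, so that a
  polynomial bound on the cost is the same as polynomial time on a Turing machine.
  Random bits are read from a tape of fair coin flips.
\<close>

datatype binop = Plus | Minus | Times | Quot | Rem | Less | Equal

datatype expr = Const int | Read string expr | Bin binop expr expr

datatype com =
    Skip
  | Write string expr expr  (* array, index, new contents *)
  | Flip string expr  (* array, index *)
  | Seq com com
  | Cond expr com com
  | While expr com

type_synonym memory = "string \<Rightarrow> int \<Rightarrow> int"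

fun apply_binop :: "binop \<Rightarrow> int \<Rightarrow> int \<Rightarrow> int" where
  "apply_binop Plus a b = a + b"
| "apply_binop Minus a b = a - b"
| "apply_binop Times a b = a * b"
| "apply_binop Quot a b = a div b"
| "apply_binop Rem a b = a mod b"
| "apply_binop Less a b = (if a < b then 1 else 0)"
| "apply_binop Equal a b = (if a = b then 1 else 0)"

fun eval_expr :: "memory \<Rightarrow> expr \<Rightarrow> int" where
  "eval_expr s (Const k) = k"
| "eval_expr s (Read a e) = s a (eval_expr s e)"
| "eval_expr s (Bin f e1 e2) = apply_binop f (eval_expr s e1) (eval_expr s e2)"

text \<open>The additional bit is for the sign; it also makes every operation cost at least 1.\<close>

definition bits :: "int \<Rightarrow> nat" where
  "bits z = 1 + nat (bitlen \<bar>z\<bar>)"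

fun expr_cost :: "memory \<Rightarrow> expr \<Rightarrow> nat" where
  "expr_cost s (Const k) = bits k"
| "expr_cost s (Read a e) = expr_cost s e + bits (eval_expr s (Read a e))"
| "expr_cost s (Bin f e1 e2) =
     expr_cost s e1 + expr_cost s e2 + bits (eval_expr s (Bin f e1 e2))"

definition store :: "memory \<Rightarrow> string \<Rightarrow> int \<Rightarrow> int \<Rightarrow> memory" where
  "store s a k z = s(a := (s a)(k := z))"

text \<open>
  \<open>exec c (s, r) t (s', r')\<close>: started in memory \<open>s\<close> with the random tape \<open>r\<close>, the program \<open>c\<close>
  terminates at cost \<open>t\<close> in memory \<open>s'\<close>, leaving the part \<open>r'\<close> of the tape unread. There is no
  such run if \<open>c\<close> diverges or attempts to read beyond the end of the tape.
\<close>

inductive exec :: "com \<Rightarrow> memory \<times> bool list \<Rightarrow> nat \<Rightarrow> memory \<times> bool list \<Rightarrow> bool" where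
  exec_Skip: "exec Skip (s, r) 1 (s, r)"
| exec_Write:
    "exec (Write a e1 e2) (s, r) (1 + expr_cost s e1 + expr_cost s e2)
          (store s a (eval_expr s e1) (eval_expr s e2), r)"
| exec_Flip:
    "exec (Flip a e) (s, b # r) (1 + expr_cost s e)
          (store s a (eval_expr s e) (if b then 1 else 0), r)"
| exec_Seq:
    "exec c1 (s, r) t1 (s', r') \<Longrightarrow> exec c2 (s', r') t2 (s'', r'') \<Longrightarrow>
     exec (Seq c1 c2) (s, r) (t1 + t2) (s'', r'')"
| exec_CondTrue:
    "eval_expr s e \<noteq> 0 \<Longrightarrow> exec c1 (s, r) t (s', r') \<Longrightarrow>
     exec (Cond e c1 c2) (s, r) (1 + expr_cost s e + t) (s', r')"
| exec_CondFalse: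
    "eval_expr s e = 0 \<Longrightarrow> exec c2 (s, r) t (s', r') \<Longrightarrow>
     exec (Cond e c1 c2) (s, r) (1 + expr_cost s e + t) (s', r')"
| exec_WhileFalse:
    "eval_expr s e = 0 \<Longrightarrow> exec (While e c) (s, r) (1 + expr_cost s e) (s, r)"
| exec_WhileTrue:
    "eval_expr s e \<noteq> 0 \<Longrightarrow> exec c (s, r) t1 (s', r') \<Longrightarrow>
     exec (While e c) (s', r') t2 (s'', r'') \<Longrightarrow>
     exec (While e c) (s, r) (1 + expr_cost s e + t1 + t2) (s'', r'')"

inductive_cases exec_elims:
  "exec Skip (s, r) t q" "exec (Write a e1 e2) (s, r) t q" "exec (Flip a e) (s, r) t q"
  "exec (Seq c1 c2) (s, r) t q" "exec (Cond e c1 c2) (s, r) t q" "exec (While e c) (s, r) t q"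

lemma exec_deterministic:
  "exec c p t q \<Longrightarrow> exec c p t' q' \<Longrightarrow> t' = t \<and> q' = q"
proof (induction arbitrary: t' q' rule: exec.induct)
  case (exec_Seq c1 s r t1 s' r' c2 t2 s'' r'')
  from exec_Seq.prems show ?case
    by (rule exec_elims(4)) (use exec_Seq.IH in fastforce)
next
  case (exec_WhileTrue s e c r t1 s' r' t2 s'' r'')
  from exec_WhileTrue.prems show ?case
    by (rule exec_elims(6)) (use exec_WhileTrue in fastforce)+
next
  case (exec_CondTrue s e c1 r t s' r' c2)
  from exec_CondTrue.prems show ?case
    by (rule exec_elims(5)) (use exec_CondTrue in fastforce)+
next
  case (exec_CondFalse s e c2 r t s' r' c1)
  from exec_CondFalse.prems show ?case
    by (rule exec_elims(5)) (use exec_CondFalse in fastforce)+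
qed (auto elim: exec_elims)

definition final_memory :: "com \<Rightarrow> memory \<Rightarrow> bool list \<Rightarrow> memory" where
  "final_memory c s r = (THE s'. \<exists>t r'. exec c (s, r) t (s', r'))"

lemma final_memory_eq: "exec c (s, r) t (s', r') \<Longrightarrow> final_memory c s r = s'"
  unfolding final_memory_def by (rule the_equality) (use exec_deterministic in blast)+


section \<open>Approximation algorithms for the fully static problem\<close>

text \<open>
  An input consists of \<open>n\<close>, \<open>m\<close> and the two weight matrices. As usual for polynomial time, the
  weights are rational numbers, given by numerator and denominator in binary. Matrices are stored
  by rows.
\<close>

definition mnl_instance ::
  "nat \<Rightarrow> nat \<Rightarrow> (nat \<Rightarrow> nat \<Rightarrow> rat) \<Rightarrow> (nat \<Rightarrow> nat \<Rightarrow> rat) \<Rightarrow> bool" where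
  "mnl_instance n m v w \<longleftrightarrow> (\<forall>i<n. \<forall>j<m. 0 \<le> v i j \<and> 0 \<le> w j i)"

definition real_weights :: "(nat \<Rightarrow> nat \<Rightarrow> rat) \<Rightarrow> nat \<Rightarrow> nat \<Rightarrow> real" where
  "real_weights u i j = real_of_rat (u i j)"

definition numerator :: "rat \<Rightarrow> int" where "numerator q = fst (quotient_of q)"

definition denominator :: "rat \<Rightarrow> int" where "denominator q = snd (quotient_of q)"

definition scalar_cells :: "int \<Rightarrow> int \<Rightarrow> int" where
  "scalar_cells z k = (if k = 0 then z else 0)"

definition matrix_cells :: "nat \<Rightarrow> nat \<Rightarrow> (nat \<Rightarrow> nat \<Rightarrow> int) \<Rightarrow> int \<Rightarrow> int" where
  "matrix_cells nr nc f k =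
     (if 0 \<le> k \<and> k < int (nr * nc) then f (nat k div nc) (nat k mod nc) else 0)"

definition input_memory ::
  "nat \<Rightarrow> nat \<Rightarrow> (nat \<Rightarrow> nat \<Rightarrow> rat) \<Rightarrow> (nat \<Rightarrow> nat \<Rightarrow> rat) \<Rightarrow> memory" where
  "input_memory n m v w = (\<lambda>a k. 0)
     (''n'' := scalar_cells (int n),
      ''m'' := scalar_cells (int m),
      ''vnum'' := matrix_cells n m (\<lambda>i j. numerator (v i j)),
      ''vden'' := matrix_cells n m (\<lambda>i j. denominator (v i j)),
      ''wnum'' := matrix_cells m n (\<lambda>j i. numerator (w j i)),
      ''wden'' := matrix_cells m n (\<lambda>j i. denominator (w j i)))"

definition input_size ::
  "nat \<Rightarrow> nat \<Rightarrow> (nat \<Rightarrow> nat \<Rightarrow> rat) \<Rightarrow> (nat \<Rightarrow> nat \<Rightarrow> rat) \<Rightarrow> nat" where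
  "input_size n m v w = n + m +
     (\<Sum>i<n. \<Sum>j<m. bits (numerator (v i j)) + bits (denominator (v i j))
                  + bits (numerator (w j i)) + bits (denominator (w j i)))"

definition output_solution :: "nat \<Rightarrow> memory \<Rightarrow> nat \<Rightarrow> nat \<Rightarrow> real" where
  "output_solution m s i j = real_of_int (s ''x'' (int (i * m + j)))"

text \<open>
  The program \<open>c\<close> is the same for all instances. Within the time bound \<open>T\<close> at most \<open>T\<close> coins can be
  flipped, so a uniformly random tape of length \<open>T\<close> suffices; time bound and feasibility are
  required for every tape. The inner expectation is over the choices of the agents, the outer one
  over the coin flips of the algorithm.
\<close>

definition approximation_algorithm :: "real \<Rightarrow> com \<Rightarrow> bool" where
  "approximation_algorithm \<alpha> c \<longleftrightarrow>
     (\<exists>p :: nat poly. \<forall>n m v w. mnl_instance n m v w \<longrightarrow>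
        (let T = poly p (input_size n m v w);
             tapes = {r :: bool list. length r = T};
             s = input_memory n m v w;
             x = (\<lambda>r. output_solution m (final_memory c s r))
         in (\<forall>r\<in>tapes. (\<exists>t s' r'. exec c (s, r) t (s', r') \<and> t \<le> T) \<and> x r \<in> fs_solutions n m) \<and>
            measure_pmf.expectation (pmf_of_set tapes)
              (\<lambda>r. solution_matches n m (real_weights v) (real_weights w) (x r))
            \<ge> \<alpha> * OPT_FS n m (real_weights v) (real_weights w)))"

end

theory Submission
  imports Defs
begin

text \<open>
  Write \<open>a = v / (1 + v)\<close> and \<open>b = w / (1 + w)\<close> for the two weights of an edge (a customer-supplier
  pair). For any solution, \<open>a\<close> times \<open>(1 + v) / (1 + V)\<close>, where \<open>V\<close> is the total weight shown to the
  customer, sums to at most 1 over the edges of that customer, and likewise for suppliers; hence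
  the optimum is bounded by a packing linear program with profits \<open>a b\<close> and sizes \<open>a\<close>, \<open>b\<close>. A
  local-ratio pass over the edges raises the dual variables of both endpoints by the residual profit
  \<open>h\<close> of the edge, and \<open>OPT\<close> is at most about \<open>2 \<Sum> h\<close>. Unwinding the edges in reverse order gives a
  fractional solution \<open>y\<close> with load at most \<open>c\<close> at every agent and \<open>\<Sum> y a b\<close> at least about \<open>c \<Sum> h\<close>.
  Including every edge independently with probability \<open>y\<close> retains a factor \<open>(1 - c)\<^sup>2\<close>, because
  \<open>(1 + v) / (1 + v + \<Sum> v\<^sub>l x\<^sub>l) \<ge> \<Prod> (1 - a\<^sub>l x\<^sub>l)\<close> for \<open>x\<^sub>l \<in> {0, 1}\<close> and the right-hand side is multi-affine.
  The resulting ratio \<open>c (1 - c)\<^sup>2 / 2\<close> is \<open>2/27 > 0.067\<close> at \<open>c = 1/3\<close>; the values \<open>22/64\<close> and \<open>21/64\<close>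
  around \<open>1/3\<close> leave room for rounding \<open>y\<close> to multiples of \<open>1/64\<close>, that is, to six coin flips per edge.
\<close>

section \<open>Local ratio for a packing relaxation\<close>

text \<open>Multiplying \<open>cover\<close> by \<open>x e * Y e * Z e\<close> makes its left side
  \<open>\<epsilon>\<close> times a term of the objective, as
  \<open>Y e * a e = v e / (1 + V e)\<close>. After exchanging the sums, \<open>h e\<close> is
  counted at most \<open>V e / (1 + V e)\<close> times through its row,
  \<open>W e / (1 + W e)\<close> times through its column and
  \<open>1 / (1 + V e) + 1 / (1 + W e)\<close> times through its own term, in total at most twice.
  The own term is \<open>2 - a e - b e\<close> because the sums over row and column already contain
  \<open>h e\<close> with the factors \<open>a e\<close> and \<open>b e\<close>; together they give
  \<open>2 * h e\<close>, which leaves a factor 2 for rounding \<open>h\<close>.\<close>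

lemma dual_bound:
  fixes v w x h :: "nat \<Rightarrow> real" and row col :: "nat \<Rightarrow> nat" and E :: "nat set"
  defines "a \<equiv> \<lambda>e. v e / (1 + v e)" and "b \<equiv> \<lambda>e. w e / (1 + w e)"
  defines "V \<equiv> \<lambda>e. \<Sum>e'\<in>E. of_bool (row e' = row e) * v e' * x e'"
  defines "W \<equiv> \<lambda>e. \<Sum>e'\<in>E. of_bool (col e' = col e) * w e' * x e'"
  assumes fin: "finite E"
    and v: "\<And>e. e \<in> E \<Longrightarrow> 0 \<le> v e" and w: "\<And>e. e \<in> E \<Longrightarrow> 0 \<le> w e"
    and h: "\<And>e. e \<in> E \<Longrightarrow> 0 \<le> h e"
    and x: "\<And>e. e \<in> E \<Longrightarrow> x e \<in> {0, 1}"
    and cover: "\<And>e. e \<in> E \<Longrightarrow> \<epsilon> * (a e * b e) \<le>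
        a e * (\<Sum>e'\<in>E. of_bool (row e' = row e) * h e') +
        b e * (\<Sum>e'\<in>E. of_bool (col e' = col e) * h e') + h e * (2 - a e - b e)"
  shows "\<epsilon> * (\<Sum>e\<in>E. v e / (1 + V e) * (w e / (1 + W e)) * x e) \<le> 2 * (\<Sum>e\<in>E. h e)"
proof -
  define Y where "Y e = (1 + v e) / (1 + V e)" for e
  define Z where "Z e = (1 + w e) / (1 + W e)" for e
  have x0: "0 \<le> x e" if "e \<in> E" for e using x[OF that] by auto
  have V0: "0 \<le> V e" and W0: "0 \<le> W e" for e
    unfolding V_def W_def using v w x0 by (auto intro!: sum_nonneg)
  have Vv: "v e \<le> V e" and Ww: "w e \<le> W e" if "e \<in> E" "x e = 1" for e
    using member_le_sum[of e E "\<lambda>e'. of_bool (row e' = row e) * v e' * x e'"]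
      member_le_sum[of e E "\<lambda>e'. of_bool (col e' = col e) * w e' * x e'"] that fin v w x0
    by (auto simp: V_def W_def)
  have Y0: "0 \<le> Y e" "0 \<le> Z e" if "e \<in> E" for e
    using V0[of e] W0[of e] v w that by (auto simp: Y_def Z_def)
  \<comment> \<open>Only for a chosen edge is \<open>v e\<close> a part of \<open>V e\<close>; all
    other edges carry the factor \<open>x e = 0\<close>.\<close>
  have Y1: "Y e \<le> 1" "Z e \<le> 1" if "e \<in> E" "x e = 1" for e
    using Vv[OF that] Ww[OF that] V0[of e] W0[of e] by (auto simp: Y_def Z_def)
  have Ya: "Y e * a e = v e / (1 + V e)" "Z e * b e = w e / (1 + W e)" if "e \<in> E" for e
    using v[OF that] w[OF that] by (auto simp: Y_def Z_def a_def b_def)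
  have Yc: "Y e * (1 - a e) = 1 / (1 + V e)" "Z e * (1 - b e) = 1 / (1 + W e)" if "e \<in> E" for e
    using v[OF that] w[OF that] by (auto simp: Y_def Z_def a_def b_def field_simps)
  have row: "(\<Sum>e\<in>E. x e * Y e * Z e * (a e * (\<Sum>e'\<in>E. of_bool (row e' = row e) * h e')))
      \<le> (\<Sum>e\<in>E. h e * (V e / (1 + V e)))"
  proof -
    have "(\<Sum>e\<in>E. x e * Y e * Z e * (a e * (\<Sum>e'\<in>E. of_bool (row e' = row e) * h e'))) =
        (\<Sum>e\<in>E. \<Sum>e'\<in>E. h e' * (of_bool (row e' = row e) * (x e * Z e * (Y e * a e))))"
      by (simp add: sum_distrib_left mult_ac)
    also have "\<dots> = (\<Sum>e'\<in>E. h e' * (\<Sum>e\<in>E. of_bool (row e' = row e) * (x e * Z e * (Y e * a e))))"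
      by (subst sum.swap) (simp add: sum_distrib_left)
    \<comment> \<open>The factor \<open>Z e\<close> is dropped; the edges of a row share the
      denominator \<open>1 + V e'\<close>, so their terms add up to
      \<open>V e' / (1 + V e')\<close>.\<close>
    also have "\<dots> \<le> (\<Sum>e'\<in>E. h e' * (\<Sum>e\<in>E. of_bool (row e = row e') * v e * x e / (1 + V e')))"
    proof (intro sum_mono mult_left_mono h)
      fix e' e assume e: "e' \<in> E" "e \<in> E"
      have "x e * Z e * (v e / (1 + V e)) \<le> x e * (v e / (1 + V e))"
        using x[of e] Y1[of e] e v[of e] V0[of e] mult_right_mono[of "Z e" 1 "v e / (1 + V e)"]
        by auto
      moreover have "V e = V e'" if "row e' = row e" using that by (simp add: V_def)
      ultimately show "of_bool (row e' = row e) * (x e * Z e * (Y e * a e))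
          \<le> of_bool (row e = row e') * v e * x e / (1 + V e')"
        using Ya e by (auto simp: mult_ac)
    qed
    also have "\<dots> = (\<Sum>e\<in>E. h e * (V e / (1 + V e)))"
      by (simp add: V_def sum_divide_distrib)
    finally show ?thesis .
  qed
  have col: "(\<Sum>e\<in>E. x e * Y e * Z e * (b e * (\<Sum>e'\<in>E. of_bool (col e' = col e) * h e')))
      \<le> (\<Sum>e\<in>E. h e * (W e / (1 + W e)))"
  proof -
    have "(\<Sum>e\<in>E. x e * Y e * Z e * (b e * (\<Sum>e'\<in>E. of_bool (col e' = col e) * h e'))) =
        (\<Sum>e\<in>E. \<Sum>e'\<in>E. h e' * (of_bool (col e' = col e) * (x e * Y e * (Z e * b e))))"
      by (simp add: sum_distrib_left mult_ac)
    also have "\<dots> = (\<Sum>e'\<in>E. h e' * (\<Sum>e\<in>E. of_bool (col e' = col e) * (x e * Y e * (Z e * b e))))"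
      by (subst sum.swap) (simp add: sum_distrib_left)
    also have "\<dots> \<le> (\<Sum>e'\<in>E. h e' * (\<Sum>e\<in>E. of_bool (col e = col e') * w e * x e / (1 + W e')))"
    proof (intro sum_mono mult_left_mono h)
      fix e' e assume e: "e' \<in> E" "e \<in> E"
      have "x e * Y e * (w e / (1 + W e)) \<le> x e * (w e / (1 + W e))"
        using x[of e] Y1[of e] e w[of e] W0[of e] mult_right_mono[of "Y e" 1 "w e / (1 + W e)"]
        by auto
      moreover have "W e = W e'" if "col e' = col e" using that by (simp add: W_def)
      ultimately show "of_bool (col e' = col e) * (x e * Y e * (Z e * b e))
          \<le> of_bool (col e = col e') * w e * x e / (1 + W e')"
        using Ya e by (auto simp: mult_ac)
    qed
    also have "\<dots> = (\<Sum>e\<in>E. h e * (W e / (1 + W e)))"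
      by (simp add: W_def sum_divide_distrib)
    finally show ?thesis .
  qed
  have "\<epsilon> * (\<Sum>e\<in>E. v e / (1 + V e) * (w e / (1 + W e)) * x e) =
      (\<Sum>e\<in>E. x e * Y e * Z e * (\<epsilon> * (a e * b e)))"
    by (auto simp: Ya[symmetric] sum_distrib_left mult_ac intro!: sum.cong)
  also have "\<dots> \<le> (\<Sum>e\<in>E. x e * Y e * Z e * (a e * (\<Sum>e'\<in>E. of_bool (row e' = row e) * h e') +
        b e * (\<Sum>e'\<in>E. of_bool (col e' = col e) * h e') + h e * (2 - a e - b e)))"
    using x0 Y0 by (intro sum_mono mult_left_mono cover) auto
  also have "\<dots> \<le> (\<Sum>e\<in>E. h e * (V e / (1 + V e))) + (\<Sum>e\<in>E. h e * (W e / (1 + W e))) +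
      (\<Sum>e\<in>E. x e * Y e * Z e * (h e * (2 - a e - b e)))"
    using row col by (simp add: distrib_left sum.distrib)
  also have "\<dots> = (\<Sum>e\<in>E. h e * (V e / (1 + V e) + W e / (1 + W e) + x e * Y e * Z e * (2 - a e - b e)))"
    by (simp add: distrib_left sum.distrib mult_ac)
  also have "\<dots> \<le> (\<Sum>e\<in>E. h e * 2)"
  proof (intro sum_mono mult_left_mono h)
    fix e assume e: "e \<in> E"
    have eq: "V e / (1 + V e) = 1 - Y e * (1 - a e)" "W e / (1 + W e) = 1 - Z e * (1 - b e)"
      unfolding Yc[OF e] using V0[of e] W0[of e] by (simp_all add: field_simps)
    have a1: "a e \<le> 1" "b e \<le> 1" using v[OF e] w[OF e] by (auto simp: a_def b_def)
    show "V e / (1 + V e) + W e / (1 + W e) + x e * Y e * Z e * (2 - a e - b e) \<le> 2"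
    proof (cases "x e = 1")
      case True
      \<comment> \<open>With \<open>2 - a e - b e\<close> split into
        \<open>(1 - a e) + (1 - b e)\<close>, each half fits into the gap that the row or the column
        term leaves below 1.\<close>
      have "Y e * Z e * (1 - a e) \<le> Y e * (1 - a e)" "Y e * Z e * (1 - b e) \<le> Z e * (1 - b e)"
        using Y0[OF e] Y1[OF e True] a1 by (auto intro!: mult_right_mono mult_left_le mult_left_le_one_le)
      then show ?thesis unfolding eq using True by (simp add: algebra_simps)
    next
      case False
      moreover have "V e / (1 + V e) \<le> 1" "W e / (1 + W e) \<le> 1"
        using V0[of e] W0[of e] by simp_all
      ultimately show ?thesis using x[OF e] by auto
    qed
  qed auto
  also have "\<dots> = 2 * (\<Sum>e\<in>E. h e)" by (simp add: sum_distrib_right[symmetric])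
  finally show ?thesis .
qed

text \<open>By \<open>profit\<close>, the value \<open>y e * (a e * b e)\<close> pays
  \<open>y e\<close> times for \<open>h e\<close> and in proportion to its sizes for all earlier
  raises at its endpoints. Seen from a raise \<open>h e\<close>, the payments amount to
  \<open>y e\<close> plus the loads that later edges put on the two endpoints, and
  \<open>full\<close> makes this at least \<open>c\<close>.\<close>

lemma charging_bound:
  fixes a b h y :: "nat \<Rightarrow> real" and row col :: "nat \<Rightarrow> nat"
  assumes a: "\<And>e. e < N \<Longrightarrow> a e \<in> {0..1}" and b: "\<And>e. e < N \<Longrightarrow> b e \<in> {0..1}"
    and h: "\<And>e. e < N \<Longrightarrow> 0 \<le> h e" and y: "\<And>e. e < N \<Longrightarrow> 0 \<le> y e"
    and profit: "\<And>e. e < N \<Longrightarrow> 0 < y e \<Longrightarrow>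
        h e + a e * (\<Sum>e'<e. of_bool (row e' = row e) * h e')
            + b e * (\<Sum>e'<e. of_bool (col e' = col e) * h e') \<le> a e * b e"
    and full: "\<And>e. e < N \<Longrightarrow> 0 < h e \<Longrightarrow> c \<le> y e \<or>
        c \<le> (\<Sum>e'\<in>{e..<N}. of_bool (row e' = row e) * (a e' * y e')) \<or>
        c \<le> (\<Sum>e'\<in>{e..<N}. of_bool (col e' = col e) * (b e' * y e'))"
  shows "c * (\<Sum>e<N. h e) \<le> (\<Sum>e<N. y e * (a e * b e))"
proof -
  \<comment> \<open>Double counting of the pairs \<open>e' < e\<close> at a common agent; it serves
    rows and columns alike.\<close>
  have swap: "(\<Sum>e<N. g e * (\<Sum>e'<e. of_bool (k e' = k e) * h e')) =
      (\<Sum>e'<N. h e' * (\<Sum>e\<in>{e'<..<N}. of_bool (k e = k e') * g e))" for g and k :: "nat \<Rightarrow> nat"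
  proof -
    have "(\<Sum>e<N. g e * (\<Sum>e'<e. of_bool (k e' = k e) * h e')) =
        (\<Sum>e<N. \<Sum>e'\<in>{e'\<in>{..<N}. e' < e}. h e' * (of_bool (k e' = k e) * g e))"
    proof (rule sum.cong)
      fix e assume "e \<in> {..<N}"
      then have "{e'\<in>{..<N}. e' < e} = {..<e}" by auto
      then show "g e * (\<Sum>e'<e. of_bool (k e' = k e) * h e') =
          (\<Sum>e'\<in>{e'\<in>{..<N}. e' < e}. h e' * (of_bool (k e' = k e) * g e))"
        unfolding sum_distrib_left by (intro sum.cong) (simp_all add: mult_ac)
    qed simp
    also have "\<dots> = (\<Sum>e'<N. \<Sum>e\<in>{e\<in>{..<N}. e' < e}. h e' * (of_bool (k e' = k e) * g e))"
      by (rule sum.swap_restrict) auto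
    also have "\<dots> = (\<Sum>e'<N. h e' * (\<Sum>e\<in>{e'<..<N}. of_bool (k e = k e') * g e))"
      unfolding sum_distrib_left by (intro sum.cong) auto
    finally show ?thesis .
  qed
  have "c * (\<Sum>e<N. h e) = (\<Sum>e<N. h e * c)" by (simp add: sum_distrib_left mult_ac)
  also have "\<dots> \<le> (\<Sum>e<N. h e * (y e + (\<Sum>e'\<in>{e<..<N}. of_bool (row e' = row e) * (a e' * y e'))
      + (\<Sum>e'\<in>{e<..<N}. of_bool (col e' = col e) * (b e' * y e'))))"
  proof (intro sum_mono)
    fix e assume "e \<in> {..<N}"
    then have e: "e < N" by simp
    have split: "{e..<N} = insert e {e<..<N}" using e by auto
    let ?R = "\<Sum>e'\<in>{e<..<N}. of_bool (row e' = row e) * (a e' * y e')"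
    let ?C = "\<Sum>e'\<in>{e<..<N}. of_bool (col e' = col e) * (b e' * y e')"
    have R: "0 \<le> ?R" "0 \<le> ?C" using a b y by (auto intro!: sum_nonneg)
    \<comment> \<open>The loads in \<open>full\<close> include the edge itself, the payments only
      strictly later edges; the difference is covered by the summand \<open>y e\<close>.\<close>
    have "a e * y e \<le> y e" "b e * y e \<le> y e"
      using a[OF e] b[OF e] y[OF e] by (auto intro!: mult_left_le_one_le)
    then have "c \<le> y e + ?R + ?C" if "0 < h e"
      using full[OF e that] R y[OF e] unfolding split by auto
    then show "h e * c \<le> h e * (y e + ?R + ?C)"
      using h[OF e] by (cases "h e = 0") (auto intro!: mult_left_mono)
  qed
  also have "\<dots> = (\<Sum>e<N. y e * h e + (a e * y e) * (\<Sum>e'<e. of_bool (row e' = row e) * h e')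
      + (b e * y e) * (\<Sum>e'<e. of_bool (col e' = col e) * h e'))"
    unfolding sum.distrib swap by (simp add: distrib_left sum.distrib mult_ac)
  also have "\<dots> \<le> (\<Sum>e<N. y e * (a e * b e))"
  proof (intro sum_mono)
    fix e assume "e \<in> {..<N}"
    then have e: "e < N" by simp
    let ?R = "\<Sum>e'<e. of_bool (row e' = row e) * h e'"
    let ?C = "\<Sum>e'<e. of_bool (col e' = col e) * h e'"
    have "y e * (h e + a e * ?R + b e * ?C) \<le> y e * (a e * b e)"
      using profit[OF e] y[OF e] by (cases "y e = 0") (auto intro!: mult_left_mono)
    then show "y e * h e + (a e * y e) * ?R + (b e * y e) * ?C \<le> y e * (a e * b e)"
      by (simp add: algebra_simps)
  qed
  finally show ?thesis .
qed

section \<open>Independent rounding with coin flips\<close>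

lemma one_plus_sum_le_prod:
  fixes f :: "'a \<Rightarrow> real"
  assumes "finite A" "\<And>x. x \<in> A \<Longrightarrow> 0 \<le> f x"
  shows "1 + sum f A \<le> (\<Prod>x\<in>A. 1 + f x)"
  using assms
proof (induction rule: finite_induct)
  case (insert x A)
  have "1 + sum f (insert x A) \<le> (1 + f x) * (1 + sum f A)"
    using insert sum_nonneg[of A f] by (simp add: algebra_simps)
  also have "\<dots> \<le> (1 + f x) * (\<Prod>x\<in>A. 1 + f x)"
    using insert by (intro mult_left_mono) auto
  finally show ?case using insert by simp
qed simp

text \<open>For \<open>x l\<close> in \<open>{0, 1}\<close> the factor
  \<open>1 - v l / (1 + v l) * x l\<close> is the inverse of \<open>1 + v l * x l\<close>, and the
  product of these denominators with \<open>1 + v e\<close> dominates the MNL denominator.\<close>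

lemma inverse_one_plus_sum_ge:
  fixes v x :: "nat \<Rightarrow> real"
  assumes "finite R" "e \<notin> R" "\<And>l. l \<in> insert e R \<Longrightarrow> 0 \<le> v l" "\<And>l. l \<in> R \<Longrightarrow> x l \<in> {0, 1}"
  shows "v e / (1 + v e) * (\<Prod>l\<in>R. 1 - v l / (1 + v l) * x l) \<le> v e / (1 + (v e + (\<Sum>l\<in>R. v l * x l)))"
proof -
  have nn: "0 \<le> (\<Sum>l\<in>R. v l * x l)" using assms by (fastforce intro!: sum_nonneg)
  have ve: "0 \<le> v e" using assms by auto
  have "1 + v e + (\<Sum>l\<in>R. v l * x l) \<le> (1 + v e) * (1 + (\<Sum>l\<in>R. v l * x l))"
    using ve nn by (simp add: algebra_simps)
  also have "\<dots> \<le> (1 + v e) * (\<Prod>l\<in>R. 1 + v l * x l)"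
    using assms ve by (intro mult_left_mono one_plus_sum_le_prod) fastforce+
  finally have le: "1 + (v e + (\<Sum>l\<in>R. v l * x l)) \<le> (1 + v e) * (\<Prod>l\<in>R. 1 + v l * x l)" by simp
  have "(\<Prod>l\<in>R. 1 - v l / (1 + v l) * x l) = (\<Prod>l\<in>R. inverse (1 + v l * x l))"
  proof (intro prod.cong refl)
    fix l assume "l \<in> R"
    with assms have "0 \<le> v l" "x l = 0 \<or> x l = 1" by auto
    then show "1 - v l / (1 + v l) * x l = inverse (1 + v l * x l)" by (auto simp: field_simps)
  qed
  also have "\<dots> = inverse (\<Prod>l\<in>R. 1 + v l * x l)" by (simp add: prod_inversef[symmetric] comp_def)
  finally have "v e / (1 + v e) * (\<Prod>l\<in>R. 1 - v l / (1 + v l) * x l) =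
      v e / ((1 + v e) * (\<Prod>l\<in>R. 1 + v l * x l))" by (simp add: field_simps)
  also have "\<dots> \<le> v e / (1 + (v e + (\<Sum>l\<in>R. v l * x l)))"
    using le nn ve by (intro divide_left_mono) (auto intro: less_le_trans[of 0 "1 + (v e + (\<Sum>l\<in>R. v l * x l))"])
  finally show ?thesis .
qed

section \<open>Blocks of fair coins as independent uniform numbers\<close>

fun coin_value :: "bool list \<Rightarrow> nat" where
  "coin_value [] = 0"
| "coin_value (b # r) = of_bool b + 2 * coin_value r"

lemma finite_tapes: "finite {r :: bool list. length r = k}"
  using finite_lists_length_eq[of "UNIV :: bool set" k] by simp

lemma card_tapes: "card {r :: bool list. length r = k} = 2 ^ k"
  using card_lists_length_eq[of "UNIV :: bool set" k] by simp

lemma sum_tapes_Suc: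
  fixes F :: "bool list \<Rightarrow> real"
  shows "(\<Sum>r | length r = Suc k. F r) = (\<Sum>r | length r = k. F (True # r) + F (False # r))"
proof -
  have "{r :: bool list. length r = Suc k} =
      (#) True ` {r. length r = k} \<union> (#) False ` {r. length r = k}"
    by (auto simp: length_Suc_conv)
  then have "(\<Sum>r | length r = Suc k. F r) =
      sum F ((#) True ` {r. length r = k}) + sum F ((#) False ` {r. length r = k})"
    by (simp only:) (rule sum.union_disjoint; auto simp: finite_tapes)
  then show ?thesis by (simp add: sum.reindex sum.distrib)
qed

lemma sum_tapes_add:
  fixes F :: "bool list \<Rightarrow> real"
  shows "(\<Sum>r | length r = k + l. F r) = (\<Sum>c | length c = k. \<Sum>r | length r = l. F (c @ r))"
  by (induction k arbitrary: F) (simp_all add: sum_tapes_Suc sum.distrib)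

text \<open>Lists of \<open>k\<close> bits represent every number below \<open>2 ^ k\<close> exactly
  once; the first bit separates odd from even numbers.\<close>

lemma sum_coin_value:
  fixes G :: "nat \<Rightarrow> real"
  shows "(\<Sum>r | length r = k. G (coin_value r)) = (\<Sum>z<2 ^ k. G z)"
proof (induction k arbitrary: G)
  case (Suc k)
  have "(\<Sum>r | length r = Suc k. G (coin_value r)) = (\<Sum>z<2 ^ k. G (1 + 2 * z) + G (2 * z))"
    using Suc[of "\<lambda>z. G (1 + 2 * z) + G (2 * z)"] by (simp add: sum_tapes_Suc)
  \<comment> \<open>The power is generalized to an arbitrary \<open>K\<close> so that pairs of an
    odd and an even number can be collected by induction on it.\<close>
  also have "\<dots> = (\<Sum>z<2 * K. G z)" if "K = 2 ^ k" for K
    unfolding that[symmetric] by (induction K) (simp_all add: algebra_simps)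
  finally show ?case by simp
qed simp

text \<open>This is the independence of disjoint blocks, stated by counting. The \<open>d\<close>
  trailing bits are there because the tape is as long as the time bound, not as long as the part
  that is read.\<close>

lemma sum_tapes_prod:
  fixes G :: "nat \<Rightarrow> bool list \<Rightarrow> real"
  shows "(\<Sum>r | length r = k * N + d. \<Prod>e<N. G e (take k (drop (k * e) r))) =
    2 ^ d * (\<Prod>e<N. \<Sum>c | length c = k. G e c)"
proof (induction N arbitrary: G)
  case 0
  show ?case by (simp add: card_tapes)
next
  case (Suc N)
  have "(\<Sum>r | length r = k * Suc N + d. \<Prod>e<Suc N. G e (take k (drop (k * e) r))) =
      (\<Sum>c | length c = k. \<Sum>r | length r = k * N + d.
        \<Prod>e<Suc N. G e (take k (drop (k * e) (c @ r))))"
    using sum_tapes_add[of _ k "k * N + d"] by (simp add: add_ac)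
  also have "\<dots> = (\<Sum>c | length c = k. G 0 c *
      (\<Sum>r | length r = k * N + d. \<Prod>e<N. G (Suc e) (take k (drop (k * e) r))))"
    by (intro sum.cong refl) (simp add: prod.lessThan_Suc_shift sum_distrib_left del: prod.lessThan_Suc)
  also have "\<dots> = 2 ^ d * (\<Prod>e<Suc N. \<Sum>c | length c = k. G e c)"
    unfolding Suc[of "\<lambda>e. G (Suc e)"] by (simp add: prod.lessThan_Suc_shift sum_distrib_right[symmetric] del: prod.lessThan_Suc)
  finally show ?case .
qed

lemma tapes_nonempty: "{r :: bool list. length r = T} \<noteq> {}"
  using card_tapes[of T] by (metis card.empty power_not_zero zero_neq_numeral)

lemma integrable_pmf_of_tapes:
  fixes F :: "bool list \<Rightarrow> real"
  shows "integrable (measure_pmf (pmf_of_set {r. length r = T})) F"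
  by (intro integrable_measure_pmf_finite) (subst set_pmf_of_set[OF tapes_nonempty finite_tapes], rule finite_tapes)

text \<open>Block \<open>e\<close> of the tape decides edge \<open>e\<close>, which is kept with
  probability \<open>Y e / 2 ^ k\<close> provided that \<open>Y e \<le> 2 ^ k\<close>.\<close>

definition rounded :: "nat \<Rightarrow> (nat \<Rightarrow> nat) \<Rightarrow> bool list \<Rightarrow> nat \<Rightarrow> real" where
  "rounded k Y r e = of_bool (coin_value (take k (drop (k * e) r)) < Y e)"

lemma expectation_prod_rounded:
  fixes g :: "nat \<Rightarrow> real \<Rightarrow> real"
  assumes Y: "\<And>e. e < N \<Longrightarrow> Y e \<le> 2 ^ k" and T: "k * N \<le> T"
  shows "measure_pmf.expectation (pmf_of_set {r. length r = T}) (\<lambda>r. \<Prod>e<N. g e (rounded k Y r e)) =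
    (\<Prod>e<N. Y e / 2 ^ k * g e 1 + (1 - Y e / 2 ^ k) * g e 0)"
proof -
  obtain d where d: "T = k * N + d" using T le_Suc_ex by blast
  have one: "(\<Sum>c | length c = k. g e (of_bool (coin_value c < Y e))) =
      2 ^ k * (Y e / 2 ^ k * g e 1 + (1 - Y e / 2 ^ k) * g e 0)" if e: "e < N" for e
  proof -
    have "(\<Sum>c | length c = k. g e (of_bool (coin_value c < Y e))) =
        (\<Sum>z<2 ^ k. g e (of_bool (z < Y e)))"
      by (rule sum_coin_value)
    also have "{..<2 ^ k} = {..<Y e} \<union> {Y e..<2 ^ k}" using Y[OF e] by auto
    also have "(\<Sum>z\<in>\<dots>. g e (of_bool (z < Y e))) =
        (\<Sum>z<Y e. g e 1) + (\<Sum>z\<in>{Y e..<2 ^ k}. g e 0)"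
      by (subst sum.union_disjoint) (auto intro!: arg_cong2[where f = "(+)"] sum.cong)
    also have "\<dots> = real (Y e) * g e 1 + (2 ^ k - real (Y e)) * g e 0"
      using Y[OF e] by (simp add: of_nat_diff)
    also have "\<dots> = 2 ^ k * (Y e / 2 ^ k * g e 1 + (1 - Y e / 2 ^ k) * g e 0)"
      by (simp add: field_simps)
    finally show ?thesis .
  qed
  have "measure_pmf.expectation (pmf_of_set {r. length r = T}) (\<lambda>r. \<Prod>e<N. g e (rounded k Y r e)) =
      (\<Sum>r | length r = T. \<Prod>e<N. g e (rounded k Y r e)) / 2 ^ T"
    by (subst integral_pmf_of_set[OF tapes_nonempty finite_tapes]) (simp add: card_tapes)
  also have "\<dots> = (2 ^ d * (\<Prod>e<N. 2 ^ k * (Y e / 2 ^ k * g e 1 + (1 - Y e / 2 ^ k) * g e 0))) / 2 ^ T"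
    unfolding d rounded_def by (subst sum_tapes_prod) (simp add: one)
  also have "\<dots> = (\<Prod>e<N. Y e / 2 ^ k * g e 1 + (1 - Y e / 2 ^ k) * g e 0)"
    by (simp add: d prod.distrib power_add power_mult)
  finally show ?thesis .
qed

lemma sum_split_self:
  fixes v x :: "nat \<Rightarrow> real"
  assumes "e < N"
  shows "(\<Sum>l<N. of_bool (k l = k e) * v l * x l) =
    v e * x e + (\<Sum>l\<in>{l. l < N \<and> l \<noteq> e \<and> k l = k e}. v l * x l)"
proof -
  have "(\<Sum>l<N. of_bool (k l = k e) * v l * x l) = (\<Sum>l\<in>{l. l < N \<and> k l = k e}. v l * x l)"
    by (rule sum.mono_neutral_cong_right) auto
  also have "{l. l < N \<and> k l = k e} = insert e {l. l < N \<and> l \<noteq> e \<and> k l = k e}"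
    using assms by auto
  finally show ?thesis by simp
qed

text \<open>The term of each edge is bounded below by a product with one factor per edge, affine in
  the corresponding variable. Independence then allows \<open>y\<close> to be substituted for the
  random bits, and the load bound \<open>c\<close> at either endpoint leaves a factor of at least
  \<open>1 - c\<close> for the competing edges there.\<close>

lemma rounding_bound:
  fixes v w :: "nat \<Rightarrow> real" and Y row col :: "nat \<Rightarrow> nat" and k N :: nat
  defines "a \<equiv> \<lambda>e. v e / (1 + v e)" and "b \<equiv> \<lambda>e. w e / (1 + w e)"
  defines "y \<equiv> \<lambda>e. real (Y e) / 2 ^ k"
  defines "f \<equiv> \<lambda>x. \<Sum>e<N. v e / (1 + (\<Sum>l<N. of_bool (row l = row e) * v l * x l)) *
      (w e / (1 + (\<Sum>l<N. of_bool (col l = col e) * w l * x l))) * x e"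
  assumes v: "\<And>e. e < N \<Longrightarrow> 0 \<le> v e" and w: "\<And>e. e < N \<Longrightarrow> 0 \<le> w e"
    and inj: "\<And>e l. e < N \<Longrightarrow> l < N \<Longrightarrow> row e = row l \<Longrightarrow> col e = col l \<Longrightarrow> e = l"
    and Y: "\<And>e. e < N \<Longrightarrow> Y e \<le> 2 ^ k" and T: "k * N \<le> T" and c: "c \<le> 1"
    and row: "\<And>e. e < N \<Longrightarrow> (\<Sum>l<N. of_bool (row l = row e) * (a l * y l)) \<le> c"
    and col: "\<And>e. e < N \<Longrightarrow> (\<Sum>l<N. of_bool (col l = col e) * (b l * y l)) \<le> c"
  shows "(1 - c)\<^sup>2 * (\<Sum>e<N. y e * (a e * b e)) \<le>
    measure_pmf.expectation (pmf_of_set {r. length r = T}) (\<lambda>r. f (rounded k Y r))"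
proof -
  define R where "R e = {l. l < N \<and> l \<noteq> e \<and> row l = row e}" for e
  define C where "C e = {l. l < N \<and> l \<noteq> e \<and> col l = col e}" for e
  define g where "g e l t = (if l = e then t else 1) *
      ((if l \<in> R e then 1 - a l * t else 1) * (if l \<in> C e then 1 - b l * t else 1))" for e l t
  have finR: "finite (R e)" "finite (C e)" for e by (auto simp: R_def C_def)
  have sub: "R e \<subseteq> {..<N}" "C e \<subseteq> {..<N}" for e by (auto simp: R_def C_def)
  have notin: "e \<notin> R e" "e \<notin> C e" for e by (auto simp: R_def C_def)
  \<comment> \<open>No edge other than \<open>e\<close> shares both endpoints with it, so
    \<open>g e l t\<close> never contains two factors depending on \<open>t\<close>.\<close>
  have disj: "R e \<inter> C e = {}" if "e < N" for e using inj that by (auto simp: R_def C_def)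
  have a01: "a e \<in> {0..1}" and b01: "b e \<in> {0..1}" if "e < N" for e
    using v[OF that] w[OF that] by (auto simp: a_def b_def)
  have y01: "y e \<in> {0..1}" if "e < N" for e
    using Y[OF that] by (simp add: y_def)
  have prod_g: "(\<Prod>l<N. g e l (x l)) = x e * ((\<Prod>l\<in>R e. 1 - a l * x l) * (\<Prod>l\<in>C e. 1 - b l * x l))"
    if "e < N" for e and x :: "nat \<Rightarrow> real"
  proof -
    have "(\<Prod>l<N. if l \<in> A then h l else 1) = prod h A" if "A \<subseteq> {..<N}" for A and h :: "nat \<Rightarrow> real"
      using that by (simp add: prod.inter_restrict[symmetric] Int_absorb1)
    then show ?thesis using that sub by (simp add: g_def prod.distrib)
  qed
  \<comment> \<open>An affine function averaged over 0 and 1 takes its value at the mean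
    \<open>y l\<close>.\<close>
  have mean: "(\<Prod>l<N. Y l / 2 ^ k * g e l 1 + (1 - Y l / 2 ^ k) * g e l 0) = (\<Prod>l<N. g e l (y l))"
    if "e < N" for e
    using disj[OF that] notin[of e] unfolding g_def y_def
    by (intro prod.cong refl) (auto simp: algebra_simps diff_divide_distrib)
  have point: "a e * b e * (\<Prod>l<N. g e l (x l)) \<le>
      v e / (1 + (\<Sum>l<N. of_bool (row l = row e) * v l * x l)) *
      (w e / (1 + (\<Sum>l<N. of_bool (col l = col e) * w l * x l))) * x e"
    if e: "e < N" and x: "\<And>l. x l \<in> {0, 1}" for e x
  proof (cases "x e = 1")
    case True
    have "a e * (\<Prod>l\<in>R e. 1 - a l * x l) \<le> v e / (1 + (v e + (\<Sum>l\<in>R e. v l * x l)))"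
      unfolding a_def using finR notin x v e by (intro inverse_one_plus_sum_ge) (auto simp: R_def)
    moreover have "b e * (\<Prod>l\<in>C e. 1 - b l * x l) \<le> w e / (1 + (w e + (\<Sum>l\<in>C e. w l * x l)))"
      unfolding b_def using finR notin x w e by (intro inverse_one_plus_sum_ge) (auto simp: C_def)
    moreover have "0 \<le> b e * (\<Prod>l\<in>C e. 1 - b l * x l)"
    proof (intro mult_nonneg_nonneg prod_nonneg ballI)
      show "0 \<le> b e" using b01[OF e] by simp
      show "0 \<le> 1 - b l * x l" if "l \<in> C e" for l
        using x[of l] b01[of l] that by (auto simp: C_def)
    qed
    moreover have "0 \<le> (\<Sum>l\<in>R e. v l * x l)"
    proof (intro sum_nonneg mult_nonneg_nonneg)
      show "0 \<le> v l" "0 \<le> x l" if "l \<in> R e" for l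
        using x[of l] v[of l] that by (auto simp: R_def)
    qed
    then have "0 \<le> v e / (1 + (v e + (\<Sum>l\<in>R e. v l * x l)))" using v[OF e] by simp
    ultimately have "(a e * (\<Prod>l\<in>R e. 1 - a l * x l)) * (b e * (\<Prod>l\<in>C e. 1 - b l * x l)) \<le>
        v e / (1 + (v e + (\<Sum>l\<in>R e. v l * x l))) * (w e / (1 + (w e + (\<Sum>l\<in>C e. w l * x l))))"
      by (intro mult_mono)
    then show ?thesis
      unfolding prod_g[OF e] sum_split_self[OF e] using True by (simp add: R_def C_def mult_ac)
  next
    case False
    then have "x e = 0" using x[of e] by auto
    then show ?thesis unfolding prod_g[OF e] by simp
  qed
  \<comment> \<open>The Weierstrass product inequality; omitting \<open>e\<close> itself can only
    lower the load.\<close>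
  have prob: "1 - c \<le> (\<Prod>l\<in>A. 1 - d l * y l)" if "(\<Sum>l<N. of_bool (k l = k e) * (d l * y l)) \<le> c"
     and "\<And>l. l < N \<Longrightarrow> d l \<in> {0..1}" and A: "A = {l. l < N \<and> l \<noteq> e \<and> k l = k e}" for A d e and k :: "nat \<Rightarrow> nat"
  proof -
    have dy: "0 \<le> d l * y l" "d l * y l \<le> 1" if "l < N" for l
      using y01[OF that] \<open>\<And>l. l < N \<Longrightarrow> d l \<in> {0..1}\<close>[OF that] by (auto intro: mult_le_one)
    have "(\<Sum>l\<in>A. d l * y l) = (\<Sum>l\<in>A. of_bool (k l = k e) * (d l * y l))"
      by (intro sum.cong) (auto simp: A)
    also have "\<dots> \<le> (\<Sum>l<N. of_bool (k l = k e) * (d l * y l))"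
      using dy by (intro sum_mono2) (auto simp: A)
    finally have "1 - c \<le> 1 - (\<Sum>l\<in>A. d l * y l)" using that by simp
    also have "\<dots> \<le> (\<Prod>l\<in>A. 1 - d l * y l)"
      using dy by (intro Weierstrass_prod_ineq) (auto simp: A)
    finally show ?thesis .
  qed
  have "(1 - c)\<^sup>2 * (\<Sum>e<N. y e * (a e * b e)) = (\<Sum>e<N. a e * b e * (y e * ((1 - c) * (1 - c))))"
    by (simp add: sum_distrib_left power2_eq_square mult_ac)
  also have "\<dots> \<le> (\<Sum>e<N. a e * b e * (\<Prod>l<N. g e l (y l)))"
  proof (intro sum_mono mult_left_mono)
    fix e assume "e \<in> {..<N}"
    then have e: "e < N" by simp
    have "(1 - c) * (1 - c) \<le> (\<Prod>l\<in>R e. 1 - a l * y l) * (\<Prod>l\<in>C e. 1 - b l * y l)"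
    proof (intro mult_mono prob[OF row[OF e]] prob[OF col[OF e]])
      show "0 \<le> (\<Prod>l\<in>R e. 1 - a l * y l)"
        using c prob[OF row[OF e] a01, of "R e"] by (simp add: R_def)
    qed (use c a01 b01 in \<open>auto simp: R_def C_def\<close>)
    then show "y e * ((1 - c) * (1 - c)) \<le> (\<Prod>l<N. g e l (y l))"
      unfolding prod_g[OF e] using y01[OF e] by (intro mult_left_mono) auto
    show "0 \<le> a e * b e" using a01[OF e] b01[OF e] by simp
  qed
  also have "\<dots> = (\<Sum>e<N. a e * b e * measure_pmf.expectation (pmf_of_set {r. length r = T})
      (\<lambda>r. \<Prod>l<N. g e l (rounded k Y r l)))"
    using mean by (intro sum.cong refl) (simp add: expectation_prod_rounded[OF Y T, where g = "g _"])
  also have "\<dots> = measure_pmf.expectation (pmf_of_set {r. length r = T})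
      (\<lambda>r. \<Sum>e<N. a e * b e * (\<Prod>l<N. g e l (rounded k Y r l)))"
    by (simp add: Bochner_Integration.integral_sum integrable_pmf_of_tapes)
  also have "\<dots> \<le> measure_pmf.expectation (pmf_of_set {r. length r = T}) (\<lambda>r. f (rounded k Y r))"
    unfolding f_def
    by (intro integral_mono integrable_pmf_of_tapes sum_mono point) (auto simp: rounded_def)
  finally show ?thesis .
qed

section \<open>Cost of programs on bounded memories\<close>

text \<open>A single exponent for all cells lets every cost be bounded by a constant multiple of
  it.\<close>

definition bounded_memory :: "nat \<Rightarrow> memory \<Rightarrow> bool" where
  "bounded_memory b s \<longleftrightarrow> (\<forall>a k. \<bar>s a k\<bar> \<le> 2 ^ b)"

lemma bounded_memory_mono: "bounded_memory b s \<Longrightarrow> b \<le> c \<Longrightarrow> bounded_memory c s"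
  unfolding bounded_memory_def by (meson order.trans power_increasing one_le_numeral)

lemma bounded_memory_store:
  "bounded_memory b s \<Longrightarrow> \<bar>z\<bar> \<le> 2 ^ b \<Longrightarrow> bounded_memory b (store s a k z)"
  by (simp add: bounded_memory_def store_def)

text \<open>The number \<open>2 ^ k\<close> itself has \<open>k + 1\<close> binary digits, and the
  sign takes another bit.\<close>

lemma bits_le: "\<bar>z\<bar> \<le> 2 ^ k \<Longrightarrow> bits z \<le> k + 2"
proof -
  assume z: "\<bar>z\<bar> \<le> 2 ^ k"
  also have "(2 :: int) ^ k < 2 ^ Suc k" by simp
  finally have "bitlen \<bar>z\<bar> \<le> int (Suc k)" by (simp add: bitlen_le_iff_power nat_add_distrib)
  then show ?thesis by (simp add: bits_def)
qed

lemma abs_div_le: "\<bar>a div b\<bar> \<le> \<bar>a\<bar>" for a b :: int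
proof -
  have pos: "\<bar>a div b\<bar> \<le> \<bar>a\<bar>" if "0 < b" for a b :: int
  proof (cases "0 \<le> a")
    case True
    then show ?thesis
      using that zdiv_mono2[of a 1 b] pos_imp_zdiv_nonneg_iff[of b a] by simp
  next
    case False
    then show ?thesis
      using that zdiv_mono2_neg[of a 1 b] pos_imp_zdiv_neg_iff[of b a] by simp
  qed
  show ?thesis
    using pos[of b a] pos[of "- b" "- a"] by (cases b "0 :: int" rule: linorder_cases) simp_all
qed

text \<open>The summand \<open>\<bar>a\<bar>\<close> covers \<open>b = 0\<close>, where
  \<open>a mod b\<close> is \<open>a\<close>.\<close>

lemma abs_mod_le: "\<bar>a mod b\<bar> \<le> \<bar>a\<bar> + \<bar>b\<bar>" for a b :: int
  using abs_mod_less[of b a] by (cases "b = 0") auto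

text \<open>An operation yields at most twice the product of the bounds of its arguments, so the
  exponents add up, with one further \<open>b\<close> for the factor 2. The constant depends on the
  expression alone.\<close>

lemma eval_expr_bounded: "\<exists>K. \<forall>b s. 1 \<le> b \<longrightarrow> bounded_memory b s \<longrightarrow> \<bar>eval_expr s e\<bar> \<le> 2 ^ (K * b)"
proof (induction e)
  case (Const k)
  have "\<bar>k\<bar> \<le> 2 ^ nat \<bar>k\<bar>" using of_nat_less_two_power[of "nat \<bar>k\<bar>", where 'a = int] by simp
  also have "(2 :: int) ^ nat \<bar>k\<bar> \<le> 2 ^ (nat \<bar>k\<bar> * b)" if "1 \<le> b" for b
    using that by (intro power_increasing) auto
  finally show ?case by (intro exI[of _ "nat \<bar>k\<bar>"]) simp
next
  case (Read a e)
  show ?case by (intro exI[of _ 1]) (simp add: bounded_memory_def)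
next
  case (Bin f e1 e2)
  then obtain K1 K2 where
    K: "\<bar>eval_expr s e1\<bar> \<le> 2 ^ (K1 * b)" "\<bar>eval_expr s e2\<bar> \<le> 2 ^ (K2 * b)"
    if "1 \<le> b" "bounded_memory b s" for s b by blast
  show ?case
  proof (intro exI[of _ "K1 + K2 + 1"] allI impI)
    fix b s assume b: "1 \<le> b" "bounded_memory b s"
    define x y where "x = eval_expr s e1" and "y = eval_expr s e2"
    define X Y :: int where "X = 2 ^ (K1 * b)" and "Y = 2 ^ (K2 * b)"
    have x: "\<bar>x\<bar> \<le> X" "1 \<le> X" and y: "\<bar>y\<bar> \<le> Y" "1 \<le> Y"
      using K[OF b] by (auto simp: x_def y_def X_def Y_def)
    define Z where "Z = X * Y"
    have "X * 1 \<le> Z" "1 * Y \<le> Z" unfolding Z_def using x y by (intro mult_mono; simp)+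
    moreover have "\<bar>x * y\<bar> \<le> Z" unfolding Z_def abs_mult using x y by (intro mult_mono) auto
    ultimately have "\<bar>apply_binop f x y\<bar> \<le> 2 * (X * Y)"
      using x y abs_div_le[of x y] abs_mod_le[of x y] abs_triangle_ineq[of x y] abs_triangle_ineq4[of x y]
      unfolding Z_def[symmetric] by (cases f) auto
    also have "(2 :: int) \<le> 2 ^ b" using b power_increasing[of 1 b "2 :: int"] by simp
    then have "2 * (X * Y) \<le> 2 ^ b * (X * Y)" using x y by (intro mult_right_mono) auto
    also have "\<dots> = 2 ^ ((K1 + K2 + 1) * b)"
      by (simp add: X_def Y_def power_add[symmetric] algebra_simps)
    finally show "\<bar>eval_expr s (Bin f e1 e2)\<bar> \<le> 2 ^ ((K1 + K2 + 1) * b)"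
      by (simp add: x_def y_def)
  qed
qed

lemma expr_cost_bounded: "\<exists>K. \<forall>b s. 1 \<le> b \<longrightarrow> bounded_memory b s \<longrightarrow> expr_cost s e \<le> K * b"
proof -
  have bits: "\<exists>K. \<forall>b s. 1 \<le> b \<longrightarrow> bounded_memory b s \<longrightarrow> bits (eval_expr s e) \<le> K * b" for e
  proof -
    obtain K where K: "1 \<le> b \<Longrightarrow> bounded_memory b s \<Longrightarrow> \<bar>eval_expr s e\<bar> \<le> 2 ^ (K * b)" for s b
      using eval_expr_bounded[of e] by blast
    show ?thesis
    proof (intro exI[of _ "K + 2"] allI impI)
      fix b s assume b: "1 \<le> b" "bounded_memory b s"
      then have "bits (eval_expr s e) \<le> K * b + 2" by (intro bits_le K)
      also have "\<dots> \<le> (K + 2) * b" using b by simp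
      finally show "bits (eval_expr s e) \<le> (K + 2) * b" .
    qed
  qed
  show ?thesis
  proof (induction e)
    case (Const k)
    then show ?case using bits[of "Const k"] by simp
  next
    case (Read a e)
    then obtain K where K: "1 \<le> b \<Longrightarrow> bounded_memory b s \<Longrightarrow> expr_cost s e \<le> K * b" for s b by blast
    obtain L where L: "1 \<le> b \<Longrightarrow> bounded_memory b s \<Longrightarrow> bits (eval_expr s (Read a e)) \<le> L * b" for s b
      using bits[of "Read a e"] by blast
    show ?case
      by (intro exI[of _ "K + L"] allI impI) (use K L in \<open>simp add: distrib_right add_mono\<close>)
  next
    case (Bin f e1 e2)
    then obtain K1 K2 where K: "1 \<le> b \<Longrightarrow> bounded_memory b s \<Longrightarrow> expr_cost s e1 \<le> K1 * b"
      "1 \<le> b \<Longrightarrow> bounded_memory b s \<Longrightarrow> expr_cost s e2 \<le> K2 * b" for s b by blast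
    obtain L where L: "1 \<le> b \<Longrightarrow> bounded_memory b s \<Longrightarrow> bits (eval_expr s (Bin f e1 e2)) \<le> L * b" for s b
      using bits[of "Bin f e1 e2"] by blast
    show ?case
      by (intro exI[of _ "K1 + K2 + L"] allI impI) (use K L in \<open>simp add: distrib_right add_mono\<close>)
  qed
qed

section \<open>Cost of loop-free commands and of loops\<close>

fun loop_free :: "com \<Rightarrow> bool" where
  "loop_free (While e c) = False"
| "loop_free (Seq c d) = (loop_free c \<and> loop_free d)"
| "loop_free (Cond e c d) = (loop_free c \<and> loop_free d)"
| "loop_free _ = True"

fun flips :: "com \<Rightarrow> nat" where
  "flips (Flip a e) = 1"
| "flips (Seq c d) = flips c + flips d"
| "flips (Cond e c d) = max (flips c) (flips d)"
| "flips (While e c) = flips c"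
| "flips _ = 0"

text \<open>Only meaningful for loop-free commands and tapes that are long enough.\<close>

fun run :: "com \<Rightarrow> memory \<times> bool list \<Rightarrow> memory \<times> bool list" where
  "run (Write a e1 e2) (s, r) = (store s a (eval_expr s e1) (eval_expr s e2), r)"
| "run (Flip a e) (s, r) = (store s a (eval_expr s e) (of_bool (hd r)), tl r)"
| "run (Seq c d) q = run d (run c q)"
| "run (Cond e c d) (s, r) = (if eval_expr s e \<noteq> 0 then run c (s, r) else run d (s, r))"
| "run _ q = q"

text \<open>Each command multiplies the exponent of the memory bound by a constant. Iterating this
  would give an exponential bound, so it is used for loop bodies only, and the invariant of a loop
  restores the original exponent after every round. The last conjunct says that at most
  \<open>flips c\<close> coins are consumed.\<close>

lemma exec_loop_free:
  assumes "loop_free c"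
  shows "\<exists>K\<ge>1. \<forall>b s r. 1 \<le> b \<longrightarrow> bounded_memory b s \<longrightarrow> flips c \<le> length r \<longrightarrow>
    (\<exists>t\<le>K * b. exec c (s, r) t (run c (s, r))) \<and> bounded_memory (K * b) (fst (run c (s, r))) \<and>
    length r \<le> length (snd (run c (s, r))) + flips c"
  using assms
proof (induction c)
  case Skip
  show ?case using exec_Skip by (intro exI[of _ 1]) fastforce
next
  case (Write a e1 e2)
  obtain K1 K2 where K: "1 \<le> b \<Longrightarrow> bounded_memory b s \<Longrightarrow> expr_cost s e1 \<le> K1 * b"
      "1 \<le> b \<Longrightarrow> bounded_memory b s \<Longrightarrow> expr_cost s e2 \<le> K2 * b" for s b
    using expr_cost_bounded[of e1] expr_cost_bounded[of e2] by blast
  obtain L where L: "1 \<le> b \<Longrightarrow> bounded_memory b s \<Longrightarrow> \<bar>eval_expr s e2\<bar> \<le> 2 ^ (L * b)" for s b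
    using eval_expr_bounded[of e2] by blast
  show ?case
  proof (rule exI[of _ "1 + K1 + K2 + L"], intro conjI allI impI)
    fix b s and r :: "bool list" assume b: "1 \<le> b" "bounded_memory b s"
    show "\<exists>t\<le>(1 + K1 + K2 + L) * b. exec (Write a e1 e2) (s, r) t (run (Write a e1 e2) (s, r))"
      using K[OF b] b(1) exec_Write[of a e1 e2 s r]
      by (intro exI[of _ "1 + expr_cost s e1 + expr_cost s e2"]) (auto simp: algebra_simps)
    have "bounded_memory ((1 + K1 + K2 + L) * b) s"
      using b by (auto intro: bounded_memory_mono)
    moreover have "L * b \<le> (1 + K1 + K2 + L) * b" by (intro mult_le_mono1) simp
    then have "\<bar>eval_expr s e2\<bar> \<le> 2 ^ ((1 + K1 + K2 + L) * b)"
      by (intro order.trans[OF L[OF b] power_increasing]) auto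
    ultimately show "bounded_memory ((1 + K1 + K2 + L) * b) (fst (run (Write a e1 e2) (s, r)))"
      by (simp only: run.simps fst_conv bounded_memory_store)
  qed auto
next
  case (Flip a e)
  obtain K where K: "1 \<le> b \<Longrightarrow> bounded_memory b s \<Longrightarrow> expr_cost s e \<le> K * b" for s b
    using expr_cost_bounded[of e] by blast
  show ?case
  proof (rule exI[of _ "1 + K"], intro conjI allI impI)
    fix b s and r :: "bool list" assume b: "1 \<le> b" "bounded_memory b s" "flips (Flip a e) \<le> length r"
    then obtain h r' where r: "r = h # r'" by (cases r) auto
    show "\<exists>t\<le>(1 + K) * b. exec (Flip a e) (s, r) t (run (Flip a e) (s, r))"
      using K[OF b(1,2)] b(1) exec_Flip[of a e s h r'] unfolding r
      by (intro exI[of _ "1 + expr_cost s e"]) (auto simp: of_bool_def)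
    show "bounded_memory ((1 + K) * b) (fst (run (Flip a e) (s, r)))"
      using b by (auto intro!: bounded_memory_store intro: bounded_memory_mono)
  qed auto
next
  case (Seq c d)
  then obtain K1 K2 where K1: "1 \<le> K1" "1 \<le> b \<Longrightarrow> bounded_memory b s \<Longrightarrow> flips c \<le> length r \<Longrightarrow>
    (\<exists>t\<le>K1 * b. exec c (s, r) t (run c (s, r))) \<and> bounded_memory (K1 * b) (fst (run c (s, r))) \<and>
    length r \<le> length (snd (run c (s, r))) + flips c"
    and K2: "1 \<le> K2" "1 \<le> b \<Longrightarrow> bounded_memory b s \<Longrightarrow> flips d \<le> length r \<Longrightarrow>
    (\<exists>t\<le>K2 * b. exec d (s, r) t (run d (s, r))) \<and> bounded_memory (K2 * b) (fst (run d (s, r))) \<and>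
    length r \<le> length (snd (run d (s, r))) + flips d" for b s r by auto
  show ?case
  \<comment> \<open>The second command starts in a memory with exponent \<open>K1 * b\<close>,
    whence the product.\<close>
  proof (rule exI[of _ "K1 + K2 * K1"], intro conjI allI impI)
    show "1 \<le> K1 + K2 * K1" using K1 by simp
    fix b s and r :: "bool list"
    assume b: "1 \<le> b" "bounded_memory b s" "flips (Seq c d) \<le> length r"
    obtain s' r' where run: "run c (s, r) = (s', r')" by (cases "run c (s, r)")
    have 1: "\<exists>t\<le>K1 * b. exec c (s, r) t (s', r')" "bounded_memory (K1 * b) s'"
      "length r \<le> length r' + flips c"
      using K1(2)[OF b(1,2), of r] b(3) run by auto
    have 2: "\<exists>t\<le>K2 * (K1 * b). exec d (s', r') t (run d (s', r'))"
      "bounded_memory (K2 * (K1 * b)) (fst (run d (s', r')))"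
      "length r' \<le> length (snd (run d (s', r'))) + flips d"
      using K2(2)[of "K1 * b" s' r'] b 1 K1(1) by auto
    from 1 2 obtain t u where t: "t \<le> K1 * b" "exec c (s, r) t (s', r')"
      and u: "u \<le> K2 * (K1 * b)" "exec d (s', r') u (run d (s', r'))" by blast
    have "exec (Seq c d) (s, r) (t + u) (run (Seq c d) (s, r))"
      using exec_Seq[OF t(2), of d u "fst (run d (s', r'))" "snd (run d (s', r'))"] u(2) run by simp
    then show "\<exists>t\<le>(K1 + K2 * K1) * b. exec (Seq c d) (s, r) t (run (Seq c d) (s, r))"
      using t u by (intro exI[of _ "t + u"]) (auto simp: algebra_simps)
    show "bounded_memory ((K1 + K2 * K1) * b) (fst (run (Seq c d) (s, r)))"
      using 2(2) run by (auto intro: bounded_memory_mono simp: algebra_simps)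
    show "length r \<le> length (snd (run (Seq c d) (s, r))) + flips (Seq c d)"
      using 1 2 run by simp
  qed
next
  case (Cond e c d)
  then obtain K1 K2 where K1: "1 \<le> K1" "1 \<le> b \<Longrightarrow> bounded_memory b s \<Longrightarrow> flips c \<le> length r \<Longrightarrow>
    (\<exists>t\<le>K1 * b. exec c (s, r) t (run c (s, r))) \<and> bounded_memory (K1 * b) (fst (run c (s, r))) \<and>
    length r \<le> length (snd (run c (s, r))) + flips c"
    and K2: "1 \<le> K2" "1 \<le> b \<Longrightarrow> bounded_memory b s \<Longrightarrow> flips d \<le> length r \<Longrightarrow>
    (\<exists>t\<le>K2 * b. exec d (s, r) t (run d (s, r))) \<and> bounded_memory (K2 * b) (fst (run d (s, r))) \<and>
    length r \<le> length (snd (run d (s, r))) + flips d" for b s r by auto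
  obtain K where K: "1 \<le> b \<Longrightarrow> bounded_memory b s \<Longrightarrow> expr_cost s e \<le> K * b" for s b
    using expr_cost_bounded[of e] by blast
  show ?case
  proof (rule exI[of _ "1 + K + K1 + K2"], intro conjI allI impI)
    fix b s and r :: "bool list"
    assume b: "1 \<le> b" "bounded_memory b s" "flips (Cond e c d) \<le> length r"
    note 1 = K1(2)[OF b(1,2), of r] and 2 = K2(2)[OF b(1,2), of r]
    show "\<exists>t\<le>(1 + K + K1 + K2) * b. exec (Cond e c d) (s, r) t (run (Cond e c d) (s, r))"
    proof (cases "eval_expr s e = 0")
      case True
      obtain t where t: "t \<le> K2 * b" "exec d (s, r) t (run d (s, r))" using 2 b(3) by auto
      with True have "exec (Cond e c d) (s, r) (1 + expr_cost s e + t) (run (Cond e c d) (s, r))"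
        using exec_CondFalse[of s e d r t "fst (run d (s, r))" "snd (run d (s, r))"] by simp
      then show ?thesis using t(1) K[OF b(1,2)] b(1)
        by (intro exI[of _ "1 + expr_cost s e + t"]) (auto simp: algebra_simps)
    next
      case False
      obtain t where t: "t \<le> K1 * b" "exec c (s, r) t (run c (s, r))" using 1 b(3) by auto
      with False have "exec (Cond e c d) (s, r) (1 + expr_cost s e + t) (run (Cond e c d) (s, r))"
        using exec_CondTrue[of s e c r t "fst (run c (s, r))" "snd (run c (s, r))"] by simp
      then show ?thesis using t(1) K[OF b(1,2)] b(1)
        by (intro exI[of _ "1 + expr_cost s e + t"]) (auto simp: algebra_simps)
    qed
    show "bounded_memory ((1 + K + K1 + K2) * b) (fst (run (Cond e c d) (s, r)))"
      using 1 2 b(3) by (auto intro: bounded_memory_mono simp: algebra_simps)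
    show "length r \<le> length (snd (run (Cond e c d) (s, r))) + flips (Cond e c d)"
      using 1 2 b(3) by auto
  qed simp
qed simp

text \<open>A round costs at most \<open>C\<close> for the test, \<open>C\<close> for the body and 1
  for the loop itself; the extra round in \<open>N + 1\<close> pays for the final test.\<close>

lemma exec_While_invariant:
  assumes step: "\<And>k s r. k < N \<Longrightarrow> I k s r \<Longrightarrow>
      eval_expr s e \<noteq> 0 \<and> (\<exists>t s' r'. exec c (s, r) t (s', r') \<and> t \<le> C \<and> I (Suc k) s' r')"
    and cost: "\<And>k s r. k \<le> N \<Longrightarrow> I k s r \<Longrightarrow> expr_cost s e \<le> C"
    and fin: "\<And>s r. I N s r \<Longrightarrow> eval_expr s e = 0"
    and init: "I 0 s r"
  shows "\<exists>t s' r'. exec (While e c) (s, r) t (s', r') \<and> t \<le> (N + 1) * (2 * C + 1) \<and> I N s' r'"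
proof -
  have "\<exists>t s' r'. exec (While e c) (s, r) t (s', r') \<and> t \<le> (d + 1) * (2 * C + 1) \<and> I N s' r'"
    if "k + d = N" "I k s r" for k d s r
    using that
  proof (induction d arbitrary: k s r)
    case 0
    then show ?case using fin cost exec_WhileFalse[of s e c r] by fastforce
  next
    case (Suc d)
    then obtain t s' r' where t: "eval_expr s e \<noteq> 0" "exec c (s, r) t (s', r')" "t \<le> C" "I (Suc k) s' r'"
      using step[of k s r] by auto
    from Suc.IH[OF _ t(4)] Suc.prems obtain u s'' r'' where
      u: "exec (While e c) (s', r') u (s'', r'')" "u \<le> (d + 1) * (2 * C + 1)" "I N s'' r''" by auto
    from exec_WhileTrue[OF t(1,2) u(1)]
    show ?case using t u cost[of k s r] Suc.prems by fastforce
  qed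
  then show ?thesis using init by simp
qed

text \<open>A run without coin flips can be transferred to any other tape, with the same cost and
  the same final memory.\<close>

lemma exec_flip_free:
  "exec c p t q \<Longrightarrow> flips c = 0 \<Longrightarrow> snd q = snd p \<and> (\<forall>r. exec c (fst p, r) t (fst q, r))"
  by (induction rule: exec.induct) (auto intro: exec.intros[simplified])

section \<open>The program\<close>

abbreviation var :: "string \<Rightarrow> expr" where "var a \<equiv> Read a (Const 0)"
abbreviation assign :: "string \<Rightarrow> expr \<Rightarrow> com" where "assign a e \<equiv> Write a (Const 0) e"
abbreviation plus_expr (infixl "+\<^sub>e" 65) where "plus_expr \<equiv> Bin Plus"
abbreviation minus_expr (infixl "-\<^sub>e" 65) where "minus_expr \<equiv> Bin Minus"
abbreviation times_expr (infixl "*\<^sub>e" 70) where "times_expr \<equiv> Bin Times"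
abbreviation quot_expr (infixl "div\<^sub>e" 70) where "quot_expr \<equiv> Bin Quot"
abbreviation rem_expr (infixl "mod\<^sub>e" 70) where "rem_expr \<equiv> Bin Rem"
abbreviation less_expr (infix "<\<^sub>e" 60) where "less_expr \<equiv> Bin Less"
abbreviation seq_com (infixr ";;" 55) where "seq_com \<equiv> Seq"

definition increment :: com where "increment = assign ''t'' (var ''t'' +\<^sub>e Const 1)"

definition for_edges :: "com \<Rightarrow> com" where
  "for_edges c = assign ''t'' (Const 0) ;;
     While (var ''t'' <\<^sub>e var ''n'' *\<^sub>e var ''m'') (c ;; increment)"

lemma store_same [simp]: "store s a k z a = (s a)(k := z)"
  and store_other [simp]: "a \<noteq> b \<Longrightarrow> store s a k z b = s b"
  and store_other' [simp]: "b \<noteq> a \<Longrightarrow> store s a k z b = s b"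
  by (simp_all add: store_def)

text \<open>The constant must not depend on the input, hence the quantification over \<open>N\<close> and the invariant.\<close>

definition loop_cost :: "com \<Rightarrow> nat \<Rightarrow> bool" where
  "loop_cost c K \<longleftrightarrow> (\<forall>b N (I :: nat \<Rightarrow> memory \<Rightarrow> bool list \<Rightarrow> bool) s r.
    1 \<le> b \<longrightarrow> bounded_memory b s \<longrightarrow> I 0 (store s ''t'' 0 0) r \<longrightarrow>
    (\<forall>k s r. k \<le> N \<longrightarrow> I k s r \<longrightarrow>
       bounded_memory b s \<and> s ''t'' 0 = int k \<and> s ''n'' 0 * s ''m'' 0 = int N) \<longrightarrow>
    (\<forall>k s r. k < N \<longrightarrow> I k s r \<longrightarrow> flips c \<le> length r \<and>
       (case run c (s, r) of (s', r') \<Rightarrow> I (Suc k) (store s' ''t'' 0 (s' ''t'' 0 + 1)) r')) \<longrightarrow>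
    (\<exists>t s' r'. exec (for_edges c) (s, r) t (s', r') \<and> t \<le> K * b * (N + 1) \<and> I N s' r'))"

text \<open>Since the invariant guarantees the same exponent \<open>b\<close> before every round,
  the constants of the body and the test apply to all rounds and do not accumulate.\<close>

lemma loop_cost_exists:
  assumes "loop_free c"
  shows "\<exists>K. loop_cost c K"
proof -
  let ?body = "c ;; increment"
  let ?init = "assign ''t'' (Const 0)"
  let ?test = "var ''t'' <\<^sub>e var ''n'' *\<^sub>e var ''m''"
  have lf: "loop_free ?body" "loop_free ?init" using assms by (simp_all add: increment_def)
  obtain K1 where K1: "\<exists>t\<le>K1 * b. exec ?body (s, r) t (run ?body (s, r))"
    if "1 \<le> b" "bounded_memory b s" "flips ?body \<le> length r" for b s r
    using exec_loop_free[OF lf(1)] by blast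
  obtain K2 where K2: "\<exists>t\<le>K2 * b. exec ?init (s, r) t (run ?init (s, r))"
    if "1 \<le> b" "bounded_memory b s" "flips ?init \<le> length r" for b s and r :: "bool list"
    using exec_loop_free[OF lf(2)] by blast
  obtain K3 where K3: "expr_cost s ?test \<le> K3 * b"
    if "1 \<le> b" "bounded_memory b s" for b s
    using expr_cost_bounded[of ?test] by blast
  show ?thesis
    unfolding loop_cost_def
  proof (rule exI[of _ "K2 + 2 * (K1 + K3) + 1"], intro allI impI)
    fix b N s r and I :: "nat \<Rightarrow> memory \<Rightarrow> bool list \<Rightarrow> bool"
    assume b: "1 \<le> b" "bounded_memory b s" and init: "I 0 (store s ''t'' 0 0) r"
    assume inv: "\<forall>k s r. k \<le> N \<longrightarrow> I k s r \<longrightarrow>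
       bounded_memory b s \<and> s ''t'' 0 = int k \<and> s ''n'' 0 * s ''m'' 0 = int N"
    assume step: "\<forall>k s r. k < N \<longrightarrow> I k s r \<longrightarrow> flips c \<le> length r \<and>
       (case run c (s, r) of (s', r') \<Rightarrow> I (Suc k) (store s' ''t'' 0 (s' ''t'' 0 + 1)) r')"
    obtain t0 where t0: "t0 \<le> K2 * b" "exec ?init (s, r) t0 (store s ''t'' 0 0, r)"
      using K2[OF b, of r] by auto
    have "\<exists>t s' r'. exec (While ?test ?body) (store s ''t'' 0 0, r) t (s', r') \<and>
        t \<le> (N + 1) * (2 * ((K1 + K3) * b) + 1) \<and> I N s' r'"
    proof (rule exec_While_invariant[where I = I])
      fix k s r assume k: "k < N" "I k s r"
      obtain s' r' where run: "run c (s, r) = (s', r')" by (cases "run c (s, r)")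
      have bd: "bounded_memory b s" "flips ?body \<le> length r"
        using inv[rule_format, of k s r] step[rule_format, of k s r] k by (auto simp: increment_def)
      obtain t where t: "t \<le> K1 * b" "exec ?body (s, r) t (run ?body (s, r))"
        using K1[OF b(1) bd] by blast
      have "run ?body (s, r) = (store s' ''t'' 0 (s' ''t'' 0 + 1), r')"
        using run by (simp add: increment_def)
      moreover have "I (Suc k) (store s' ''t'' 0 (s' ''t'' 0 + 1)) r'"
        using step[rule_format, of k s r] k run by simp
      moreover have "eval_expr s ?test \<noteq> 0" using inv[rule_format, of k s r] k by simp
      ultimately show "eval_expr s ?test \<noteq> 0 \<and>
          (\<exists>t s' r'. exec ?body (s, r) t (s', r') \<and> t \<le> (K1 + K3) * b \<and> I (Suc k) s' r')"
        using t by (intro conjI exI[of _ t]) (auto simp: algebra_simps intro: trans_le_add1)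
    next
      fix k s r assume "k \<le> N" "I k s r"
      with inv have "bounded_memory b s" by blast
      from K3[OF b(1) this] show "expr_cost s ?test \<le> (K1 + K3) * b"
        by (rule order.trans) simp
    next
      fix s r assume "I N s r"
      with inv[rule_format, of N s r] show "eval_expr s ?test = 0" by simp
    qed (rule init)
    then obtain t s' r' where t: "exec (While ?test ?body) (store s ''t'' 0 0, r) t (s', r')"
      "t \<le> (N + 1) * (2 * ((K1 + K3) * b) + 1)" "I N s' r'" by blast
    have "(N + 1) * (2 * ((K1 + K3) * b) + 1) \<le> (N + 1) * ((2 * (K1 + K3) + 1) * b)"
      using b(1) by (intro mult_le_mono2) (simp add: algebra_simps)
    moreover have "K2 * b \<le> (N + 1) * (K2 * b)" by simp
    ultimately have "t0 + t \<le> (K2 + 2 * (K1 + K3) + 1) * b * (N + 1)"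
      using t0(1) t(2) by (simp add: algebra_simps)
    moreover have "exec (for_edges c) (s, r) (t0 + t) (s', r')"
      unfolding for_edges_def using exec_Seq[OF t0(2) t(1)] .
    ultimately show "\<exists>t s' r'. exec (for_edges c) (s, r) t (s', r') \<and>
        t \<le> (K2 + 2 * (K1 + K3) + 1) * b * (N + 1) \<and> I N s' r'"
      using t(3) by blast
  qed
qed

text \<open>
  The arrays \<open>p\<close> and \<open>q\<close> hold the dual variables of the customers and suppliers, \<open>L\<close> and \<open>K\<close> their
  loads.
\<close>

definition product_step :: com where
  "product_step = assign ''U'' (var ''U'' *\<^sub>e
     ((Read ''vnum'' (var ''t'') +\<^sub>e Read ''vden'' (var ''t'')) *\<^sub>e
      (Read ''wnum'' (var ''t'') +\<^sub>e Read ''wden'' (var ''t''))))"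

text \<open>\<open>e\<close> is the position of the edge in the customer matrices and
  \<open>k\<close> its position in the supplier matrices, which are stored with suppliers as
  rows.\<close>

definition locate :: "expr \<Rightarrow> com" where
  "locate e =
     assign ''e'' e ;;
     assign ''i'' (var ''e'' div\<^sub>e var ''m'') ;;
     assign ''j'' (var ''e'' mod\<^sub>e var ''m'') ;;
     assign ''k'' (var ''j'' *\<^sub>e var ''n'' +\<^sub>e var ''i'') ;;
     assign ''A'' (var ''U'' *\<^sub>e Read ''vnum'' (var ''e'') div\<^sub>e
       (Read ''vnum'' (var ''e'') +\<^sub>e Read ''vden'' (var ''e''))) ;;
     assign ''B'' (var ''U'' *\<^sub>e Read ''wnum'' (var ''k'') div\<^sub>e
       (Read ''wnum'' (var ''k'') +\<^sub>e Read ''wden'' (var ''k'')))"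

definition add_to :: "string \<Rightarrow> expr \<Rightarrow> expr \<Rightarrow> com" where
  "add_to a k e = Write a k (Read a k +\<^sub>e e)"

text \<open>With \<open>A = U a\<close>, \<open>B = U b\<close> and duals in units of
  \<open>1 / (64 U^2)\<close>, the profit \<open>a b\<close> is \<open>64 A B\<close> units and the
  part already covered is \<open>(p A + q B) / U\<close> units; \<open>gain\<close> is the
  difference, rounded down. It is stored in \<open>h\<close> before \<open>p\<close> and
  \<open>q\<close> are raised because raising them changes its value.\<close>

definition push_step :: com where
  "push_step =
     (let gain = (Const 64 *\<^sub>e var ''A'' *\<^sub>e var ''B'' *\<^sub>e var ''U''
                    -\<^sub>e Read ''p'' (var ''i'') *\<^sub>e var ''A''
                    -\<^sub>e Read ''q'' (var ''j'') *\<^sub>e var ''B'') div\<^sub>e var ''U''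
      in locate (var ''t'') ;;
         Cond (Const 0 <\<^sub>e gain)
           (Write ''h'' (var ''e'') gain ;;
            add_to ''p'' (var ''i'') (Read ''h'' (var ''e'')) ;;
            add_to ''q'' (var ''j'') (Read ''h'' (var ''e'')))
           Skip)"

text \<open>Loads \<open>A * Y\<close> are in units of \<open>1 / (64 U)\<close>, in which the
  capacity \<open>22/64\<close> is \<open>22 * U\<close>. As long as \<open>room\<close> is
  nonnegative, the test succeeds only for a nonzero size, so there is no division by zero.\<close>

definition cap_at :: "string \<Rightarrow> expr \<Rightarrow> string \<Rightarrow> com" where
  "cap_at L i A =
     (let room = Const 22 *\<^sub>e var ''U'' -\<^sub>e Read L i
      in Cond (room <\<^sub>e var A *\<^sub>e var ''Y'') (assign ''Y'' (room div\<^sub>e var A)) Skip)"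

definition pop_step :: com where
  "pop_step =
     locate (var ''n'' *\<^sub>e var ''m'' -\<^sub>e Const 1 -\<^sub>e var ''t'') ;;
     Cond (Const 0 <\<^sub>e Read ''h'' (var ''e''))
       (assign ''Y'' (Const 64) ;;
        cap_at ''L'' (var ''i'') ''A'' ;;
        cap_at ''K'' (var ''j'') ''B'' ;;
        Write ''y'' (var ''e'') (var ''Y'') ;;
        add_to ''L'' (var ''i'') (var ''A'' *\<^sub>e var ''Y'') ;;
        add_to ''K'' (var ''j'') (var ''B'' *\<^sub>e var ''Y''))
       Skip"

definition coin :: "int \<Rightarrow> expr" where "coin k = Read ''z'' (Const k)"

text \<open>Horner form with the first flip as the lowest bit, in agreement with
  \<open>coin_value\<close>.\<close>

definition coins :: expr where
  "coins = coin 0 +\<^sub>e Const 2 *\<^sub>e (coin 1 +\<^sub>e Const 2 *\<^sub>e (coin 2 +\<^sub>e Const 2 *\<^sub>e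
     (coin 3 +\<^sub>e Const 2 *\<^sub>e (coin 4 +\<^sub>e Const 2 *\<^sub>e coin 5))))"

definition round_step :: com where
  "round_step =
     Flip ''z'' (Const 0) ;; Flip ''z'' (Const 1) ;; Flip ''z'' (Const 2) ;;
     Flip ''z'' (Const 3) ;; Flip ''z'' (Const 4) ;; Flip ''z'' (Const 5) ;;
     Write ''x'' (var ''t'') (coins <\<^sub>e Read ''y'' (var ''t''))"

definition deterministic_part :: com where
  "deterministic_part = assign ''U'' (Const 1) ;;
     for_edges product_step ;; for_edges push_step ;; for_edges pop_step"

definition fs_program :: com where
  "fs_program = deterministic_part ;; for_edges round_step"

lemmas program_defs = product_step_def locate_def add_to_def push_step_def cap_at_def pop_step_def
  round_step_def increment_def for_edges_def Let_def

lemma loop_free_steps: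
  "loop_free product_step" "loop_free push_step" "loop_free pop_step" "loop_free round_step"
  by (simp_all add: program_defs)

lemma flips_steps:
  "flips product_step = 0" "flips push_step = 0" "flips pop_step = 0" "flips round_step = 6"
  "flips deterministic_part = 0"
  by (simp_all add: program_defs deterministic_part_def)

section \<open>Integer data of an instance\<close>

lemma sum_edges: "(\<Sum>e<n * m. f (e div m) (e mod m)) = (\<Sum>i<n. \<Sum>j<m. f i j)" for n m :: nat
proof (cases "m = 0")
  case False
  have "(\<Sum>i<n. \<Sum>j<m. f i j) = (\<Sum>i<n. \<Sum>e\<in>{i * m..<i * m + m}. f (e div m) (e mod m))"
  proof (rule sum.cong[OF refl])
    fix i
    have "(\<Sum>e\<in>{i * m..<i * m + m}. f (e div m) (e mod m)) = (\<Sum>j\<in>{0..<m}. f ((j + i * m) div m) ((j + i * m) mod m))"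
      using sum.shift_bounds_nat_ivl[of "\<lambda>e. f (e div m) (e mod m)" 0 "i * m" m] by (simp add: add.commute)
    also have "\<dots> = (\<Sum>j<m. f i j)"
      using False by (intro sum.cong) auto
    finally show "(\<Sum>j<m. f i j) = (\<Sum>e\<in>{i * m..<i * m + m}. f (e div m) (e mod m))" by simp
  qed
  then show ?thesis by (simp add: sum.nat_group)
qed simp

lemma div_bounds:
  fixes x d :: int
  assumes "0 < d"
  shows "d * (x div d) \<le> x" "x < d * (x div d) + d"
proof -
  have "x = d * (x div d) + x mod d" by simp
  with pos_mod_bound[OF assms, of x] pos_mod_sign[OF assms, of x]
  show "d * (x div d) \<le> x" "x < d * (x div d) + d" by linarith+
qed

locale fs_input =
  fixes n m :: nat and v w :: "nat \<Rightarrow> nat \<Rightarrow> rat"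
  assumes nonneg: "mnl_instance n m v w"
begin

definition N where "N = n * m"
definition row where "row e = e div m"
definition col where "col e = e mod m"

definition "vnum e = numerator (v (row e) (col e))"
definition "vden e = denominator (v (row e) (col e))"
definition "wnum e = numerator (w (col e) (row e))"
definition "wden e = denominator (w (col e) (row e))"

abbreviation "s0 \<equiv> input_memory n m v w"

text \<open>The two sums belong to different edges in general, since the supplier matrices are
  transposed. Over all \<open>t < N\<close> each edge contributes both of its denominators once,
  which is what the product \<open>U\<close> has to contain.\<close>

definition factor :: "nat \<Rightarrow> int" where
  "factor t = (s0 ''vnum'' t + s0 ''vden'' t) * (s0 ''wnum'' t + s0 ''wden'' t)"

definition U where "U = prod factor {..<N}"

text \<open>
  \<open>U\<close> is a common denominator of the numbers \<open>v / (1 + v)\<close> and \<open>w / (1 + w)\<close>; \<open>A e\<close> and \<open>B e\<close> are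
  their exact numerators over \<open>U\<close>.
\<close>

definition A where "A e = U * vnum e div (vnum e + vden e)"
definition B where "B e = U * wnum e div (wnum e + wden e)"

text \<open>
  \<open>H\<close> is the raise of both dual variables at an edge, in units of \<open>1 / (64 U\<^sup>2)\<close>. Rounding down to this
  unit keeps the numbers short. Undoing the rounding at most doubles a raise, unless the residual
  profit is below one unit and hence at most \<open>1/64\<close> of the profit of the edge.
\<close>

function H :: "nat \<Rightarrow> int" where
  "H e = max 0 ((64 * A e * B e * U - (\<Sum>e'<e. of_bool (row e' = row e) * H e') * A e
      - (\<Sum>e'<e. of_bool (col e' = col e) * H e') * B e) div U)"
  by auto
termination by (relation less_than) auto

declare H.simps [simp del]

text \<open>For \<open>load \<le> 22 * U\<close> and nonnegative \<open>a\<close> and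
  \<open>y\<close>, this is the largest integer amount up to \<open>y\<close> that respects the
  capacity; it mirrors \<open>cap_at\<close>.\<close>

definition capped :: "int \<Rightarrow> int \<Rightarrow> int \<Rightarrow> int" where
  "capped load a y = (if 22 * U - load < a * y then (22 * U - load) div a else y)"

definition edge where "edge t = N - 1 - t"

text \<open>
  The edges are unwound in reverse order: step \<open>t\<close> treats \<open>edge t\<close>. \<open>Z t\<close> is its inclusion
  probability in units of \<open>1/64\<close>, as large as the capacity \<open>22/64\<close> of both endpoints allows.
\<close>

function Z :: "nat \<Rightarrow> int" where
  "Z t = (if 0 < H (edge t)
     then capped (\<Sum>t'<t. of_bool (col (edge t') = col (edge t)) * (B (edge t') * Z t')) (B (edge t))
            (capped (\<Sum>t'<t. of_bool (row (edge t') = row (edge t)) * (A (edge t') * Z t')) (A (edge t)) 64)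
     else 0)"
  by auto
termination by (relation less_than) auto

declare Z.simps [simp del]

definition Y :: "nat \<Rightarrow> nat" where "Y e = nat (Z (edge e))"

lemma row_col: "e < N \<Longrightarrow> row e < n" "e < N \<Longrightarrow> col e < m" "row e * m + col e = e"
  "e < N \<Longrightarrow> col e * n + row e < N"
proof -
  show 1: "row e < n" "col e < m" if "e < N" for e
    using that unfolding N_def row_def col_def
    by (auto simp: less_mult_imp_div_less) (cases m; simp)
  show "row e * m + col e = e" by (simp add: row_def col_def)
  assume "e < N"
  from 1[OF this] have "col e * n + row e < (col e + 1) * n" "(col e + 1) * n \<le> m * n"
    by (simp, intro mult_le_mono1, simp)
  then show "col e * n + row e < N" by (simp add: N_def mult.commute)
qed

lemma quotients: "e < N \<Longrightarrow> 0 \<le> vnum e" "0 < vden e" "e < N \<Longrightarrow> 0 \<le> wnum e" "0 < wden e"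
proof -
  have "0 \<le> numerator q" if "0 \<le> q" for q
  proof -
    have "rat_of_int (numerator q) = q * rat_of_int (denominator q)"
      using quotient_of_div[of q "numerator q" "denominator q"] quotient_of_denom_pos'[of q]
      unfolding numerator_def denominator_def
      by (metis less_irrefl nonzero_eq_divide_eq of_int_eq_0_iff prod.collapse)
    also have "0 \<le> \<dots>" using that quotient_of_denom_pos'[of q] by (simp add: denominator_def)
    finally show ?thesis by simp
  qed
  then show "e < N \<Longrightarrow> 0 \<le> vnum e" "e < N \<Longrightarrow> 0 \<le> wnum e"
    using nonneg row_col[of e] by (auto simp: mnl_instance_def vnum_def wnum_def)
  show "0 < vden e" "0 < wden e"
    by (auto simp: vden_def wden_def denominator_def quotient_of_denom_pos')
qed

lemma weight_eq: "real_of_rat (v (row e) (col e)) = real_of_int (vnum e) / real_of_int (vden e)"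
  "real_of_rat (w (col e) (row e)) = real_of_int (wnum e) / real_of_int (wden e)"
proof -
  have "real_of_rat q = real_of_int (numerator q) / real_of_int (denominator q)" for q
    using quotient_of_div[of q "numerator q" "denominator q"]
    by (metis numerator_def denominator_def of_rat_divide of_rat_of_int_eq prod.collapse)
  then show "real_of_rat (v (row e) (col e)) = real_of_int (vnum e) / real_of_int (vden e)"
    "real_of_rat (w (col e) (row e)) = real_of_int (wnum e) / real_of_int (wden e)"
    by (auto simp: vnum_def vden_def wnum_def wden_def)
qed

lemma input_cells:
  assumes "e < N"
  shows "s0 ''vnum'' (int e) = vnum e" "s0 ''vden'' (int e) = vden e"
    "s0 ''wnum'' (int (col e * n + row e)) = wnum e" "s0 ''wden'' (int (col e * n + row e)) = wden e"
proof -
  have e: "int e < int (n * m)" "int (col e * n + row e) < int (m * n)"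
    using assms row_col(4)[OF assms] by (simp_all add: N_def mult.commute del: of_nat_mult of_nat_add)
  have "(col e * n + row e) div n = col e" "(col e * n + row e) mod n = row e"
    using row_col(1)[OF assms] by auto
  with e show "s0 ''vnum'' (int e) = vnum e" "s0 ''vden'' (int e) = vden e"
    "s0 ''wnum'' (int (col e * n + row e)) = wnum e" "s0 ''wden'' (int (col e * n + row e)) = wden e"
    unfolding input_memory_def matrix_cells_def vnum_def vden_def wnum_def wden_def
    by (simp_all add: row_def col_def del: of_nat_mult of_nat_add)
qed

lemma scalar_inputs: "s0 ''n'' 0 = int n" "s0 ''m'' 0 = int m"
  by (simp_all add: input_memory_def scalar_cells_def)

lemma other_cells:
  "a \<notin> {''n'', ''m'', ''vnum'', ''vden'', ''wnum'', ''wden''} \<Longrightarrow> s0 a = (\<lambda>_. 0)"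
  by (simp add: input_memory_def)

text \<open>Every cell of the supplier matrices belongs to some edge, so facts known per edge, such
  as positivity, hold per cell.\<close>

lemma transpose_edge:
  assumes "t < N"
  obtains e where "e < N" "col e * n + row e = t"
proof
  have "0 < n" "0 < m" using assms by (auto simp: N_def intro!: gr0I)
  define e where "e = (t mod n) * m + t div n"
  have t: "t div n < m" "t mod n < n"
    using assms \<open>0 < n\<close> by (auto simp: N_def less_mult_imp_div_less mult.commute)
  then have "row e = t mod n" "col e = t div n" by (auto simp: row_def col_def e_def)
  then show "col e * n + row e = t" by simp
  have "e < (t mod n + 1) * m" "(t mod n + 1) * m \<le> n * m"
    using t by (simp add: e_def, intro mult_le_mono1, simp)
  then show "e < N" by (simp add: N_def)
qed

lemma factor_parts:
  assumes "t < N"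
  shows "0 < s0 ''vnum'' t + s0 ''vden'' t" "0 < s0 ''wnum'' t + s0 ''wden'' t"
proof -
  show "0 < s0 ''vnum'' t + s0 ''vden'' t"
    using input_cells[OF assms] quotients[of t] assms by simp
  obtain e where "e < N" "col e * n + row e = t" using transpose_edge[OF assms] .
  then show "0 < s0 ''wnum'' t + s0 ''wden'' t"
    using input_cells(3,4)[of e] quotients[of e] by auto
qed

lemma factor_pos: "t < N \<Longrightarrow> 0 < factor t"
  using factor_parts[of t] by (simp add: factor_def)

lemma U_pos: "0 < U"
  using factor_pos by (auto simp: U_def intro: prod_pos)

text \<open>The customer part divides the factor at position \<open>e\<close>, the supplier part the
  factor at the transposed position.\<close>

lemma dvd_U:
  assumes "e < N"
  shows "vnum e + vden e dvd U" "wnum e + wden e dvd U"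
proof -
  have "factor t dvd U" if "t < N" for t using that by (auto simp: U_def intro: dvd_prodI)
  from this[OF assms] this[OF row_col(4)[OF assms]] input_cells[OF assms]
  show "vnum e + vden e dvd U" "wnum e + wden e dvd U"
    by (auto simp: factor_def simp del: of_nat_add of_nat_mult intro: dvd_trans dvd_mult_left dvd_mult_right)
qed

lemma A_eq: "e < N \<Longrightarrow> real_of_int (A e) = U * (vnum e / (vnum e + vden e))"
  and B_eq: "e < N \<Longrightarrow> real_of_int (B e) = U * (wnum e / (wnum e + wden e))"
  using dvd_U[of e] by (auto simp: A_def B_def real_of_int_div)

lemma A_bounds: "e < N \<Longrightarrow> 0 \<le> A e" "e < N \<Longrightarrow> A e \<le> U"
  and B_bounds: "e < N \<Longrightarrow> 0 \<le> B e" "e < N \<Longrightarrow> B e \<le> U"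
proof -
  have *: "0 \<le> U * x div (x + y) \<and> U * x div (x + y) \<le> U" if "0 \<le> x" "0 < y" for x y :: int
  proof
    show "0 \<le> U * x div (x + y)" using that U_pos by (simp add: pos_imp_zdiv_nonneg_iff)
    have "U * x div (x + y) \<le> U * (x + y) div (x + y)"
      using that U_pos by (intro zdiv_mono1 mult_left_mono) auto
    then show "U * x div (x + y) \<le> U" using that by simp
  qed
  show "e < N \<Longrightarrow> 0 \<le> A e" "e < N \<Longrightarrow> A e \<le> U" "e < N \<Longrightarrow> 0 \<le> B e" "e < N \<Longrightarrow> B e \<le> U"
    using *[of "vnum e" "vden e"] *[of "wnum e" "wden e"] quotients[of e] by (auto simp: A_def B_def)
qed

section \<open>Bounds on the rounded dual raises\<close>

lemma H_nonneg: "0 \<le> H e"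
  by (subst H.simps) simp

lemma H_le:
  assumes e: "e < N"
  shows "H e \<le> 64 * U ^ 2"
proof -
  have "0 \<le> (\<Sum>e'<e. of_bool (row e' = row e) * H e') * A e" "0 \<le> (\<Sum>e'<e. of_bool (col e' = col e) * H e') * B e"
    using e by (auto intro!: mult_nonneg_nonneg sum_nonneg H_nonneg A_bounds B_bounds)
  then have "(64 * A e * B e * U - (\<Sum>e'<e. of_bool (row e' = row e) * H e') * A e
      - (\<Sum>e'<e. of_bool (col e' = col e) * H e') * B e) div U \<le> 64 * A e * B e * U div U"
    using U_pos by (intro zdiv_mono1) auto
  then have *: "H e \<le> 64 * A e * B e"
    using A_bounds[OF e] B_bounds[OF e] U_pos by (subst H.simps) auto
  have "64 * (A e * B e) \<le> 64 * (U * U)"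
    using A_bounds[OF e] B_bounds[OF e] by (intro mult_left_mono mult_mono) auto
  with * show "H e \<le> 64 * U ^ 2" by (simp add: power2_eq_square)
qed

text \<open>The integer form of the hypothesis \<open>cover\<close> of \<open>dual_bound\<close> for
  \<open>\<epsilon> = 63/64\<close>. On the right, the share of \<open>e\<close> in the two sums and
  the last term combine to \<open>2 * U * H e\<close>, enough to make up for rounding down.\<close>

lemma H_cover:
  assumes e: "e < N"
  shows "63 * A e * B e * U \<le> (\<Sum>e'<N. of_bool (row e' = row e) * H e') * A e
    + (\<Sum>e'<N. of_bool (col e' = col e) * H e') * B e + H e * (2 * U - A e - B e)"
proof -
  define P where "P = (\<Sum>e'<e. of_bool (row e' = row e) * H e')"
  define Q where "Q = (\<Sum>e'<e. of_bool (col e' = col e) * H e')"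
  define X where "X = 64 * A e * B e * U - P * A e - Q * B e"
  have H: "H e = max 0 (X div U)" by (subst H.simps) (simp add: X_def P_def Q_def)
  have "(\<Sum>e'<Suc e. of_bool (k e' = k e) * H e') \<le> (\<Sum>e'<N. of_bool (k e' = k e) * H e')"
    for k :: "nat \<Rightarrow> nat"
    using e by (intro sum_mono2) (auto simp: H_nonneg)
  from this[of row] this[of col]
  have PQ: "P + H e \<le> (\<Sum>e'<N. of_bool (row e' = row e) * H e')"
    "Q + H e \<le> (\<Sum>e'<N. of_bool (col e' = col e) * H e')"
    by (simp_all add: P_def Q_def)
  have "63 * A e * B e * U \<le> (P + H e) * A e + (Q + H e) * B e + H e * (2 * U - A e - B e)"
  proof (cases "X < U")
    case True
    then have "X div U \<le> 0" using pos_imp_zdiv_pos_iff[OF U_pos, of X] by linarith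
    then have H0: "H e = 0" using H by simp
    have PQ0: "0 \<le> P * A e" "0 \<le> Q * B e"
      using e by (auto intro!: mult_nonneg_nonneg sum_nonneg H_nonneg A_bounds B_bounds simp: P_def Q_def)
    show ?thesis
    proof (cases "A e * B e = 0")
      case True
      then show ?thesis using PQ0 H0 by auto
    next
      case False
      \<comment> \<open>By integrality, a nonzero profit \<open>64 * A e * B e * U\<close> is at
        least \<open>64 * U\<close>, so a residual \<open>X < U\<close> is less than one 64th of
        it.\<close>
      then have "1 \<le> A e * B e" using A_bounds[OF e] B_bounds[OF e] by (simp add: int_one_le_iff_zero_less)
      then have "1 * U \<le> A e * B e * U" using U_pos by (intro mult_right_mono) auto
      then show ?thesis using True H0 by (simp add: X_def)
    qed
  next
    case False
    then have "1 \<le> X div U" using U_pos by (simp add: pos_imp_zdiv_pos_iff int_one_le_iff_zero_less)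
    then have He: "H e = X div U" "1 \<le> H e" using H by auto
    \<comment> \<open>Rounding down loses less than one unit, and \<open>H e\<close> is at least one
      unit.\<close>
    have "X < U * (H e + 1)"
      unfolding He(1) using div_bounds(2)[OF U_pos, of X] by (simp add: distrib_left)
    also have "\<dots> \<le> U * (2 * H e)" using He U_pos by (intro mult_left_mono) auto
    finally have "X < 2 * U * H e" by simp
    moreover have "0 \<le> A e * B e * U" using A_bounds[OF e] B_bounds[OF e] U_pos by simp
    ultimately show ?thesis by (simp add: X_def algebra_simps)
  qed
  also have "\<dots> \<le> (\<Sum>e'<N. of_bool (row e' = row e) * H e') * A e
    + (\<Sum>e'<N. of_bool (col e' = col e) * H e') * B e + H e * (2 * U - A e - B e)"
    using PQ A_bounds[OF e] B_bounds[OF e] by (intro add_mono mult_right_mono) auto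
  finally show ?thesis .
qed

text \<open>Here rounding down helps. If \<open>H e = 0\<close>, the residual profit may be
  negative, hence the premise \<open>0 < H e\<close>.\<close>

lemma H_profit:
  assumes e: "e < N" and pos: "0 < H e"
  shows "H e * U + A e * (\<Sum>e'<e. of_bool (row e' = row e) * H e')
    + B e * (\<Sum>e'<e. of_bool (col e' = col e) * H e') \<le> 64 * A e * B e * U"
proof -
  let ?X = "64 * A e * B e * U - (\<Sum>e'<e. of_bool (row e' = row e) * H e') * A e
      - (\<Sum>e'<e. of_bool (col e' = col e) * H e') * B e"
  have "H e = ?X div U" using pos H.simps[of e] by auto
  then have "H e * U \<le> ?X" using div_bounds(1)[OF U_pos, of ?X] by (simp only: mult.commute)
  then show ?thesis by (simp add: algebra_simps)
qed

text \<open>When the cap takes effect, rounding the quotient down wastes less than one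
  \<open>a\<close>. With \<open>a \<le> U\<close> the load then exceeds \<open>21 * U\<close>; this
  is the loss from \<open>22/64\<close> to \<open>21/64\<close>.\<close>

lemma capped_props:
  assumes "load \<le> 22 * U" "0 \<le> a" "0 \<le> y"
  shows "0 \<le> capped load a y" "capped load a y \<le> y" "load + a * capped load a y \<le> 22 * U"
    "capped load a y < y \<Longrightarrow> 22 * U - a < load + a * capped load a y"
proof -
  have *: "0 \<le> (22 * U - load) div a \<and> (22 * U - load) div a \<le> y \<and> a * ((22 * U - load) div a) \<le> 22 * U - load
    \<and> 22 * U - load - a < a * ((22 * U - load) div a)" if "22 * U - load < a * y"
  proof -
    have a: "0 < a" using assms that by (cases "a = 0") auto
    note div_bounds[OF a, of "22 * U - load"]
    moreover have "0 \<le> (22 * U - load) div a" using a assms by (simp add: pos_imp_zdiv_nonneg_iff)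
    moreover have "(22 * U - load) div a \<le> (a * y) div a" using a that by (intro zdiv_mono1) auto
    ultimately show ?thesis using a by simp
  qed
  with assms show "0 \<le> capped load a y" "capped load a y \<le> y" "load + a * capped load a y \<le> 22 * U"
    "capped load a y < y \<Longrightarrow> 22 * U - a < load + a * capped load a y"
    using assms unfolding capped_def by (auto split: if_splits)
qed

section \<open>Loads of the agents during the reverse unwinding\<close>

definition "row_load t i = (\<Sum>t'<t. of_bool (row (edge t') = i) * (A (edge t') * Z t'))"
definition "col_load t j = (\<Sum>t'<t. of_bool (col (edge t') = j) * (B (edge t') * Z t'))"

lemma Z_eq: "Z t = (if 0 < H (edge t)
    then capped (col_load t (col (edge t))) (B (edge t)) (capped (row_load t (row (edge t))) (A (edge t)) 64)
    else 0)"
  by (subst Z.simps) (simp add: row_load_def col_load_def)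

lemma edge_less: "t < N \<Longrightarrow> edge t < N"
  by (simp add: edge_def)

lemma edge_edge: "t < N \<Longrightarrow> edge (edge t) = t"
  by (simp add: edge_def)

lemma load_Suc:
  "row_load (Suc t) i = row_load t i + of_bool (row (edge t) = i) * (A (edge t) * Z t)"
  "col_load (Suc t) j = col_load t j + of_bool (col (edge t) = j) * (B (edge t) * Z t)"
  by (simp_all add: row_load_def col_load_def)

lemma Z_step:
  assumes t: "t < N" and row: "row_load t (row (edge t)) \<le> 22 * U" and col: "col_load t (col (edge t)) \<le> 22 * U"
  shows "0 \<le> Z t" "Z t \<le> 64" "row_load t (row (edge t)) + A (edge t) * Z t \<le> 22 * U"
    "col_load t (col (edge t)) + B (edge t) * Z t \<le> 22 * U"
    "0 < H (edge t) \<Longrightarrow> Z t = 64 \<or> 21 * U \<le> row_load t (row (edge t)) + A (edge t) * Z t \<or>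
       21 * U \<le> col_load t (col (edge t)) + B (edge t) * Z t"
proof -
  note a = A_bounds[OF edge_less[OF t]] and b = B_bounds[OF edge_less[OF t]]
  define z where "z = capped (row_load t (row (edge t))) (A (edge t)) 64"
  note 1 = capped_props[OF row a(1), of 64, folded z_def]
  have z0: "0 \<le> z" using 1 by simp
  note 2 = capped_props[OF col b(1) z0]
  have Z: "Z t = (if 0 < H (edge t) then capped (col_load t (col (edge t))) (B (edge t)) z else 0)"
    by (subst Z_eq) (simp add: z_def)
  show "0 \<le> Z t" "Z t \<le> 64" "col_load t (col (edge t)) + B (edge t) * Z t \<le> 22 * U"
    using Z 1 2 col by auto
  have "A (edge t) * Z t \<le> A (edge t) * z" using Z 2 z0 a by (intro mult_left_mono) auto
  then show "row_load t (row (edge t)) + A (edge t) * Z t \<le> 22 * U" using 1 by simp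
  show "0 < H (edge t) \<Longrightarrow> Z t = 64 \<or> 21 * U \<le> row_load t (row (edge t)) + A (edge t) * Z t \<or>
       21 * U \<le> col_load t (col (edge t)) + B (edge t) * Z t"
    using Z 1 2 a b by (cases "Z t = z") auto
qed

lemma load_bounds: "t \<le> N \<Longrightarrow> row_load t i \<in> {0..22 * U} \<and> col_load t j \<in> {0..22 * U}"
proof (induction t arbitrary: i j)
  case 0
  then show ?case using U_pos by (simp add: row_load_def col_load_def)
next
  case (Suc t)
  then have IH: "row_load t i \<in> {0..22 * U}" "col_load t j \<in> {0..22 * U}" for i j by auto
  have t: "t < N" using Suc by simp
  have "row_load t (row (edge t)) \<le> 22 * U" "col_load t (col (edge t)) \<le> 22 * U"
    using IH by auto
  note Z = Z_step[OF t this]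
  show ?case
    unfolding load_Suc using IH Z A_bounds[OF edge_less[OF t]] B_bounds[OF edge_less[OF t]]
    by (auto simp: of_bool_def)
qed

lemma Z_props:
  assumes t: "t < N"
  shows "0 \<le> Z t" "Z t \<le> 64"
    "0 < H (edge t) \<Longrightarrow> Z t = 64 \<or> 21 * U \<le> row_load (Suc t) (row (edge t)) \<or>
       21 * U \<le> col_load (Suc t) (col (edge t))"
  using Z_step[OF t] load_bounds[of t] t by (auto simp: load_Suc)

lemma sum_H_bounds: "k \<le> N \<Longrightarrow> (\<Sum>e<k. of_bool (P e) * H e) \<in> {0..N * (64 * U ^ 2)}"
proof -
  assume "k \<le> N"
  then have "(\<Sum>e<k. of_bool (P e) * H e) \<le> (\<Sum>e<k. 64 * U ^ 2)"
    using H_le by (intro sum_mono) (auto simp: of_bool_def)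
  also have "\<dots> \<le> N * (64 * U ^ 2)" using \<open>k \<le> N\<close> by (simp add: mult_right_mono)
  finally show ?thesis by (auto intro!: sum_nonneg simp: H_nonneg)
qed

end

section \<open>Correctness of the program\<close>

lemma abs_le_power_bits: "\<bar>z\<bar> \<le> 2 ^ bits z"
proof -
  have "\<bar>z\<bar> < 2 ^ nat (bitlen \<bar>z\<bar>)" using bitlen_le_iff_power[of "\<bar>z\<bar>" "bitlen \<bar>z\<bar>"] by simp
  also have "(2 :: int) ^ nat (bitlen \<bar>z\<bar>) \<le> 2 ^ bits z" by (simp add: bits_def)
  finally show ?thesis by simp
qed

text \<open>A sum of numbers that are at least 2 is bounded by their product. Thus bit lengths add
  up along the product \<open>U\<close> of sums.\<close>

lemma add_le_power_bits: "\<bar>x + y\<bar> \<le> 2 ^ (bits x + bits y)"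
proof -
  have "(2 :: int) ^ 1 \<le> 2 ^ bits z" for z by (intro power_increasing) (auto simp: bits_def)
  then have 2: "(2 :: int) \<le> 2 ^ bits x" "(2 :: int) \<le> 2 ^ bits y" by simp_all
  have "\<bar>x + y\<bar> \<le> 2 ^ bits x + 2 ^ bits y"
    using abs_le_power_bits[of x] abs_le_power_bits[of y] by linarith
  also have "\<dots> \<le> 2 ^ bits x * 2 ^ bits y"
  proof -
    have "X + Y \<le> X * Y" if "2 \<le> X" "2 \<le> Y" for X Y :: int
      using that mult_mono[of 1 "X - 1" 1 "Y - 1"] by (simp add: algebra_simps)
    from this[OF 2] show ?thesis .
  qed
  finally show ?thesis by (simp add: power_add)
qed

context fs_input
begin

definition "total_size = input_size n m v w"
text \<open>The largest cells are the dual variables, at most \<open>N * (64 * U ^ 2)\<close>;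
  \<open>N\<close> and both factors \<open>U\<close> are at most \<open>2 ^ total_size\<close>, and
  the 10 leaves room for constants.\<close>

definition "cell_bits = 3 * total_size + 10"

definition "edge_bits e = bits (vnum e) + bits (vden e) + bits (wnum e) + bits (wden e)"

lemma size_eq: "total_size = n + m + (\<Sum>e<N. edge_bits e)"
  unfolding total_size_def input_size_def N_def edge_bits_def vnum_def vden_def wnum_def wden_def row_def col_def
  by (subst sum_edges[where f = "\<lambda>i j. bits (numerator (v i j)) + bits (denominator (v i j))
      + bits (numerator (w j i)) + bits (denominator (w j i))"]) simp

lemma N_le_size: "N \<le> total_size"
proof -
  have "N = (\<Sum>e<N. 1)" by simp
  also have "\<dots> \<le> (\<Sum>e<N. edge_bits e)" by (intro sum_mono) (simp add: edge_bits_def bits_def)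
  finally show ?thesis by (simp add: size_eq)
qed

lemma edge_bits_le: "e < N \<Longrightarrow> edge_bits e \<le> total_size"
  using member_le_sum[of e "{..<N}" edge_bits] by (simp add: size_eq)

text \<open>The exponents of the factors are the bit lengths of all entries of the four matrices,
  which are part of the input size. The supplier entries are reindexed by exchanging the sums over
  customers and suppliers.\<close>

lemma U_le: "U \<le> 2 ^ total_size"
proof -
  define \<beta> where "\<beta> a b t = bits (s0 a (int t)) + bits (s0 b (int t))" for a b and t :: nat
  have 1: "(\<Sum>t<N. \<beta> ''vnum'' ''vden'' t) = (\<Sum>e<N. bits (vnum e) + bits (vden e))"
    by (intro sum.cong) (auto simp: \<beta>_def input_cells)
  have "(\<Sum>t<N. \<beta> ''wnum'' ''wden'' t) = (\<Sum>t<m * n. bits (numerator (w (t div n) (t mod n)))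
      + bits (denominator (w (t div n) (t mod n))))"
    by (intro sum.cong)
      (auto simp: \<beta>_def N_def mult.commute input_memory_def matrix_cells_def simp del: of_nat_mult)
  also have "\<dots> = (\<Sum>j<m. \<Sum>i<n. bits (numerator (w j i)) + bits (denominator (w j i)))"
    by (rule sum_edges)
  also have "\<dots> = (\<Sum>i<n. \<Sum>j<m. bits (numerator (w j i)) + bits (denominator (w j i)))"
    by (rule sum.swap)
  also have "\<dots> = (\<Sum>e<N. bits (wnum e) + bits (wden e))"
    unfolding N_def wnum_def wden_def row_def col_def by (rule sum_edges[symmetric])
  finally have 2: "(\<Sum>t<N. \<beta> ''wnum'' ''wden'' t) = (\<Sum>e<N. bits (wnum e) + bits (wden e))" .
  have "U \<le> (\<Prod>t<N. 2 ^ (\<beta> ''vnum'' ''vden'' t + \<beta> ''wnum'' ''wden'' t))"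
    unfolding U_def
  proof (intro prod_mono conjI)
    fix t assume t: "t \<in> {..<N}"
    then show "0 \<le> factor t" using factor_pos[of t] by simp
    have "\<bar>s0 ''vnum'' t + s0 ''vden'' t\<bar> * \<bar>s0 ''wnum'' t + s0 ''wden'' t\<bar> \<le>
      2 ^ \<beta> ''vnum'' ''vden'' t * 2 ^ \<beta> ''wnum'' ''wden'' t"
      unfolding \<beta>_def by (intro mult_mono add_le_power_bits) auto
    then show "factor t \<le> 2 ^ (\<beta> ''vnum'' ''vden'' t + \<beta> ''wnum'' ''wden'' t)"
      using factor_parts[of t] t by (simp add: factor_def power_add)
  qed
  also have "\<dots> = 2 ^ (\<Sum>t<N. \<beta> ''vnum'' ''vden'' t + \<beta> ''wnum'' ''wden'' t)"
    by (rule power_sum[symmetric])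
  also have "\<dots> \<le> 2 ^ total_size"
    unfolding sum.distrib 1 2 by (intro power_increasing) (simp_all add: size_eq edge_bits_def sum.distrib)
  finally show ?thesis .
qed

lemma size_bounds: "int total_size \<le> 2 ^ cell_bits" "64 * U \<le> 2 ^ cell_bits" "64 * U ^ 2 \<le> 2 ^ cell_bits"
  "int N * (64 * U ^ 2) \<le> 2 ^ cell_bits" "64 \<le> (2 :: int) ^ cell_bits"
proof -
  define S :: int where "S = 2 ^ total_size"
  have S: "1 \<le> S" "U \<le> S" "int total_size \<le> S"
    using U_le of_nat_less_two_power[of total_size, where 'a = int] by (simp_all add: S_def)
  have big: "2 ^ cell_bits = 1024 * (S * (S * S))"
  proof -
    have "cell_bits = total_size + (total_size + total_size) + 10" by (simp add: cell_bits_def)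
    then show ?thesis by (simp only: S_def power_add) simp
  qed
  have U2: "U ^ 2 \<le> S * S" unfolding power2_eq_square using S U_pos by (intro mult_mono) auto
  have S2: "S \<le> S * S" using S mult_left_mono[of 1 S S] by simp
  have S3: "S * S \<le> S * (S * S)" using S S2 by (intro mult_left_mono) auto
  show "int total_size \<le> 2 ^ cell_bits" "64 * U \<le> 2 ^ cell_bits" "64 * U ^ 2 \<le> 2 ^ cell_bits" "64 \<le> (2 :: int) ^ cell_bits"
    unfolding big using S U2 S2 S3 by linarith+
  have "int N * (64 * U ^ 2) \<le> S * (64 * (S * S))"
    using U2 S N_le_size by (intro mult_mono) auto
  then show "int N * (64 * U ^ 2) \<le> 2 ^ cell_bits" unfolding big using S S2 S3 by linarith
qed

lemma bounded_input: "bounded_memory cell_bits s0"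
  unfolding bounded_memory_def
proof (intro allI)
  fix a k
  have num: "\<bar>numerator (v i j)\<bar> \<le> 2 ^ cell_bits" "\<bar>denominator (v i j)\<bar> \<le> 2 ^ cell_bits"
    "\<bar>numerator (w j i)\<bar> \<le> 2 ^ cell_bits" "\<bar>denominator (w j i)\<bar> \<le> 2 ^ cell_bits"
    if "i < n" "j < m" for i j
  proof -
    have "i * m + j < (i + 1) * m" "(i + 1) * m \<le> n * m"
      using that by (simp, intro mult_le_mono1, simp)
    then have e: "i * m + j < N" by (simp add: N_def)
    have rc: "row (i * m + j) = i" "col (i * m + j) = j" using that by (auto simp: row_def col_def)
    have "bits z \<le> cell_bits \<Longrightarrow> \<bar>z\<bar> \<le> 2 ^ cell_bits" for z
      using abs_le_power_bits[of z] by (rule order.trans) (simp add: power_increasing)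
    then show "\<bar>numerator (v i j)\<bar> \<le> 2 ^ cell_bits" "\<bar>denominator (v i j)\<bar> \<le> 2 ^ cell_bits"
      "\<bar>numerator (w j i)\<bar> \<le> 2 ^ cell_bits" "\<bar>denominator (w j i)\<bar> \<le> 2 ^ cell_bits"
      using edge_bits_le[OF e]
      by (simp_all add: edge_bits_def vnum_def vden_def wnum_def wden_def rc cell_bits_def)
  qed
  have mat: "\<bar>matrix_cells nr nc f k\<bar> \<le> 2 ^ cell_bits"
    if "\<And>i j. i < nr \<Longrightarrow> j < nc \<Longrightarrow> \<bar>f i j\<bar> \<le> 2 ^ cell_bits" for nr nc f
  proof (cases "0 \<le> k \<and> k < int (nr * nc)")
    case True
    then have "nat k < nr * nc" by linarith
    then have "nat k div nc < nr" "nat k mod nc < nc"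
      by (auto simp: less_mult_imp_div_less) (cases nc; simp)
    then show ?thesis using that by (simp add: matrix_cells_def)
  qed (auto simp: matrix_cells_def)
  have "n \<le> total_size" "m \<le> total_size" by (simp_all add: size_eq)
  with size_bounds(1) have "\<bar>scalar_cells (int n) k\<bar> \<le> 2 ^ cell_bits" "\<bar>scalar_cells (int m) k\<bar> \<le> 2 ^ cell_bits"
    by (auto simp: scalar_cells_def)
  with num mat show "\<bar>s0 a k\<bar> \<le> 2 ^ cell_bits" by (simp add: input_memory_def)
qed

lemma small: "z \<le> int N \<Longrightarrow> z \<le> 2 ^ cell_bits" "z \<le> 64 \<Longrightarrow> z \<le> 2 ^ cell_bits" "z \<le> 22 * U \<Longrightarrow> z \<le> 2 ^ cell_bits"
  "z \<le> 64 * U ^ 2 \<Longrightarrow> z \<le> 2 ^ cell_bits" "z \<le> int N * (64 * U ^ 2) \<Longrightarrow> z \<le> 2 ^ cell_bits"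
  "z \<le> int n \<Longrightarrow> z \<le> 2 ^ cell_bits" "z \<le> int m \<Longrightarrow> z \<le> 2 ^ cell_bits"
  using size_bounds U_pos N_le_size size_eq by linarith+

lemma small_nat: "z \<le> N \<Longrightarrow> z \<le> 2 ^ cell_bits" "z \<le> n \<Longrightarrow> z \<le> 2 ^ cell_bits" "z \<le> m \<Longrightarrow> z \<le> 2 ^ cell_bits"
  using small(1,6,7)[of "int z"] by (simp_all flip: of_nat_le_iff)

section \<open>Loop invariants\<close>

definition basic :: "nat \<Rightarrow> memory \<Rightarrow> bool" where
  "basic k s \<longleftrightarrow> bounded_memory cell_bits s \<and> s ''t'' 0 = int k \<and>
     (\<forall>a\<in>{''n'', ''m'', ''vnum'', ''vden'', ''wnum'', ''wden''}. s a = s0 a)"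

lemma basic_store:
  assumes "bounded_memory cell_bits s" "k \<le> N" "\<forall>a\<in>{''n'', ''m'', ''vnum'', ''vden'', ''wnum'', ''wden''}. s a = s0 a"
  shows "basic k (store s ''t'' 0 (int k))"
  using assms small(1)[of "int k"] unfolding basic_def by (auto intro!: bounded_memory_store)

definition located :: "memory \<Rightarrow> nat \<Rightarrow> memory" where
  "located s e = store (store (store (store (store (store s ''e'' 0 (int e)) ''i'' 0 (int (row e)))
     ''j'' 0 (int (col e))) ''k'' 0 (int (col e * n + row e))) ''A'' 0 (A e)) ''B'' 0 (B e)"

lemma run_locate:
  assumes s: "basic k s" "s ''U'' 0 = U" and e: "e < N" "eval_expr s x = int e"
  shows "run (locate x) (s, r) = (located s e, r)"
proof -
  have "int e div int m = int (row e)" "int e mod int m = int (col e)"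
    by (simp_all add: row_def col_def zdiv_int zmod_int)
  with s e input_cells[OF e(1)] scalar_inputs show ?thesis
    by (simp add: locate_def located_def basic_def A_def B_def)
qed

lemma located_other:
  "a \<notin> {''e'', ''i'', ''j'', ''k'', ''A'', ''B''} \<Longrightarrow> located s e a = s a"
  by (simp add: located_def store_def)

lemma located_vars:
  "located s e ''e'' 0 = int e" "located s e ''i'' 0 = int (row e)" "located s e ''j'' 0 = int (col e)"
  "located s e ''A'' 0 = A e" "located s e ''B'' 0 = B e"
  by (simp_all add: located_def)

lemma bounded_located:
  assumes "bounded_memory cell_bits s" "e < N"
  shows "bounded_memory cell_bits (located s e)"
  unfolding located_def
  using assms row_col(1,2,4)[OF assms(2)] A_bounds[OF assms(2)] B_bounds[OF assms(2)] U_pos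
  by (intro bounded_memory_store)
    (auto simp del: of_nat_add of_nat_mult intro: small small_nat)

text \<open>The zero arrays are carried along because the later loops take them as their initial
  values.\<close>

definition inv_product :: "nat \<Rightarrow> memory \<Rightarrow> bool list \<Rightarrow> bool" where
  "inv_product k s r \<longleftrightarrow> basic k s \<and> s ''U'' 0 = prod factor {..<k} \<and>
     (\<forall>a\<in>{''h'', ''p'', ''q'', ''L'', ''K'', ''y'', ''x''}. s a = (\<lambda>_. 0))"

text \<open>The remaining factors are positive integers, so a partial product cannot exceed the
  complete one.\<close>

lemma prod_factor_bounds: "k \<le> N \<Longrightarrow> prod factor {..<k} \<in> {0..U}"
proof -
  assume k: "k \<le> N"
  have f1: "1 \<le> factor t" if "t < N" for t using factor_pos[OF that] by simp
  have nn: "0 \<le> prod factor {..<k}"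
    using k factor_pos by (intro prod_nonneg) (auto intro: less_imp_le)
  have "prod factor {..<k} * 1 \<le> prod factor {..<k} * prod factor {k..<N}"
    using nn f1 by (intro mult_left_mono prod_ge_1) auto
  also have "\<dots> = U"
    unfolding U_def using k by (subst prod.union_disjoint[symmetric]) (auto intro!: prod.cong)
  finally show ?thesis using nn by simp
qed

lemma inv_product_step:
  assumes k: "k < N" and inv: "inv_product k s r"
  shows "case run product_step (s, r) of (s', r') \<Rightarrow> inv_product (Suc k) (store s' ''t'' 0 (s' ''t'' 0 + 1)) r'"
proof -
  have run: "run product_step (s, r) = (store s ''U'' 0 (prod factor {..<Suc k}), r)"
    using inv by (simp add: inv_product_def basic_def product_step_def factor_def)
  have "bounded_memory cell_bits (store s ''U'' 0 (prod factor {..<Suc k}))"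
    using inv prod_factor_bounds[of "Suc k"] k U_pos
    by (intro bounded_memory_store) (auto simp: inv_product_def basic_def simp del: prod.lessThan_Suc intro: small)
  then have "basic (Suc k) (store (store s ''U'' 0 (prod factor {..<Suc k})) ''t'' 0 (int (Suc k)))"
    using inv k by (intro basic_store) (auto simp: inv_product_def basic_def)
  then show ?thesis
    using inv by (simp add: run inv_product_def basic_def add.commute)
qed

definition inv_push :: "nat \<Rightarrow> memory \<Rightarrow> bool list \<Rightarrow> bool" where
  "inv_push k s r \<longleftrightarrow> basic k s \<and> s ''U'' 0 = U \<and>
     (\<forall>e. s ''h'' (int e) = (if e < k then H e else 0)) \<and>
     (\<forall>i. s ''p'' (int i) = (\<Sum>e<k. of_bool (row e = i) * H e)) \<and>
     (\<forall>j. s ''q'' (int j) = (\<Sum>e<k. of_bool (col e = j) * H e)) \<and>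
     (\<forall>a\<in>{''L'', ''K'', ''y'', ''x''}. s a = (\<lambda>_. 0))"

text \<open>The cells of \<open>p\<close> and \<open>q\<close> at the endpoints hold the sums over
  earlier edges from the recursion of \<open>H\<close>, so the gain computed is the quotient in that
  recursion.\<close>

lemma inv_push_step:
  assumes k: "k < N" and inv: "inv_push k s r"
  shows "case run push_step (s, r) of (s', r') \<Rightarrow> inv_push (Suc k) (store s' ''t'' 0 (s' ''t'' 0 + 1)) r'"
proof -
  have basic: "basic k s" and U: "s ''U'' 0 = U" and t: "s ''t'' 0 = int k"
    using inv by (auto simp: inv_push_def basic_def)
  define s1 where "s1 = located s k"
  define P where "P = (\<Sum>e<k. of_bool (row e = row k) * H e)"
  define Q where "Q = (\<Sum>e<k. of_bool (col e = col k) * H e)"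
  define g where "g = (64 * A k * B k * U - P * A k - Q * B k) div U"
  have H: "H k = max 0 g" by (subst H.simps) (simp add: g_def P_def Q_def)
  have s1: "s1 a = s a" if "a \<notin> {''e'', ''i'', ''j'', ''k'', ''A'', ''B''}" for a
    using located_other[OF that] by (simp add: s1_def)
  have loc: "run (locate (var ''t'')) (s, r) = (s1, r)"
    unfolding s1_def using k t by (intro run_locate[OF basic U]) auto
  have PQ: "s ''p'' (int (row k)) = P" "s ''q'' (int (col k)) = Q"
    using inv by (auto simp: inv_push_def P_def Q_def)
  define s2 where "s2 = store (store (store s1 ''h'' (int k) (H k)) ''p'' (int (row k)) (P + H k)) ''q'' (int (col k)) (Q + H k)"
  have b1: "bounded_memory cell_bits s1"
    unfolding s1_def using basic k by (intro bounded_located) (auto simp: basic_def)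
  have sums: "(\<Sum>e<Suc k. of_bool (row e = row k) * H e) = P + H k" "(\<Sum>e<Suc k. of_bool (col e = col k) * H e) = Q + H k"
    by (simp_all add: P_def Q_def)
  have b2: "bounded_memory cell_bits s2"
    unfolding s2_def
    using b1 k H_nonneg[of k] H_le[OF k] sum_H_bounds[of "Suc k" "\<lambda>e. row e = row k"]
      sum_H_bounds[of "Suc k" "\<lambda>e. col e = col k"] unfolding sums
    by (intro bounded_memory_store) (auto intro: small)
  have run: "run push_step (s, r) = (if 0 < g then s2 else s1, r)"
    unfolding push_step_def Let_def run.simps(3) loc
    using U PQ H by (simp add: located_vars[of s k, folded s1_def] s1 add_to_def g_def[symmetric] s2_def)
  define s3 where "s3 = (if 0 < g then s2 else s1)"
  have b3: "bounded_memory cell_bits s3" using b1 b2 by (simp add: s3_def)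
  have s3: "s3 a = s a" if "a \<notin> {''e'', ''i'', ''j'', ''k'', ''A'', ''B'', ''h'', ''p'', ''q''}" for a
    using that by (simp add: s3_def s2_def s1)
  \<comment> \<open>Without a positive gain nothing is written, and the initial 0 in the cell equals
    \<open>H k\<close>.\<close>
  have s3h: "s3 ''h'' = (s ''h'')(int k := H k)"
  proof (cases "0 < g")
    case False
    have "s ''h'' (int k) = 0" using inv by (simp add: inv_push_def)
    with False show ?thesis using H by (auto simp: s3_def s1)
  qed (simp add: s3_def s2_def s1 fun_eq_iff)
  have s3p: "s3 ''p'' = (s ''p'')(int (row k) := P + H k)"
    using H PQ by (auto simp: s3_def s2_def s1)
  have s3q: "s3 ''q'' = (s ''q'')(int (col k) := Q + H k)"
    using H PQ by (auto simp: s3_def s2_def s1)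
  have "basic (Suc k) (store s3 ''t'' 0 (int (Suc k)))"
    using basic k b3 s3 by (intro basic_store) (auto simp: basic_def)
  moreover have "s3 ''t'' 0 + 1 = int (Suc k)" using t s3[of "''t''"] by simp
  ultimately show ?thesis
    using inv PQ unfolding run s3_def[symmetric]
    by (auto simp: inv_push_def s3 s3h s3p s3q less_Suc_eq add.commute)
qed

text \<open>As \<open>edge\<close> is an involution, edge \<open>e\<close> is treated in step
  \<open>edge e\<close>; its cell of \<open>y\<close> is therefore final once
  \<open>edge e < k\<close>.\<close>

definition inv_pop :: "nat \<Rightarrow> memory \<Rightarrow> bool list \<Rightarrow> bool" where
  "inv_pop k s r \<longleftrightarrow> basic k s \<and> s ''U'' 0 = U \<and>
     (\<forall>e<N. s ''h'' (int e) = H e) \<and>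
     (\<forall>e<N. s ''y'' (int e) = (if edge e < k then Z (edge e) else 0)) \<and>
     (\<forall>i. s ''L'' (int i) = row_load k i) \<and>
     (\<forall>j. s ''K'' (int j) = col_load k j) \<and>
     s ''x'' = (\<lambda>_. 0)"

lemma inv_pop_step:
  assumes k: "k < N" and inv: "inv_pop k s r"
  shows "case run pop_step (s, r) of (s', r') \<Rightarrow> inv_pop (Suc k) (store s' ''t'' 0 (s' ''t'' 0 + 1)) r'"
proof -
  have basic: "basic k s" and U: "s ''U'' 0 = U" and t: "s ''t'' 0 = int k"
    using inv by (auto simp: inv_pop_def basic_def)
  define e where "e = edge k"
  have e: "e < N" "edge e = k" using k by (simp_all add: e_def edge_less edge_edge)
  define s1 where "s1 = located s e"
  have s1: "s1 a = s a" if "a \<notin> {''e'', ''i'', ''j'', ''k'', ''A'', ''B''}" for a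
    using located_other[OF that] by (simp add: s1_def)
  have "eval_expr s (var ''n'' *\<^sub>e var ''m'' -\<^sub>e Const 1 -\<^sub>e var ''t'') = int e"
    using basic t k scalar_inputs by (simp add: basic_def e_def edge_def N_def of_nat_diff)
  then have loc: "run (locate (var ''n'' *\<^sub>e var ''m'' -\<^sub>e Const 1 -\<^sub>e var ''t'')) (s, r) = (s1, r)"
    unfolding s1_def using e by (intro run_locate[OF basic U]) auto
  have LK: "s ''L'' (int (row e)) = row_load k (row e)" "s ''K'' (int (col e)) = col_load k (col e)"
    "s ''h'' (int e) = H e"
    using inv e by (auto simp: inv_pop_def)
  define z where "z = capped (row_load k (row e)) (A e) 64"
  have Z: "Z k = (if 0 < H e then capped (col_load k (col e)) (B e) z else 0)"
    by (subst Z_eq) (simp add: z_def e_def)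
  \<comment> \<open>\<open>s2\<close> and \<open>s3\<close> are the memories after the customer's
    and the supplier's cap, \<open>s4\<close> the one after recording the amount and the new
    loads.\<close>
  define s2 where "s2 = (if 22 * U - row_load k (row e) < A e * 64
    then store (store s1 ''Y'' 0 64) ''Y'' 0 z else store s1 ''Y'' 0 64)"
  define s3 where "s3 = (if 22 * U - col_load k (col e) < B e * z then store s2 ''Y'' 0 (Z k) else s2)"
  define s4 where "s4 = store (store (store s3 ''y'' (int e) (Z k))
    ''L'' (int (row e)) (row_load k (row e) + A e * Z k)) ''K'' (int (col e)) (col_load k (col e) + B e * Z k)"
  have s2: "s2 a = s1 a" if "a \<noteq> ''Y''" for a using that by (simp add: s2_def)
  have s2Y: "s2 ''Y'' 0 = z" by (simp add: s2_def z_def capped_def)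
  have s3: "s3 a = s1 a" if "a \<noteq> ''Y''" for a using that s2 by (simp add: s3_def)
  have s3Y: "s3 ''Y'' 0 = Z k" if "0 < H e" using that s2Y by (simp add: s3_def Z capped_def)
  note vars = located_vars[of s e, folded s1_def]
  have cap1: "run (cap_at ''L'' (var ''i'') ''A'') (store s1 ''Y'' 0 64, r) = (s2, r)"
    using U LK vars s1 by (simp add: cap_at_def Let_def s2_def z_def capped_def)
  have cap2: "run (cap_at ''K'' (var ''j'') ''B'') (s2, r) = (s3, r)" if "0 < H e"
    using U LK vars s1 s2 s2Y Z that by (simp add: cap_at_def Let_def s3_def capped_def)
  have run: "run pop_step (s, r) = (if 0 < H e then s4 else s1, r)"
    unfolding pop_step_def run.simps(3) loc
    using LK vars s1 s3 s3Y cap1 cap2 by (simp add: add_to_def s4_def)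
  have props: "0 \<le> Z k" "Z k \<le> 64" using Z_props[OF k] by auto
  have loads: "row_load (Suc k) (row e) = row_load k (row e) + A e * Z k"
    "col_load (Suc k) (col e) = col_load k (col e) + B e * Z k"
    by (simp_all add: load_Suc e_def)
  have z: "0 \<le> z" "z \<le> 64"
    using capped_props[of "row_load k (row e)" "A e" 64] load_bounds[of k] k A_bounds[OF e(1)]
    by (auto simp: z_def)
  have b1: "bounded_memory cell_bits s1"
    unfolding s1_def using basic e by (intro bounded_located) (auto simp: basic_def)
  then have "bounded_memory cell_bits s2"
    unfolding s2_def using z by (auto intro!: bounded_memory_store small(2))
  then have "bounded_memory cell_bits s3"
    unfolding s3_def using props by (auto intro!: bounded_memory_store small(2))
  then have b4: "bounded_memory cell_bits s4"
    unfolding s4_def using props load_bounds[of "Suc k" "row e" "col e"] k unfolding loads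
    by (auto intro!: bounded_memory_store intro: small)
  define s5 where "s5 = (if 0 < H e then s4 else s1)"
  have b5: "bounded_memory cell_bits s5" using b1 b4 by (simp add: s5_def)
  have s5: "s5 a = s a" if "a \<notin> {''e'', ''i'', ''j'', ''k'', ''A'', ''B'', ''Y'', ''y'', ''L'', ''K''}" for a
    using that by (simp add: s5_def s4_def s1 s3)
  have y0: "s ''y'' (int e) = 0" using inv e by (auto simp: inv_pop_def)
  have s5y: "s5 ''y'' = (s ''y'')(int e := Z k)"
    using y0 Z by (auto simp: s5_def s4_def s1 s3)
  have s5L: "s5 ''L'' = (s ''L'')(int (row e) := row_load (Suc k) (row e))"
    using LK Z unfolding loads by (auto simp: s5_def s4_def s1 s3)
  have s5K: "s5 ''K'' = (s ''K'')(int (col e) := col_load (Suc k) (col e))"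
    using LK Z unfolding loads by (auto simp: s5_def s4_def s1 s3)
  have "basic (Suc k) (store s5 ''t'' 0 (int (Suc k)))"
    using basic k b5 s5 by (intro basic_store) (auto simp: basic_def)
  moreover have "s5 ''t'' 0 + 1 = int (Suc k)" using t s5[of "''t''"] by simp
  moreover have "\<forall>l<N. s5 ''y'' (int l) = (if edge l < Suc k then Z (edge l) else 0)"
    unfolding s5y using inv e by (auto simp: inv_pop_def less_Suc_eq edge_edge e_def)
  moreover have "\<forall>i. s5 ''L'' (int i) = row_load (Suc k) i" "\<forall>j. s5 ''K'' (int j) = col_load (Suc k) j"
    unfolding s5L s5K using inv by (auto simp: inv_pop_def load_Suc e_def)
  ultimately show ?thesis
    using inv unfolding run s5_def[symmetric] by (simp add: inv_pop_def s5 add.commute)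
qed

text \<open>\<open>r0\<close> is the tape at the start of the loop; keeping it fixed expresses the
  output by blocks of the original tape.\<close>

definition inv_round :: "bool list \<Rightarrow> nat \<Rightarrow> memory \<Rightarrow> bool list \<Rightarrow> bool" where
  "inv_round r0 k s r \<longleftrightarrow> basic k s \<and>
     (\<forall>e<N. s ''y'' (int e) = Z (edge e)) \<and>
     (\<forall>e. s ''x'' (int e) = (if e < k then of_bool (coin_value (take 6 (drop (6 * e) r0)) < Y e) else 0)) \<and>
     r = drop (6 * k) r0"

lemma inv_round_step:
  assumes r0: "6 * N \<le> length r0" and k: "k < N" and inv: "inv_round r0 k s r"
  shows "6 \<le> length r"
    "case run round_step (s, r) of (s', r') \<Rightarrow> inv_round r0 (Suc k) (store s' ''t'' 0 (s' ''t'' 0 + 1)) r'"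
proof -
  have basic: "basic k s" and t: "s ''t'' 0 = int k" and r: "r = drop (6 * k) r0"
    using inv by (auto simp: inv_round_def basic_def)
  show len: "6 \<le> length r" using r r0 k by simp
  then obtain b0 b1 b2 b3 b4 b5 r' where r': "r = b0 # b1 # b2 # b3 # b4 # b5 # r'"
    by (auto simp: Suc_le_length_iff numeral_eq_Suc)
  define c where "c = coin_value (take 6 (drop (6 * k) r0))"
  have c: "int c = of_bool b0 + 2 * (of_bool b1 + 2 * (of_bool b2 + 2 * (of_bool b3 + 2 * (of_bool b4 + 2 * of_bool b5))))"
    unfolding c_def r[symmetric] r' by simp
  have r'': "r' = drop (6 * Suc k) r0"
  proof -
    have "r' = drop 6 r" by (simp add: r')
    then show ?thesis by (simp add: r add.commute)
  qed
  have y: "s ''y'' (int k) = int (Y k)"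
    using inv k Z_props[OF edge_less[OF k]] by (auto simp: inv_round_def Y_def)
  define s1 where "s1 = store (store (store (store (store (store s ''z'' 0 (of_bool b0)) ''z'' 1 (of_bool b1))
    ''z'' 2 (of_bool b2)) ''z'' 3 (of_bool b3)) ''z'' 4 (of_bool b4)) ''z'' 5 (of_bool b5)"
  have s1: "s1 a = s a" if "a \<noteq> ''z''" for a using that by (simp add: s1_def)
  have run: "run round_step (s, r) = (store s1 ''x'' (int k) (of_bool (c < Y k)), r')"
  proof -
    have "run round_step (s, r) = (store s1 ''x'' (eval_expr s1 (var ''t''))
        (eval_expr s1 (coins <\<^sub>e Read ''y'' (var ''t''))), r')"
      unfolding r' by (simp add: round_step_def s1_def del: eval_expr.simps(2,3))
    moreover have "eval_expr s1 coins = int c"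
      unfolding c by (simp add: coins_def coin_def s1_def)
    ultimately show ?thesis using t y by (simp add: s1)
  qed
  have "bounded_memory cell_bits (store s1 ''x'' (int k) (of_bool (c < Y k)))"
    unfolding s1_def using basic by (intro bounded_memory_store) (auto simp: basic_def intro: small)
  then have "basic (Suc k) (store (store s1 ''x'' (int k) (of_bool (c < Y k))) ''t'' 0 (int (Suc k)))"
    using basic k s1 by (intro basic_store) (auto simp: basic_def)
  then show "case run round_step (s, r) of (s', r') \<Rightarrow> inv_round r0 (Suc k) (store s' ''t'' 0 (s' ''t'' 0 + 1)) r'"
    using inv t r'' unfolding run
    by (auto simp: inv_round_def s1 less_Suc_eq c_def add.commute)
qed

end

section \<open>Total running time and final memory\<close>

lemma loop_costD:
  assumes "loop_cost c K" "1 \<le> b" "bounded_memory b s" "I 0 (store s ''t'' 0 0) r"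
    and "\<And>k s r. k \<le> N \<Longrightarrow> I k s r \<Longrightarrow>
       bounded_memory b s \<and> s ''t'' 0 = int k \<and> s ''n'' 0 * s ''m'' 0 = int N"
    and "\<And>k s r. k < N \<Longrightarrow> I k s r \<Longrightarrow> flips c \<le> length r"
    and "\<And>k s r. k < N \<Longrightarrow> I k s r \<Longrightarrow>
       (case run c (s, r) of (s', r') \<Rightarrow> I (Suc k) (store s' ''t'' 0 (s' ''t'' 0 + 1)) r')"
  shows "\<exists>t s' r'. exec (for_edges c) (s, r) t (s', r') \<and> t \<le> K * b * (N + 1) \<and> I N s' r'"
proof (rule assms(1)[unfolded loop_cost_def, THEN spec[of _ b], THEN spec[of _ N], THEN spec[of _ I],
      THEN spec[of _ s], THEN spec[of _ r], THEN mp, THEN mp, THEN mp, THEN mp, THEN mp])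
  show "\<forall>k s r. k \<le> N \<longrightarrow> I k s r \<longrightarrow>
       bounded_memory b s \<and> s ''t'' 0 = int k \<and> s ''n'' 0 * s ''m'' 0 = int N"
    by (intro allI impI assms(5))
  show "\<forall>k s r. k < N \<longrightarrow> I k s r \<longrightarrow> flips c \<le> length r \<and>
       (case run c (s, r) of (s', r') \<Rightarrow> I (Suc k) (store s' ''t'' 0 (s' ''t'' 0 + 1)) r')"
    by (intro allI impI conjI assms(6,7))
qed (fact assms)+

context fs_input
begin

lemma basicD: "basic k s \<Longrightarrow> bounded_memory cell_bits s \<and> s ''t'' 0 = int k \<and> s ''n'' 0 * s ''m'' 0 = int N"
  using scalar_inputs by (simp add: basic_def N_def)

lemma inv_productD: "inv_product k s r \<Longrightarrow> bounded_memory cell_bits s \<and> s ''t'' 0 = int k \<and> s ''n'' 0 * s ''m'' 0 = int N"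
  and inv_pushD: "inv_push k s r \<Longrightarrow> bounded_memory cell_bits s \<and> s ''t'' 0 = int k \<and> s ''n'' 0 * s ''m'' 0 = int N"
  and inv_popD: "inv_pop k s r \<Longrightarrow> bounded_memory cell_bits s \<and> s ''t'' 0 = int k \<and> s ''n'' 0 * s ''m'' 0 = int N"
  and inv_roundD: "inv_round r0 k s r \<Longrightarrow> bounded_memory cell_bits s \<and> s ''t'' 0 = int k \<and> s ''n'' 0 * s ''m'' 0 = int N"
  unfolding inv_product_def inv_push_def inv_pop_def inv_round_def by (blast dest: basicD)+

lemma basic_reset: "basic k s \<Longrightarrow> basic 0 (store s ''t'' 0 0)"
  using basic_store[of s 0] by (simp add: basic_def)

text \<open>The three loops are run on the empty tape, which suffices as they flip no coins; the
  resulting run is then transferred to all tapes, so memory and cost before rounding are independent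
  of the randomness.\<close>

lemma exec_deterministic_part:
  assumes K: "loop_cost product_step K0" "loop_cost push_step K1" "loop_cost pop_step K2"
  shows "\<exists>t s'. (\<forall>r. exec deterministic_part (s0, r) t (s', r)) \<and>
    t \<le> 1 + bits 0 + bits 1 + (K0 + K1 + K2) * cell_bits * (N + 1) \<and> (\<exists>r. inv_pop N s' r)"
proof -
  have b: "1 \<le> cell_bits" by (simp add: cell_bits_def)
  define s1 where "s1 = store s0 ''U'' 0 1"
  have e1: "exec (assign ''U'' (Const 1)) (s0, []) (1 + bits 0 + bits 1) (s1, [])"
    using exec_Write[of "''U''" "Const 0" "Const 1" s0 "[]"] by (simp add: s1_def)
  have b1: "bounded_memory cell_bits s1"
    unfolding s1_def by (intro bounded_memory_store bounded_input) simp
  have i1: "inv_product 0 (store s1 ''t'' 0 0) []"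
    using b1 other_cells basic_store[of s1 0] by (auto simp: inv_product_def s1_def)
  have "\<exists>t s' r'. exec (for_edges product_step) (s1, []) t (s', r') \<and>
      t \<le> K0 * cell_bits * (N + 1) \<and> inv_product N s' r'"
    by (rule loop_costD[where I = inv_product, OF K(1) b b1 i1])
      (erule inv_productD, simp add: flips_steps, rule inv_product_step)
  then obtain t2 s2 r2 where e2: "exec (for_edges product_step) (s1, []) t2 (s2, r2)"
    "t2 \<le> K0 * cell_bits * (N + 1)" "inv_product N s2 r2" by blast

  have b2: "bounded_memory cell_bits s2" using e2 by (simp add: inv_product_def basic_def)
  have i2: "inv_push 0 (store s2 ''t'' 0 0) r2"
    using e2(3) basic_reset by (auto simp: inv_product_def inv_push_def U_def)
  have "\<exists>t s' r'. exec (for_edges push_step) (s2, r2) t (s', r') \<and>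
      t \<le> K1 * cell_bits * (N + 1) \<and> inv_push N s' r'"
    by (rule loop_costD[where I = inv_push, OF K(2) b b2 i2])
      (erule inv_pushD, simp add: flips_steps, rule inv_push_step)
  then obtain t3 s3 r3 where e3: "exec (for_edges push_step) (s2, r2) t3 (s3, r3)"
    "t3 \<le> K1 * cell_bits * (N + 1)" "inv_push N s3 r3" by blast

  have b3: "bounded_memory cell_bits s3" using e3 by (simp add: inv_push_def basic_def)
  have i3: "inv_pop 0 (store s3 ''t'' 0 0) r3"
    using e3(3) basic_reset by (auto simp: inv_push_def inv_pop_def row_load_def col_load_def)
  have "\<exists>t s' r'. exec (for_edges pop_step) (s3, r3) t (s', r') \<and>
      t \<le> K2 * cell_bits * (N + 1) \<and> inv_pop N s' r'"
    by (rule loop_costD[where I = inv_pop, OF K(3) b b3 i3])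
      (erule inv_popD, simp add: flips_steps, rule inv_pop_step)
  then obtain t4 s4 r4 where e4: "exec (for_edges pop_step) (s3, r3) t4 (s4, r4)"
    "t4 \<le> K2 * cell_bits * (N + 1)" "inv_pop N s4 r4" by blast

  have "exec deterministic_part (s0, []) (1 + bits 0 + bits 1 + (t2 + (t3 + t4))) (s4, r4)"
    unfolding deterministic_part_def by (intro exec_Seq[OF e1] exec_Seq[OF e2(1)] exec_Seq[OF e3(1)] e4(1))
  from exec_flip_free[OF this flips_steps(5)]
  have "\<forall>r. exec deterministic_part (s0, r) (1 + bits 0 + bits 1 + (t2 + (t3 + t4))) (s4, r)" by simp
  moreover have "1 + bits 0 + bits 1 + (t2 + (t3 + t4)) \<le>
      1 + bits 0 + bits 1 + (K0 + K1 + K2) * cell_bits * (N + 1)"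
    using e2(2) e3(2) e4(2) by (simp add: algebra_simps)
  ultimately show ?thesis using e4(3) by blast
qed

lemma exec_fs_program:
  assumes K: "loop_cost product_step K0" "loop_cost push_step K1" "loop_cost pop_step K2"
    "loop_cost round_step K3" and r: "6 * N \<le> length r"
  shows "\<exists>t s' r'. exec fs_program (s0, r) t (s', r') \<and>
    t \<le> 1 + bits 0 + bits 1 + (K0 + K1 + K2 + K3) * cell_bits * (N + 1) \<and>
    (\<forall>e<N. real_of_int (s' ''x'' (int e)) = rounded 6 Y r e)"
proof -
  have b: "1 \<le> cell_bits" by (simp add: cell_bits_def)
  from exec_deterministic_part[OF K(1-3)] obtain t1 s1 r1 where
    e1: "exec deterministic_part (s0, r) t1 (s1, r)"
      "t1 \<le> 1 + bits 0 + bits 1 + (K0 + K1 + K2) * cell_bits * (N + 1)" "inv_pop N s1 r1"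
    by blast
  have b1: "bounded_memory cell_bits s1" using e1 by (simp add: inv_pop_def basic_def)
  have "edge e < N" if "e < N" for e using that by (rule edge_less)
  then have i1: "inv_round r 0 (store s1 ''t'' 0 0) r"
    using e1(3) basic_reset by (auto simp: inv_pop_def inv_round_def)
  have "\<exists>t s' r'. exec (for_edges round_step) (s1, r) t (s', r') \<and>
      t \<le> K3 * cell_bits * (N + 1) \<and> inv_round r N s' r'"
    by (rule loop_costD[where I = "inv_round r", OF K(4) b b1 i1])
      (erule inv_roundD, simp add: flips_steps inv_round_step(1)[OF r], rule inv_round_step(2)[OF r])
  then obtain t2 s2 r2 where e2: "exec (for_edges round_step) (s1, r) t2 (s2, r2)"
    "t2 \<le> K3 * cell_bits * (N + 1)" "inv_round r N s2 r2" by blast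
  have "exec fs_program (s0, r) (t1 + t2) (s2, r2)"
    unfolding fs_program_def by (rule exec_Seq[OF e1(1) e2(1)])
  moreover have "t1 + t2 \<le> 1 + bits 0 + bits 1 + (K0 + K1 + K2 + K3) * cell_bits * (N + 1)"
    using e1(2) e2(2) by (simp add: algebra_simps)
  moreover have "\<forall>e<N. real_of_int (s2 ''x'' (int e)) = rounded 6 Y r e"
    using e2(3) by (auto simp: inv_round_def rounded_def)
  ultimately show ?thesis by blast
qed

section \<open>The approximation ratio\<close>

definition "customer_weight e = real_weights v (row e) (col e)"
definition "supplier_weight e = real_weights w (col e) (row e)"

abbreviation "cw \<equiv> customer_weight"
abbreviation "sw \<equiv> supplier_weight"

lemma weights_nonneg: "e < N \<Longrightarrow> 0 \<le> cw e" "e < N \<Longrightarrow> 0 \<le> sw e"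
  using quotients[of e] weight_eq[of e] by (simp_all add: customer_weight_def supplier_weight_def real_weights_def)

lemma scaled_weights: "e < N \<Longrightarrow> real_of_int (A e) = U * (cw e / (1 + cw e))"
  "e < N \<Longrightarrow> real_of_int (B e) = U * (sw e / (1 + sw e))"
proof -
  have "p / q / (1 + p / q) = p / (p + q)" if "0 \<le> p" "0 < q" for p q :: real
  proof -
    have "1 + p / q = (p + q) / q" using that by (simp add: add_divide_distrib)
    then show ?thesis using that by simp
  qed
  note ratio = this
  assume e: "e < N"
  have "cw e / (1 + cw e) = vnum e / (vnum e + vden e)"
    unfolding customer_weight_def real_weights_def weight_eq of_int_add
    using quotients[of e] e by (intro ratio) auto
  then show "real_of_int (A e) = U * (cw e / (1 + cw e))" using A_eq[OF e] by simp
  have "sw e / (1 + sw e) = wnum e / (wnum e + wden e)"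
    unfolding supplier_weight_def real_weights_def weight_eq of_int_add
    using quotients[of e] e by (intro ratio) auto
  then show "real_of_int (B e) = U * (sw e / (1 + sw e))" using B_eq[OF e] by simp
qed

lemma inj_edge: "row e = row l \<Longrightarrow> col e = col l \<Longrightarrow> e = l"
  by (metis row_col(3))

text \<open>The double sum over pairs is rewritten over edge numbers, the form used by
  \<open>dual_bound\<close> and \<open>rounding_bound\<close>.\<close>

lemma fs_objective_eq:
  "fs_objective n m (real_weights v) (real_weights w) x =
    (\<Sum>e<N. cw e / (1 + (\<Sum>l<N. of_bool (row l = row e) * cw l * x (row l) (col l))) *
      (sw e / (1 + (\<Sum>l<N. of_bool (col l = col e) * sw l * x (row l) (col l)))) * x (row e) (col e))"
proof -
  have row_sum: "(\<Sum>l<N. of_bool (row l = i) * cw l * x (row l) (col l)) = (\<Sum>j<m. real_weights v i j * x i j)"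
    if "i < n" for i
  proof -
    have "(\<Sum>l<N. of_bool (row l = i) * cw l * x (row l) (col l)) =
        (\<Sum>i'<n. \<Sum>j<m. of_bool (i' = i) * real_weights v i' j * x i' j)"
      unfolding N_def row_def col_def customer_weight_def by (rule sum_edges)
    also have "\<dots> = (\<Sum>i'<n. if i' = i then \<Sum>j<m. real_weights v i j * x i j else 0)"
      by (intro sum.cong) auto
    finally show ?thesis using that by simp
  qed
  have col_sum: "(\<Sum>l<N. of_bool (col l = j) * sw l * x (row l) (col l)) = (\<Sum>i<n. real_weights w j i * x i j)"
    if "j < m" for j
  proof -
    have "(\<Sum>l<N. of_bool (col l = j) * sw l * x (row l) (col l)) =
        (\<Sum>i<n. \<Sum>j'<m. of_bool (j' = j) * real_weights w j' i * x i j')"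
      unfolding N_def row_def col_def supplier_weight_def by (rule sum_edges)
    also have "\<dots> = (\<Sum>i<n. \<Sum>j'<m. if j' = j then real_weights w j i * x i j else 0)"
      by (intro sum.cong) auto
    finally show ?thesis using that by simp
  qed
  have "fs_objective n m (real_weights v) (real_weights w) x = (\<Sum>e<N. real_weights w (col e) (row e) / (1 + (\<Sum>k<n. real_weights w (col e) k * x k (col e)))
                  * (real_weights v (row e) (col e) / (1 + (\<Sum>l<m. real_weights v (row e) l * x (row e) l))) * x (row e) (col e))"
    unfolding fs_objective_def N_def row_def col_def by (rule sum_edges[symmetric])
  also have "\<dots> = (\<Sum>e<N. cw e / (1 + (\<Sum>l<N. of_bool (row l = row e) * cw l * x (row l) (col l))) *
      (sw e / (1 + (\<Sum>l<N. of_bool (col l = col e) * sw l * x (row l) (col l)))) * x (row e) (col e))"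
  proof (rule sum.cong[OF refl], goal_cases)
    case (1 e)
    then have rc: "row e < n" "col e < m" using row_col[of e] by auto
    show ?case unfolding row_sum[OF rc(1)] col_sum[OF rc(2)]
      by (simp add: customer_weight_def supplier_weight_def mult_ac)
  qed
  finally show ?thesis .
qed

definition h :: "nat \<Rightarrow> real" where "h e = H e / (64 * real_of_int U ^ 2)"

lemma h_nonneg: "0 \<le> h e"
  by (simp add: h_def H_nonneg)

lemma sum_h: "(\<Sum>e\<in>S. of_bool (P e) * h e) = real_of_int (\<Sum>e\<in>S. of_bool (P e) * H e) / (64 * real_of_int U ^ 2)"
  by (simp add: h_def sum_divide_distrib del: sum_of_bool_mult_eq sum_mult_of_bool_eq)

text \<open>Dividing \<open>H_cover\<close> by \<open>64 * U ^ 3\<close> gives the hypothesis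
  \<open>cover\<close> for an optimal solution \<open>x\<close>.\<close>

lemma OPT_le: "63 / 64 * OPT_FS n m (real_weights v) (real_weights w) \<le> 2 * (\<Sum>e<N. h e)"
proof -
  have "(\<lambda>i j. 0) \<in> fs_solutions n m" by (simp add: fs_solutions_def)
  then have "OPT_FS n m (real_weights v) (real_weights w) \<in>
      fs_objective n m (real_weights v) (real_weights w) ` fs_solutions n m"
    unfolding OPT_FS_def by (intro Max_in finite_fs_objectives) auto
  then obtain x where x: "x \<in> fs_solutions n m"
    "OPT_FS n m (real_weights v) (real_weights w) = fs_objective n m (real_weights v) (real_weights w) x"
    by blast
  show ?thesis
    unfolding x(2) fs_objective_eq
  proof (rule dual_bound)
    fix e assume e: "e \<in> {..<N}"
    then show "x (row e) (col e) \<in> {0, 1}" using x(1) row_col[of e] by (simp add: fs_solutions_def)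
    define u where "u = real_of_int U"
    have u: "0 < u" using U_pos by (simp add: u_def)
    define a where "a = cw e / (1 + cw e)"
    define b where "b = sw e / (1 + sw e)"
    have AB: "real_of_int (A e) = u * a" "real_of_int (B e) = u * b"
      using e scaled_weights[of e] by (simp_all add: u_def a_def b_def)
    define P where "P = (\<Sum>e'<N. of_bool (row e' = row e) * H e')"
    define Q where "Q = (\<Sum>e'<N. of_bool (col e' = col e) * H e')"
    have "63 * A e * B e * U \<le> P * A e + Q * B e + H e * (2 * U - A e - B e)"
      using e unfolding P_def Q_def by (intro H_cover) simp
    then have "real_of_int (63 * A e * B e * U) \<le> real_of_int (P * A e + Q * B e + H e * (2 * U - A e - B e))"
      by (simp only: of_int_le_iff)
    then have "63 * (u * a) * (u * b) * u \<le> P * (u * a) + Q * (u * b) + H e * (2 * u - u * a - u * b)"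
      by (simp add: AB u_def[symmetric])
    then have "u * (63 * a * b * u ^ 2) \<le> u * (P * a + Q * b + H e * (2 - a - b))"
      by (simp add: algebra_simps power2_eq_square)
    then have "63 * a * b * u ^ 2 \<le> P * a + Q * b + H e * (2 - a - b)"
      using u by (simp only: mult_le_cancel_left_pos)
    then have "63 / 64 * (a * b) \<le> (P * a + Q * b + H e * (2 - a - b)) / (64 * u ^ 2)"
      using u by (simp add: field_simps)
    then show "63 / 64 * (cw e / (1 + cw e) * (sw e / (1 + sw e))) \<le>
        cw e / (1 + cw e) * (\<Sum>e'<N. of_bool (row e' = row e) * h e') +
        sw e / (1 + sw e) * (\<Sum>e'<N. of_bool (col e' = col e) * h e') +
        h e * (2 - cw e / (1 + cw e) - sw e / (1 + sw e))"
      unfolding sum_h a_def[symmetric] b_def[symmetric] P_def[symmetric] Q_def[symmetric] h_def[of e] u_def[symmetric]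
      by (simp add: add_divide_distrib mult_ac)
  qed (auto simp: weights_nonneg h_nonneg)
qed

section \<open>The fractional solution, its value and its loads\<close>

definition y :: "nat \<Rightarrow> real" where "y e = real (Y e) / 2 ^ 6"

lemma Y_props: "e < N \<Longrightarrow> int (Y e) = Z (edge e)" "e < N \<Longrightarrow> Y e \<le> 2 ^ 6"
  using Z_props[OF edge_less[of e]] by (auto simp: Y_def)

text \<open>Steps 0 to \<open>t\<close> treat exactly the edges from \<open>edge t\<close>
  upwards.\<close>

lemma sum_from_edge: "t < N \<Longrightarrow> (\<Sum>e\<in>{edge t..<N}. f e) = (\<Sum>t'<Suc t. f (edge t'))"
  by (rule sum.reindex_bij_witness[of _ edge edge]) (auto simp: edge_def)

lemma load_eq:
  assumes "t < N"
  shows "(\<Sum>e\<in>{edge t..<N}. of_bool (row e = i) * (cw e / (1 + cw e) * y e)) = row_load (Suc t) i / (64 * U)"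
    "(\<Sum>e\<in>{edge t..<N}. of_bool (col e = i) * (sw e / (1 + sw e) * y e)) = col_load (Suc t) i / (64 * U)"
proof -
  have eq: "q * y e = real_of_int (a * Z (edge e)) / (64 * U)"
    if "e < N" "real_of_int a = U * q" for a e and q :: real
  proof -
    have "real_of_int (Z (edge e)) = real (Y e)" using Y_props(1)[OF that(1)] by (metis of_int_of_nat_eq)
    then show ?thesis using that U_pos by (simp add: y_def field_simps)
  qed
  have "edge t' < N" "edge (edge t') = t'" if "t' < Suc t" for t'
    using that assms by (auto simp: edge_def)
  with eq[OF _ scaled_weights(1)] eq[OF _ scaled_weights(2)] have scaled:
    "cw (edge t') / (1 + cw (edge t')) * y (edge t') = real_of_int (A (edge t') * Z t') / (64 * U)"
    "sw (edge t') / (1 + sw (edge t')) * y (edge t') = real_of_int (B (edge t') * Z t') / (64 * U)"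
    if "t' < Suc t" for t'
    using that by metis+
  show "(\<Sum>e\<in>{edge t..<N}. of_bool (row e = i) * (cw e / (1 + cw e) * y e)) = row_load (Suc t) i / (64 * U)"
    unfolding sum_from_edge[OF assms] row_load_def of_int_sum sum_divide_distrib
  proof (rule sum.cong[OF refl], goal_cases)
    case (1 t')
    then show ?case by (subst scaled) auto
  qed
  show "(\<Sum>e\<in>{edge t..<N}. of_bool (col e = i) * (sw e / (1 + sw e) * y e)) = col_load (Suc t) i / (64 * U)"
    unfolding sum_from_edge[OF assms] col_load_def of_int_sum sum_divide_distrib
  proof (rule sum.cong[OF refl], goal_cases)
    case (1 t')
    then show ?case by (subst scaled) auto
  qed
qed

text \<open>\<open>profit\<close> is \<open>H_profit\<close> divided by \<open>64 * U ^ 3\<close>,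
  and \<open>full\<close> is the alternative in \<open>Z_props\<close>: the value 64 means
  \<open>y e = 1\<close>, and a load of \<open>21 * U\<close> means \<open>21/64\<close>.\<close>

lemma charging: "21 / 64 * (\<Sum>e<N. h e) \<le> (\<Sum>e<N. y e * (cw e / (1 + cw e) * (sw e / (1 + sw e))))"
proof (rule charging_bound)
  fix e assume e: "e < N"
  show "cw e / (1 + cw e) \<in> {0..1}" "sw e / (1 + sw e) \<in> {0..1}"
    using weights_nonneg[OF e] by auto
  show "0 \<le> h e" by (rule h_nonneg)
  show "0 \<le> y e" by (simp add: y_def)
  define u where "u = real_of_int U"
  have u: "0 < u" using U_pos by (simp add: u_def)
  define a where "a = cw e / (1 + cw e)"
  define b where "b = sw e / (1 + sw e)"
  have AB: "real_of_int (A e) = u * a" "real_of_int (B e) = u * b"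
    using e scaled_weights[of e] by (simp_all add: u_def a_def b_def)
  show "h e + cw e / (1 + cw e) * (\<Sum>e'<e. of_bool (row e' = row e) * h e')
      + sw e / (1 + sw e) * (\<Sum>e'<e. of_bool (col e' = col e) * h e')
      \<le> cw e / (1 + cw e) * (sw e / (1 + sw e))" if "0 < y e"
  proof -
    define P where "P = (\<Sum>e'<e. of_bool (row e' = row e) * H e')"
    define Q where "Q = (\<Sum>e'<e. of_bool (col e' = col e) * H e')"
    \<comment> \<open>Only edges with a positive raise receive a positive amount, so
      \<open>H_profit\<close> is applicable.\<close>
    have "Z (edge e) \<noteq> 0" using that Y_props(1)[OF e] by (simp add: y_def)
    then have "0 < H e" using Z_eq[of "edge e"] edge_edge[OF e] by (auto split: if_splits)
    then have "H e * U + A e * P + B e * Q \<le> 64 * A e * B e * U"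
      unfolding P_def Q_def by (rule H_profit[OF e])
    then have "real_of_int (H e * U + A e * P + B e * Q) \<le> real_of_int (64 * A e * B e * U)"
      by (simp only: of_int_le_iff)
    then have "u * (H e + a * P + b * Q) \<le> u * (64 * u ^ 2 * (a * b))"
      by (simp add: AB u_def[symmetric] algebra_simps power2_eq_square)
    then have "H e + a * P + b * Q \<le> 64 * u ^ 2 * (a * b)"
      using u by (simp only: mult_le_cancel_left_pos)
    then have "(H e + a * P + b * Q) / (64 * u ^ 2) \<le> a * b"
      using u by (simp add: field_simps)
    then show ?thesis
      unfolding sum_h a_def[symmetric] b_def[symmetric] P_def[symmetric] Q_def[symmetric] h_def[of e] u_def[symmetric]
      by (simp add: add_divide_distrib)
  qed
  show "21 / 64 \<le> y e \<or>
      21 / 64 \<le> (\<Sum>e'\<in>{e..<N}. of_bool (row e' = row e) * (cw e' / (1 + cw e') * y e')) \<or>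
      21 / 64 \<le> (\<Sum>e'\<in>{e..<N}. of_bool (col e' = col e) * (sw e' / (1 + sw e') * y e'))" if "0 < h e"
  proof -
    have H: "0 < H (edge (edge e))"
      using that u e by (simp add: h_def edge_edge u_def zero_less_divide_iff)
    have load: "21 / 64 \<le> real_of_int L / (64 * U)" if "21 * U \<le> L" for L
    proof -
      have "real_of_int (21 * U) \<le> real_of_int L" using that by (simp only: of_int_le_iff)
      then show ?thesis using u by (simp add: u_def field_simps)
    qed
    consider "Z (edge e) = 64" | "21 * U \<le> row_load (Suc (edge e)) (row e)" | "21 * U \<le> col_load (Suc (edge e)) (col e)"
      using Z_props(3)[OF edge_less[OF e] H] edge_edge[OF e] by auto
    then show ?thesis
    proof cases
      case 1
      then show ?thesis by (simp add: y_def Y_def)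
    qed (use load load_eq[OF edge_less[OF e]] edge_edge[OF e] in auto)
  qed
qed

text \<open>After the last step \<open>N - 1\<close> the loads range over all edges. For
  \<open>N = 0\<close> there is no last step, but the sums are empty.\<close>

lemma load_le: "(\<Sum>l<N. of_bool (row l = i) * (cw l / (1 + cw l) * y l)) \<le> 22 / 64"
  "(\<Sum>l<N. of_bool (col l = i) * (sw l / (1 + sw l) * y l)) \<le> 22 / 64"
proof -
  have load: "real_of_int L / (64 * U) \<le> 22 / 64" if "L \<in> {0..22 * U}" for L
  proof -
    have "real_of_int L \<le> real_of_int (22 * U)" using that by (simp only: of_int_le_iff atLeastAtMost_iff)
    then show ?thesis using U_pos by (simp add: field_simps)
  qed
  consider "N = 0" | t where "N = Suc t" by (cases N) auto
  then have "(\<Sum>l<N. of_bool (row l = i) * (cw l / (1 + cw l) * y l)) \<le> 22 / 64 \<and>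
      (\<Sum>l<N. of_bool (col l = i) * (sw l / (1 + sw l) * y l)) \<le> 22 / 64"
  proof cases
    case 2
    then have "{..<N} = {edge t..<N}" "t < N" by (auto simp: edge_def)
    then show ?thesis using load_eq[of t i] load[of "row_load N i"] load[of "col_load N i"] load_bounds[of N i i] 2
      by simp
  qed simp
  then show "(\<Sum>l<N. of_bool (row l = i) * (cw l / (1 + cw l) * y l)) \<le> 22 / 64"
    "(\<Sum>l<N. of_bool (col l = i) * (sw l / (1 + sw l) * y l)) \<le> 22 / 64" by auto
qed

lemma expected_objective_ge:
  assumes T: "6 * N \<le> T"
    and x: "\<And>r i j. length r = T \<Longrightarrow> i < n \<Longrightarrow> j < m \<Longrightarrow> x r i j = rounded 6 Y r (i * m + j)"
  shows "0.067 * OPT_FS n m (real_weights v) (real_weights w) \<le>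
    measure_pmf.expectation (pmf_of_set {r. length r = T})
      (\<lambda>r. fs_objective n m (real_weights v) (real_weights w) (x r))"
proof -
  let ?E = "measure_pmf.expectation (pmf_of_set {r. length r = T})"
  define f where "f z = (\<Sum>e<N. cw e / (1 + (\<Sum>l<N. of_bool (row l = row e) * cw l * z l)) *
      (sw e / (1 + (\<Sum>l<N. of_bool (col l = col e) * sw l * z l))) * z e)" for z
  have xr: "x r (row e) (col e) = rounded 6 Y r e" if "length r = T" "e < N" for r e
    using x[OF that(1) row_col(1,2)[OF that(2)]] row_col(3)[of e] by simp
  have obj: "fs_objective n m (real_weights v) (real_weights w) (x r) = f (rounded 6 Y r)" if "length r = T" for r
    unfolding fs_objective_eq f_def using xr[OF that] by simp
  define G where "G = (\<Sum>e<N. y e * (cw e / (1 + cw e) * (sw e / (1 + sw e))))"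
  have "(1 - 22 / 64)\<^sup>2 * G \<le> ?E (\<lambda>r. f (rounded 6 Y r))"
    unfolding G_def y_def f_def
    by (rule rounding_bound)
      (use T Y_props inj_edge weights_nonneg load_le[unfolded y_def] in auto)
  also have "?E (\<lambda>r. f (rounded 6 Y r)) = ?E (\<lambda>r. fs_objective n m (real_weights v) (real_weights w) (x r))"
    using obj finite_tapes tapes_nonempty by (intro integral_cong_AE) (auto simp: AE_measure_pmf_iff)
  finally have round: "(1 - 22 / 64)\<^sup>2 * G \<le>
    ?E (\<lambda>r. fs_objective n m (real_weights v) (real_weights w) (x r))" .
  have opt0: "0 \<le> OPT_FS n m (real_weights v) (real_weights w)"
  proof -
    have "fs_objective n m (real_weights v) (real_weights w) (\<lambda>i j. 0) \<le> OPT_FS n m (real_weights v) (real_weights w)"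
      unfolding OPT_FS_def by (intro Max_ge finite_fs_objectives imageI) (simp add: fs_solutions_def)
    then show ?thesis by (simp add: fs_objective_def)
  qed
  \<comment> \<open>The constant on the right is about 0.0695: \<open>(42/64)^2\<close> from
    rounding, \<open>21/64\<close> from charging and \<open>63/128\<close> from the dual
    bound.\<close>
  have "0.067 * OPT_FS n m (real_weights v) (real_weights w) \<le>
      (1 - 22 / 64)\<^sup>2 * (21 / 64 * (63 / 128 * OPT_FS n m (real_weights v) (real_weights w)))"
    using opt0 by (simp add: power2_eq_square)
  also have "\<dots> \<le> (1 - 22 / 64)\<^sup>2 * G"
    using OPT_le charging by (intro mult_left_mono) (auto simp: G_def)
  finally show ?thesis using round by simp
qed

end

lemma output_feasible:
  assumes "\<And>i j. i < n \<Longrightarrow> j < m \<Longrightarrow> x i j = rounded k Y r (i * m + j)"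
  shows "x \<in> fs_solutions n m"
  using assms by (simp add: fs_solutions_def rounded_def)

theorem theorem5p1:
  shows "\<exists>c. approximation_algorithm 0.067 c"
proof -
  obtain K0 K1 K2 K3 where K: "loop_cost product_step K0" "loop_cost push_step K1"
    "loop_cost pop_step K2" "loop_cost round_step K3"
    using loop_cost_exists[OF loop_free_steps(1)] loop_cost_exists[OF loop_free_steps(2)]
      loop_cost_exists[OF loop_free_steps(3)] loop_cost_exists[OF loop_free_steps(4)] by blast
  \<comment> \<open>The factors are \<open>cell_bits\<close> and a bound on \<open>N + 1\<close> in
    terms of the input size. The last summand makes the tape long enough for six flips per
    edge.\<close>
  define p where "p = [:1 + bits 0 + bits 1:] + smult (K0 + K1 + K2 + K3) ([:10, 3:] * [:1, 1:]) + [:0, 6:]"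
  have p: "poly p x = 1 + bits 0 + bits 1 + (K0 + K1 + K2 + K3) * (3 * x + 10) * (x + 1) + 6 * x" for x
    by (simp add: p_def algebra_simps)
  have "approximation_algorithm 0.067 fs_program"
    unfolding approximation_algorithm_def Let_def
  proof (rule exI[of _ p], intro allI impI)
    fix n m v w assume inst: "mnl_instance n m v w"
    interpret fs_input n m v w by unfold_locales (rule inst)
    let ?T = "poly p (input_size n m v w)"
    let ?x = "\<lambda>r. output_solution m (final_memory fs_program (input_memory n m v w) r)"
    have T: "?T = 1 + bits 0 + bits 1 + (K0 + K1 + K2 + K3) * cell_bits * (total_size + 1) + 6 * total_size"
      by (simp add: p cell_bits_def total_size_def)
    have "6 * N \<le> ?T" unfolding T using N_le_size by simp
    have *: "(\<exists>t s' r'. exec fs_program (input_memory n m v w, r) t (s', r') \<and> t \<le> ?T) \<and>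
        (\<forall>i<n. \<forall>j<m. ?x r i j = rounded 6 Y r (i * m + j))" if "length r = ?T" for r
    proof -
      have "6 * N \<le> length r" using \<open>6 * N \<le> ?T\<close> that by simp
      from exec_fs_program[OF K this] obtain t s' r' where e: "exec fs_program (input_memory n m v w, r) t (s', r')"
        "t \<le> 1 + bits 0 + bits 1 + (K0 + K1 + K2 + K3) * cell_bits * (N + 1)"
        "\<forall>e<N. real_of_int (s' ''x'' (int e)) = rounded 6 Y r e"
        by blast
      have "(K0 + K1 + K2 + K3) * cell_bits * (N + 1) \<le> (K0 + K1 + K2 + K3) * cell_bits * (total_size + 1)"
        using N_le_size by (intro mult_le_mono2) simp
      with e(2) have "t \<le> ?T" unfolding T by linarith
      moreover have "?x r i j = rounded 6 Y r (i * m + j)" if "i < n" "j < m" for i j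
      proof -
        have "i * m + j < (i + 1) * m" "(i + 1) * m \<le> n * m"
          using that by (simp, intro mult_le_mono1, simp)
        then have "i * m + j < N" by (simp add: N_def)
        with e show ?thesis by (simp only: output_solution_def final_memory_eq[OF e(1)])
      qed
      ultimately show ?thesis using e(1) by blast
    qed
    have feas: "?x r \<in> fs_solutions n m" if "length r = ?T" for r
      using *[OF that] by (intro output_feasible[of n m _ 6 Y r]) blast
    have "0.067 * OPT_FS n m (real_weights v) (real_weights w) \<le>
        measure_pmf.expectation (pmf_of_set {r. length r = ?T})
          (\<lambda>r. fs_objective n m (real_weights v) (real_weights w) (?x r))"
      using * by (intro expected_objective_ge[OF \<open>6 * N \<le> ?T\<close>]) blast
    also have "\<dots> = measure_pmf.expectation (pmf_of_set {r. length r = ?T})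
          (\<lambda>r. solution_matches n m (real_weights v) (real_weights w) (?x r))"
    proof (intro integral_cong_AE)
      show "AE r in measure_pmf (pmf_of_set {r. length r = ?T}).
          fs_objective n m (real_weights v) (real_weights w) (?x r) =
          solution_matches n m (real_weights v) (real_weights w) (?x r)"
        using feas inst finite_tapes tapes_nonempty
        by (auto simp: AE_measure_pmf_iff real_weights_def mnl_instance_def
            intro!: solution_matches_eq_objective[symmetric])
    qed auto
    finally show "(\<forall>r\<in>{r. length r = ?T}. (\<exists>t s' r'. exec fs_program (input_memory n m v w, r) t (s', r') \<and>
        t \<le> ?T) \<and> ?x r \<in> fs_solutions n m) \<and>
      0.067 * OPT_FS n m (real_weights v) (real_weights w) \<le>
        measure_pmf.expectation (pmf_of_set {r. length r = ?T})
          (\<lambda>r. solution_matches n m (real_weights v) (real_weights w) (?x r))"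
      using * feas by blast
  qed
  then show ?thesis by blast
qed

end
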